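(* Let $(\mathcal{G},\underline{a})$ be a finite metric graph with at least one internal edge, and let $A,B$ be linear maps in $\mathcal{K}$ with $(A,\,B)\colon\mathcal{K}\oplus\mathcal{K}\to\mathcal{K}$ surjective and $AB^*$ self-adjoint, so that $-\Delta(A,B)$ is self-adjoint. Let $-\kappa_1^2\le\dots\le-\kappa_n^2<0$ be the negative eigenvalues of $-\Delta(A,B)$ counted with multiplicity, $\kappa_1\ge\dots\ge\kappa_n>0$, and let $m_1\ge\dots\ge m_n>0$ be the $n$ largest positive eigenvalues of $L$ counted with multiplicity. Then $$0<\kappa_i\le\nu(m_i,a_{\min}),\qquad 1\le i\le n.$$ If $n\ge 1$, the lower bound $-\nu(m_1,a_{\min})^2\le-\Delta(A,B)$ on the spectrum is optimal (i.e. $\kappa_1=\nu(m_1,a_{\min})$) if and only if $$\operatorname{span}\left\{\begin{bmatrix}0\\ e_i\\ e_i\end{bmatrix}\ \Big|\ i\in\mathcal{I},\ a_i=a_{\min}\right\}\cap\operatorname{Ker}(L-m_1)\neq\{0\},$$ where $e_i$ is the $i$-th canonical basis vector of $\mathbb{C}^{|\mathcal{I}|}$ and vectors are written with respect to $\mathcal{K}=\mathcal{K}_{\mathcal{E}}\oplus\mathcal{K}_{\mathcal{I}}^-\oplus\mathcal{K}_{\mathcal{I}}^+$. Furthermore, whenever $m_i-\frac{2}{a_{\min}}>0$, one has $$\eta\Bigl(m_i-\tfrac{2}{a_{\min}},a_{\min}\Bigr)\le\kappa_i.$$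
   Context: A finite metric graph consists of finitely many vertices, a finite set $\mathcal{I}$ of internal edges and a finite set $\mathcal{E}$ of external edges; each internal edge $i$ is identified with an interval $[0,a_i]$, $a_i>0$, each external edge with $[0,\infty)$; $\underline{a}=\{a_i\}_{i\in\mathcal{I}}$, $a_{\min}=\min_i a_i$. The Hilbert space is $\mathcal{H}=\bigoplus_{j}L^2(I_j)$, $I_j$ the interval of edge $j$. Let $\mathcal{D}$ be the set of $\psi\in\mathcal{H}$ with each $\psi_j,\psi_j'$ absolutely continuous and $\psi_j''\in L^2(I_j)$. Let $\mathcal{K}=\mathcal{K}_{\mathcal{E}}\oplus\mathcal{K}_{\mathcal{I}}^-\oplus\mathcal{K}_{\mathcal{I}}^+$ with $\mathcal{K}_{\mathcal{E}}\cong\mathbb{C}^{|\mathcal{E}|}$, $\mathcal{K}_{\mathcal{I}}^\pm\cong\mathbb{C}^{|\mathcal{I}|}$, and for $\psi\in\mathcal{D}$ set $\underline{\psi}=(\{\psi_e(0)\}_{e\in\mathcal{E}},\{\psi_i(0)\}_{i\in\mathcal{I}},\{\psi_i(a_i)\}_{i\in\mathcal{I}})$, $\underline{\psi'}=(\{\psi_e'(0)\}_{e},\{\psi_i'(0)\}_{i},\{-\psi_i'(a_i)\}_{i})$. The operator $\Delta(A,B)$ acts by $(\Delta\psi)_j=\psi_j''$ on $\{\psi\in\mathcal{D}: A\underline{\psi}+B\underline{\psi'}=0\}$. Let $P$ be the orthogonal projector onto $\operatorname{Ker}B$, $P^\perp=1-P$, and $L=(B|_{\operatorname{Ran}B^*})^{-1}AP^\perp$,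 a Hermitian operator in $\operatorname{Ran}P^\perp$. (It is known that $L$ has at least $n$ positive eigenvalues, where $n$ is the number of negative eigenvalues of $-\Delta(A,B)$.) For $m>0$, $a>0$, $\nu(m,a)$ is the unique positive solution $\kappa$ of $m=\kappa\tanh(\kappa a/2)$, and for $l>0$, $\eta(l,a)$ is the unique positive solution $\kappa$ of $l=\frac{\kappa}{\tanh(\kappa a/2)}-\frac{2}{a}$. *)

theory Defs
  imports "HOL-Analysis.Analysis" "Jordan_Normal_Form.Schur_Decomposition"
begin

text \<open>A finite metric graph is encoded by the number ne of external edges
(indexed 0..<ne, each identified with [0,infinity)), the number ni of internal
edges (indexed 0..<ni, internal edge i identified with [0, a i]) and the lengths a.
Edge j < ne + ni of the combined index set is external if j < ne and the internal
edge j - ne otherwise.  The space K is complex^(ne + 2 ni), with coordinates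
ordered as K_E (0..<ne), K_I^- (ne..<ne+ni), K_I^+ (ne+ni..<ne+2ni).\<close>

definition dimK :: "nat \<Rightarrow> nat \<Rightarrow> nat" where
  "dimK ne ni = ne + 2 * ni"

definition edge_interval :: "nat \<Rightarrow> (nat \<Rightarrow> real) \<Rightarrow> nat \<Rightarrow> real set" where
  "edge_interval ne a j = (if j < ne then {0..} else {0 .. a (j - ne)})"

definition a_min :: "nat \<Rightarrow> (nat \<Rightarrow> real) \<Rightarrow> real" where
  "a_min ni a = Min (a ` {..<ni})"

definition edge_deriv ::
  "nat \<Rightarrow> (nat \<Rightarrow> real) \<Rightarrow> (nat \<Rightarrow> real \<Rightarrow> complex) \<Rightarrow> nat \<Rightarrow> real \<Rightarrow> complex" where
  "edge_deriv ne a \<psi> j x = vector_derivative (\<psi> j) (at x within edge_interval ne a j)"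

definition bval ::
  "nat \<Rightarrow> nat \<Rightarrow> (nat \<Rightarrow> real) \<Rightarrow> (nat \<Rightarrow> real \<Rightarrow> complex) \<Rightarrow> complex vec" where
  "bval ne ni a \<psi> = vec (dimK ne ni) (\<lambda>k.
      if k < ne then \<psi> k 0
      else if k < ne + ni then \<psi> k 0
      else \<psi> (k - ni) (a (k - ne - ni)))"

definition bder ::
  "nat \<Rightarrow> nat \<Rightarrow> (nat \<Rightarrow> real) \<Rightarrow> (nat \<Rightarrow> real \<Rightarrow> complex) \<Rightarrow> complex vec" where
  "bder ne ni a \<psi> = vec (dimK ne ni) (\<lambda>k.
      if k < ne then edge_deriv ne a \<psi> k 0
      else if k < ne + ni then edge_deriv ne a \<psi> k 0
      else - edge_deriv ne a \<psi> (k - ni) (a (k - ne - ni)))"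

text \<open>psi is an eigenfunction (possibly zero) of -Delta(A,B) for the eigenvalue lam,
i.e. psi lies in the domain (with the boundary condition) and -psi'' = lam psi
on every edge.  Solutions of psi'' = -lam psi in the Sobolev domain are smooth,
so the domain condition reduces to twice differentiability on the closed edges
plus square integrability on the external edges.\<close>
definition is_eigfun ::
  "nat \<Rightarrow> nat \<Rightarrow> (nat \<Rightarrow> real) \<Rightarrow> complex mat \<Rightarrow> complex mat \<Rightarrow> real
     \<Rightarrow> (nat \<Rightarrow> real \<Rightarrow> complex) \<Rightarrow> bool" where
  "is_eigfun ne ni a A B lam \<psi> \<longleftrightarrow>
     (\<forall>j < ne + ni. \<forall>x \<in> edge_interval ne a j.
         \<psi> j differentiable (at x within edge_interval ne a j) \<and>
         (edge_deriv ne a \<psi> j has_vector_derivative (- complex_of_real lam * \<psi> j x))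
            (at x within edge_interval ne a j)) \<and>
     (\<forall>j < ne. (\<lambda>x. (cmod (\<psi> j x))\<^sup>2) integrable_on {0..}) \<and>
     A *\<^sub>v bval ne ni a \<psi> + B *\<^sub>v bder ne ni a \<psi> = 0\<^sub>v (dimK ne ni)"

text \<open>Linear independence of k functions on the graph (as elements of the L^2 space,
i.e. only their values on the edges matter).\<close>
definition fun_indep ::
  "nat \<Rightarrow> (nat \<Rightarrow> real) \<Rightarrow> nat \<Rightarrow> nat \<Rightarrow> (nat \<Rightarrow> nat \<Rightarrow> real \<Rightarrow> complex) \<Rightarrow> bool" where
  "fun_indep ne a ni k \<psi>s \<longleftrightarrow>
     (\<forall>c :: nat \<Rightarrow> complex.
        (\<forall>j < ne + ni. \<forall>x \<in> edge_interval ne a j. (\<Sum>l<k. c l * \<psi>s l j x) = 0)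
        \<longrightarrow> (\<forall>l<k. c l = 0))"

definition eig_mult ::
  "nat \<Rightarrow> nat \<Rightarrow> (nat \<Rightarrow> real) \<Rightarrow> complex mat \<Rightarrow> complex mat \<Rightarrow> real \<Rightarrow> enat" where
  "eig_mult ne ni a A B lam = Sup {enat k | k. \<exists>\<psi>s.
      (\<forall>l<k. is_eigfun ne ni a A B lam (\<psi>s l)) \<and> fun_indep ne a ni k \<psi>s}"

definition ran_adjB :: "nat \<Rightarrow> complex mat \<Rightarrow> complex vec set" where
  "ran_adjB d B = {mat_adjoint B *\<^sub>v y | y. y \<in> carrier_vec d}"

text \<open>P-perp: orthogonal projector onto the orthogonal complement of Ker B,
which is Ran B*.\<close>
definition Pperp :: "nat \<Rightarrow> complex mat \<Rightarrow> complex vec \<Rightarrow> complex vec" where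
  "Pperp d B x = (THE y. y \<in> ran_adjB d B \<and> (\<forall>z \<in> ran_adjB d B. (x - y) \<bullet>c z = 0))"

definition Lop :: "nat \<Rightarrow> complex mat \<Rightarrow> complex mat \<Rightarrow> complex vec \<Rightarrow> complex vec" where
  "Lop d A B x = (THE y. y \<in> ran_adjB d B \<and> B *\<^sub>v y = A *\<^sub>v Pperp d B x)"

text \<open>Ker(L - mu), L regarded as an operator in Ran P-perp.\<close>
definition kerL :: "nat \<Rightarrow> complex mat \<Rightarrow> complex mat \<Rightarrow> real \<Rightarrow> complex vec set" where
  "kerL d A B mu = {x \<in> ran_adjB d B. Lop d A B x = complex_of_real mu \<cdot>\<^sub>v x}"

definition vec_indep :: "nat \<Rightarrow> nat \<Rightarrow> (nat \<Rightarrow> complex vec) \<Rightarrow> bool" where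
  "vec_indep d k vs \<longleftrightarrow>
     (\<forall>c :: nat \<Rightarrow> complex. (\<forall>r<d. (\<Sum>l<k. c l * vec_index (vs l) r) = 0) \<longrightarrow> (\<forall>l<k. c l = 0))"

definition L_mult :: "nat \<Rightarrow> complex mat \<Rightarrow> complex mat \<Rightarrow> real \<Rightarrow> enat" where
  "L_mult d A B mu = Sup {enat k | k. \<exists>vs. (\<forall>l<k. vs l \<in> kerL d A B mu) \<and> vec_indep d k vs}"

definition nu :: "real \<Rightarrow> real \<Rightarrow> real" where
  "nu m a = (THE \<kappa>. \<kappa> > 0 \<and> m = \<kappa> * tanh (\<kappa> * a / 2))"

definition eta :: "real \<Rightarrow> real \<Rightarrow> real" where
  "eta l a = (THE \<kappa>. \<kappa> > 0 \<and> l = \<kappa> / tanh (\<kappa> * a / 2) - 2 / a)"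

definition e_int :: "nat \<Rightarrow> nat \<Rightarrow> nat \<Rightarrow> complex vec" where
  "e_int ne ni i = vec (dimK ne ni) (\<lambda>k. if k = ne + i \<or> k = ne + ni + i then 1 else 0)"

definition span_min :: "nat \<Rightarrow> nat \<Rightarrow> (nat \<Rightarrow> real) \<Rightarrow> complex vec set" where
  "span_min ne ni a = {vec (dimK ne ni) (\<lambda>k. \<Sum>i\<in>{i. i < ni \<and> a i = a_min ni a}.
                          c i * vec_index (e_int ne ni i) k) | c. True}"

end

theory Submission
  imports Defs
begin

text \<open>On every edge an eigenfunction for \<open>- k\<^sup>2\<close> is determined by its boundary vector \<open>u\<close>, and its
boundary derivatives are \<open>- M(k) u\<close>, where the Dirichlet-to-Neumann matrix \<open>M(k)\<close> has the eigenvalues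
\<open>k\<close> (external edges) and \<open>k tanh (k a\<^sub>i / 2)\<close>, \<open>k / tanh (k a\<^sub>i / 2)\<close> (symmetric and antisymmetric part
on the internal edges).  The boundary condition becomes \<open>u \<in> Ran B\<^sup>*\<close> and \<open>L u = P\<^sup>\<bottom> M(k) u\<close>, that is,
\<open>u\<close> lies in the kernel of a Hermitian matrix \<open>H(k)\<close>, the compression of \<open>L - M(k)\<close>.  The ordered
eigenvalues of \<open>H(k)\<close> are continuous and strictly decreasing in \<open>k\<close> and eventually negative, so
\<open>\<kappa>\<^sub>i \<ge> k\<close> holds iff the \<open>i\<close>-th eigenvalue of \<open>H(k)\<close> is nonnegative.  The bounds follow by comparing
\<open>H(k)\<close> with \<open>L\<close> through \<open>k tanh (k a\<^sub>m\<^sub>i\<^sub>n / 2) \<le> M(k) \<le> k / tanh (k a\<^sub>m\<^sub>i\<^sub>n / 2)\<close>; equality in the upper bound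
forces an eigenvector of \<open>L\<close> for \<open>m\<^sub>1\<close> in the lowest eigenspace of \<open>M(k)\<close>.\<close>

text \<open>Both spectra are given only through the multiplicities of single values, so positions in
  the sorted lists have to be recovered by counting. A strictly decreasing branch has at most one
  zero, hence the multiplicities at all values from \<open>k\<close> on add up to the number of
  branches that are still nonnegative at \<open>k\<close>. This uses continuity of the ordered
  eigenvalues only, which comes from the same comparison of quadratic forms as their monotonicity;
  no eigenvector has to depend continuously on \<open>k\<close>. The obstacle is that L lives on Ran
  B*, a space without convenient coordinates. L is therefore extended by zero to all of K, and Ker B
  receives the weight - k, which stays within the extreme weights of - M(k), so that one comparison
  with explicit constants serves on the whole space. The shortest edge governs both bounds because
  tanh increases and coth decreases with the length. The shift 2/a in \<open>eta\<close> is the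
  limit of k / tanh (k a / 2) at k = 0: no positive k gives this function a value of 2/a or
  less.\<close>

unbundle no vec_syntax

section \<open>Matrices with complex entries\<close>

lemma square_mult_closed [simp]:
  "A \<in> carrier_mat d d \<Longrightarrow> B \<in> carrier_mat d d \<Longrightarrow> A * B \<in> carrier_mat d d"
  "A \<in> carrier_mat d d \<Longrightarrow> x \<in> carrier_vec d \<Longrightarrow> A *\<^sub>v x \<in> carrier_vec d"
  by simp_all

lemma adjoint_dim [simp]:
  "dim_row (mat_adjoint A) = dim_col A" "dim_col (mat_adjoint A) = dim_row A"
  unfolding mat_adjoint_def by auto

lemma adjoint_carrier [simp]:
  "A \<in> carrier_mat nr nc \<Longrightarrow> mat_adjoint A \<in> carrier_mat nc nr"
  by (intro carrier_matI) auto

lemma adjoint_index: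
  fixes A :: "complex mat"
  assumes "i < dim_col A" "j < dim_row A"
  shows "mat_adjoint A $$ (i, j) = cnj (A $$ (j, i))"
  using assms unfolding mat_adjoint_def by (simp add: mat_of_rows_index)

lemma cscalar_prod_sum:
  fixes x y :: "complex vec"
  assumes "y \<in> carrier_vec d"
  shows "x \<bullet>c y = (\<Sum>i<d. x $ i * cnj (y $ i))"
  using assms unfolding scalar_prod_def by (auto simp: atLeast0LessThan intro!: sum.cong)

lemma mult_mat_vec_sum:
  fixes A :: "complex mat"
  assumes "A \<in> carrier_mat nr nc" "x \<in> carrier_vec nc" "i < nr"
  shows "(A *\<^sub>v x) $ i = (\<Sum>j<nc. A $$ (i, j) * x $ j)"
  using assms by (auto simp: scalar_prod_def atLeast0LessThan intro!: sum.cong)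

lemma cscalar_prod_adjoint:
  fixes A :: "complex mat"
  assumes A: "A \<in> carrier_mat nr nc" and x: "x \<in> carrier_vec nc" and y: "y \<in> carrier_vec nr"
  shows "(A *\<^sub>v x) \<bullet>c y = x \<bullet>c (mat_adjoint A *\<^sub>v y)"
proof -
  have "(A *\<^sub>v x) \<bullet>c y = (\<Sum>i<nr. (\<Sum>j<nc. A $$ (i, j) * x $ j) * cnj (y $ i))"
    unfolding cscalar_prod_sum[OF y] using assms
    by (intro sum.cong refl) (simp add: mult_mat_vec_sum[OF A x] del: index_mult_mat_vec)
  also have "\<dots> = (\<Sum>j<nc. \<Sum>i<nr. A $$ (i, j) * x $ j * cnj (y $ i))"
    unfolding sum_distrib_right by (rule sum.swap)
  also have "\<dots> = (\<Sum>j<nc. x $ j * cnj ((mat_adjoint A *\<^sub>v y) $ j))"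
  proof (intro sum.cong refl)
    fix j assume j: "j \<in> {..<nc}"
    have "(mat_adjoint A *\<^sub>v y) $ j = (\<Sum>i<nr. mat_adjoint A $$ (j, i) * y $ i)"
      using j A y by (intro mult_mat_vec_sum) auto
    also have "\<dots> = (\<Sum>i<nr. cnj (A $$ (i, j)) * y $ i)"
      using j A by (intro sum.cong refl) (auto simp: adjoint_index)
    finally show "(\<Sum>i<nr. A $$ (i, j) * x $ j * cnj (y $ i)) = x $ j * cnj ((mat_adjoint A *\<^sub>v y) $ j)"
      by (simp add: sum_distrib_left mult_ac)
  qed
  also have "\<dots> = x \<bullet>c (mat_adjoint A *\<^sub>v y)"
    using A y by (subst cscalar_prod_sum[of _ nc]) (auto intro: mult_mat_vec_carrier adjoint_carrier)
  finally show ?thesis .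
qed

lemma adjoint_adjoint [simp]: "mat_adjoint (mat_adjoint (A :: complex mat)) = A"
  by (rule eq_matI) (auto simp: adjoint_index)

lemma adjoint_mult:
  fixes A B :: "complex mat"
  assumes A: "A \<in> carrier_mat nr n" and B: "B \<in> carrier_mat n nc"
  shows "mat_adjoint (A * B) = mat_adjoint B * mat_adjoint A"
proof (rule eq_matI)
  fix i j assume "i < dim_row (mat_adjoint B * mat_adjoint A)" "j < dim_col (mat_adjoint B * mat_adjoint A)"
  then have i: "i < nc" and j: "j < nr" using A B by auto
  have "mat_adjoint (A * B) $$ (i, j) = cnj ((A * B) $$ (j, i))"
    using i j A B by (intro adjoint_index) auto
  also have "\<dots> = (\<Sum>k<n. cnj (A $$ (j, k)) * cnj (B $$ (k, i)))"
    using i j A B by (auto simp: scalar_prod_def atLeast0LessThan)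
  also have "\<dots> = (mat_adjoint B * mat_adjoint A) $$ (i, j)"
    using i j A B by (auto simp: scalar_prod_def atLeast0LessThan adjoint_index mult.commute
        intro!: sum.cong)
  finally show "mat_adjoint (A * B) $$ (i, j) = (mat_adjoint B * mat_adjoint A) $$ (i, j)" .
qed (use A B in auto)

lemma cnj_cscalar_prod:
  fixes x y :: "complex vec"
  assumes "x \<in> carrier_vec d" "y \<in> carrier_vec d"
  shows "cnj (x \<bullet>c y) = y \<bullet>c x"
  by (simp add: cscalar_prod_sum[OF assms(1)] cscalar_prod_sum[OF assms(2)] mult.commute)

lemma cscalar_prod_self:
  fixes x :: "complex vec"
  assumes "x \<in> carrier_vec d"
  shows "x \<bullet>c x = complex_of_real (\<Sum>i<d. (cmod (x $ i))\<^sup>2)"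
  by (simp add: cscalar_prod_sum[OF assms] complex_norm_square[symmetric] del: of_real_power)

text \<open>Fewer equations than unknowns: a zero row at position \<open>r\<close> completes the
  system to a singular square matrix. This supplies the dimension counts below.\<close>

lemma homogeneous_system:
  fixes f :: "nat \<Rightarrow> nat \<Rightarrow> complex"
  assumes "r < n"
  obtains x where "x \<in> carrier_vec n" "x \<noteq> 0\<^sub>v n" "\<And>i. i < r \<Longrightarrow> (\<Sum>j<n. f i j * x $ j) = 0"
proof -
  define R where "R = mat\<^sub>r n n (\<lambda>i. if i = r then 0\<^sub>v n else vec n (f i))"
  have R: "R \<in> carrier_mat n n" by (simp add: R_def)
  have "det R = 0" unfolding R_def using assms by (intro det_row_0) auto
  then obtain x where x: "x \<in> carrier_vec n" "x \<noteq> 0\<^sub>v n" "R *\<^sub>v x = 0\<^sub>v n"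
    using det_0_iff_vec_prod_zero[OF R] by auto
  have "(\<Sum>j<n. f i j * x $ j) = 0" if "i < r" for i
  proof -
    have "(\<Sum>j<n. f i j * x $ j) = (R *\<^sub>v x) $ i"
      using that assms x(1) mult_mat_vec_sum[OF R x(1), of i] by (auto simp: R_def intro!: sum.cong)
    then show ?thesis using x(3) that assms by simp
  qed
  with x that show ?thesis by blast
qed

text \<open>A nonzero vector has a nontrivial annihilating polynomial in the matrix; peeling off its
linear factors one at a time must hit an eigenvector, without ever leaving the invariant subspace.\<close>

lemma eigenvector_in_invariant_subspace:
  fixes A :: "complex mat"
  assumes A: "A \<in> carrier_mat d d"
    and W: "W \<subseteq> carrier_vec d"
    and inv: "\<And>x e. x \<in> W \<Longrightarrow> A *\<^sub>v x - e \<cdot>\<^sub>v x \<in> W"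
    and x: "x \<in> W" "x \<noteq> 0\<^sub>v d"
  obtains y e where "y \<in> W" "y \<noteq> 0\<^sub>v d" "A *\<^sub>v y = e \<cdot>\<^sub>v y"
proof -
  define pw where "pw i z = ((\<lambda>z. A *\<^sub>v z) ^^ i) z" for i z
  have pw_carrier: "pw i z \<in> carrier_vec d" if "z \<in> carrier_vec d" for i z
    using that A by (induction i) (auto simp: pw_def)
  have pw_diff: "pw i (A *\<^sub>v z - e \<cdot>\<^sub>v z) = pw (Suc i) z - e \<cdot>\<^sub>v pw i z"
    if z: "z \<in> carrier_vec d" for i z e
  proof (induction i)
    case 0
    then show ?case by (simp add: pw_def)
  next
    case (Suc i)
    have "pw (Suc i) (A *\<^sub>v z - e \<cdot>\<^sub>v z) = A *\<^sub>v (pw (Suc i) z - e \<cdot>\<^sub>v pw i z)"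
      using Suc by (simp add: pw_def)
    also have "\<dots> = A *\<^sub>v pw (Suc i) z - e \<cdot>\<^sub>v (A *\<^sub>v pw i z)"
      using A pw_carrier[OF z] by (simp add: mult_minus_distrib_mat_vec mult_mat_vec)
    finally show ?case by (simp add: pw_def)
  qed
  \<comment> \<open>\<open>act p z r\<close> is component \<open>r\<close> of p(A) z, kept as a
    scalar sum so that no polynomials of matrices are needed.\<close>
  define act where "act p z r = (\<Sum>i\<le>degree p. coeff p i * pw i z $ r)" for p z r
  have act_ge: "act p z r = (\<Sum>i\<le>N. coeff p i * pw i z $ r)" if "degree p \<le> N" for p z r N
    unfolding act_def using that by (intro sum.mono_neutral_left) (auto simp: coeff_eq_0)
  have act_linear: "act ([:-e, 1:] * p) z r = act p (A *\<^sub>v z - e \<cdot>\<^sub>v z) r"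
    if z: "z \<in> carrier_vec d" and r: "r < d" for p e z r
  proof -
    let ?N = "degree p"
    have dg: "degree ([:-e, 1:] * p) \<le> Suc ?N"
      using degree_mult_le[of "[:-e, 1:]" p] by simp
    have c: "coeff ([:-e, 1:] * p) i = - e * coeff p i + (if i = 0 then 0 else coeff p (i - 1))" for i
      by (cases i) (auto simp: coeff_pCons)
    have "act ([:-e, 1:] * p) z r
        = (\<Sum>i\<le>Suc ?N. - e * coeff p i * pw i z $ r)
          + (\<Sum>i\<le>Suc ?N. (if i = 0 then 0 else coeff p (i - 1)) * pw i z $ r)"
      unfolding act_ge[OF dg] c distrib_right sum.distrib ..
    also have "(\<Sum>i\<le>Suc ?N. (if i = 0 then 0 else coeff p (i - 1)) * pw i z $ r)
        = (\<Sum>i\<le>?N. coeff p i * pw (Suc i) z $ r)"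
      by (subst sum.atMost_Suc_shift) simp
    also have "(\<Sum>i\<le>Suc ?N. - e * coeff p i * pw i z $ r) = (\<Sum>i\<le>?N. - e * coeff p i * pw i z $ r)"
      by (simp add: coeff_eq_0)
    also have "(\<Sum>i\<le>?N. - e * coeff p i * pw i z $ r) + (\<Sum>i\<le>?N. coeff p i * pw (Suc i) z $ r)
        = act p (A *\<^sub>v z - e \<cdot>\<^sub>v z) r"
      unfolding act_def pw_diff[OF z] sum.distrib[symmetric]
      using r carrier_vecD[OF pw_carrier[OF z]] by (intro sum.cong refl) (simp add: algebra_simps)
    finally show ?thesis .
  qed
  have x': "x \<in> carrier_vec d" using x W by auto
  \<comment> \<open>The d + 1 vectors x, A x, ..., A^d x satisfy a nontrivial linear relation; its
    coefficients form the polynomial \<open>p\<close>.\<close>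
  obtain c where c: "c \<in> carrier_vec (Suc d)" "c \<noteq> 0\<^sub>v (Suc d)"
    "\<And>r. r < d \<Longrightarrow> (\<Sum>j<Suc d. pw j x $ r * c $ j) = 0"
    using homogeneous_system[of d "Suc d" "\<lambda>r j. pw j x $ r"] by auto
  define p where "p = Poly (list_of_vec c)"
  have coeff_p: "coeff p j = (if j < Suc d then c $ j else 0)" for j
    using c(1) by (auto simp: p_def nth_default_def list_of_vec_index)
  have "\<exists>j<Suc d. c $ j \<noteq> 0"
    using c(1,2) by (metis carrier_vecD eq_vecI index_zero_vec)
  then have p0: "p \<noteq> 0" using coeff_p by (metis coeff_0)
  have degp: "degree p \<le> d" by (rule degree_le) (auto simp: coeff_p)
  have actp: "act p x r = 0" if "r < d" for r
    unfolding act_ge[OF degp] using c(3)[OF that]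
    by (simp add: coeff_p lessThan_Suc_atMost mult.commute)
  obtain es where es: "Polynomial.smult (lead_coeff p) (\<Prod>e\<leftarrow>es. [:-e, 1:]) = p"
    using fundamental_theorem_algebra_factorized[of p] by blast
  have act_smult: "act (Polynomial.smult b q) z r = b * act q z r" for b q z r
  proof -
    have "act (Polynomial.smult b q) z r = (\<Sum>i\<le>degree q. coeff (Polynomial.smult b q) i * pw i z $ r)"
      by (rule act_ge) (rule degree_smult_le)
    then show ?thesis by (simp add: act_def sum_distrib_left mult_ac)
  qed
  have "\<forall>r<d. act (\<Prod>e\<leftarrow>es. [:-e, 1:]) x r = 0"
    using actp act_smult[of "lead_coeff p"] es p0 by (metis leading_coeff_0_iff mult_eq_0_iff)
  then have "\<exists>y e. y \<in> W \<and> y \<noteq> 0\<^sub>v d \<and> A *\<^sub>v y = e \<cdot>\<^sub>v y"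
    using x
  proof (induction es arbitrary: x)
    case Nil
    then have "x $ r = 0" if "r < d" for r using that by (simp add: act_def pw_def)
    then have "x = 0\<^sub>v d" using Nil(2) W by (intro eq_vecI) auto
    with Nil(3) show ?case by simp
  next
    case (Cons e es)
    have xc: "x \<in> carrier_vec d" using Cons(3) W by auto
    \<comment> \<open>If (A - e) x vanishes, x is the eigenvector; otherwise (A - e) x is a nonzero
      element of \<open>W\<close> annihilated by the remaining factors.\<close>
    define y where "y = A *\<^sub>v x - e \<cdot>\<^sub>v x"
    show ?case
    proof (cases "y = 0\<^sub>v d")
      case True
      have "A *\<^sub>v x = e \<cdot>\<^sub>v x"
      proof (rule eq_vecI)
        fix i assume "i < dim_vec (e \<cdot>\<^sub>v x)"
        then have i: "i < d" using xc by simp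
        have "y $ i = 0" using True i by simp
        then show "(A *\<^sub>v x) $ i = (e \<cdot>\<^sub>v x) $ i" using i xc A
          by (simp add: y_def del: index_mult_mat_vec)
      qed (use A xc in auto)
      then show ?thesis using Cons(3,4) by blast
    next
      case False
      have "\<forall>r<d. act (\<Prod>e\<leftarrow>es. [:-e, 1:]) y r = 0"
        using Cons(2) act_linear[OF xc, of _ e "\<Prod>e\<leftarrow>es. [:-e, 1:]"] by (simp add: y_def)
      then show ?thesis using Cons(1)[of y] inv[OF Cons(3)] False by (auto simp: y_def)
    qed
  qed
  then show ?thesis using that by blast
qed

section \<open>The spectral theorem and comparison of eigenvalues\<close>

lemma mult_mat_zero_vec:
  fixes A :: "complex mat"
  assumes "A \<in> carrier_mat nr nc"
  shows "A *\<^sub>v 0\<^sub>v nc = 0\<^sub>v nr"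
  using assms by (intro eq_vecI) auto

lemma cscalar_prod_smult:
  fixes x y :: "complex vec"
  assumes "x \<in> carrier_vec d" "y \<in> carrier_vec d"
  shows "(c \<cdot>\<^sub>v x) \<bullet>c y = c * (x \<bullet>c y)" "x \<bullet>c (c \<cdot>\<^sub>v y) = cnj c * (x \<bullet>c y)"
  using assms
  by (simp_all add: cscalar_prod_sum[of _ d] sum_distrib_left mult_ac)

lemma cscalar_prod_self_eq_0:
  fixes x :: "complex vec"
  assumes "x \<in> carrier_vec d"
  shows "x \<bullet>c x = 0 \<longleftrightarrow> x = 0\<^sub>v d"
  using assms by simp

lemma hermitian_cscalar_prod:
  fixes A :: "complex mat"
  assumes "A \<in> carrier_mat d d" "mat_adjoint A = A" "x \<in> carrier_vec d" "y \<in> carrier_vec d"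
  shows "(A *\<^sub>v x) \<bullet>c y = x \<bullet>c (A *\<^sub>v y)"
  using cscalar_prod_adjoint[OF assms(1,3,4)] assms(2) by simp

lemma hermitian_eigenvalue_real:
  fixes A :: "complex mat"
  assumes A: "A \<in> carrier_mat d d" "mat_adjoint A = A" and y: "y \<in> carrier_vec d" "y \<noteq> 0\<^sub>v d"
    and e: "A *\<^sub>v y = e \<cdot>\<^sub>v y"
  shows "e = complex_of_real (Re e)"
proof -
  have "e * (y \<bullet>c y) = cnj e * (y \<bullet>c y)"
    using hermitian_cscalar_prod[OF A y(1) y(1)] cscalar_prod_smult[OF y(1) y(1), of e] e by simp
  then have "cnj e = e" using y by (simp add: cscalar_prod_self_eq_0)
  then show ?thesis by (simp add: complex_eq_iff)
qed

text \<open>Induction on the number of vectors: the orthogonal complement of those already found is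
  invariant because \<open>A\<close> is Hermitian and nonzero because \<open>r < d\<close>, so it
  contains a further eigenvector.\<close>

lemma orthonormal_eigenvectors:
  fixes A :: "complex mat"
  assumes A: "A \<in> carrier_mat d d" "mat_adjoint A = A" and "r \<le> d"
  shows "\<exists>v ev. (\<forall>i<r. v i \<in> carrier_vec d \<and> A *\<^sub>v v i = complex_of_real (ev i) \<cdot>\<^sub>v v i)
    \<and> (\<forall>i<r. \<forall>j<r. v i \<bullet>c v j = (if i = j then 1 else 0))"
  using \<open>r \<le> d\<close>
proof (induction r)
  case 0
  then show ?case by auto
next
  case (Suc r)
  then obtain v and ev :: "nat \<Rightarrow> real" where
    v: "\<And>i. i < r \<Longrightarrow> v i \<in> carrier_vec d" "\<And>i. i < r \<Longrightarrow> A *\<^sub>v v i = complex_of_real (ev i) \<cdot>\<^sub>v v i"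
    and on: "\<And>i j. i < r \<Longrightarrow> j < r \<Longrightarrow> v i \<bullet>c v j = (if i = j then 1 else 0)"
    using Suc_leD by blast
  define W where "W = {x \<in> carrier_vec d. \<forall>i<r. x \<bullet>c v i = 0}"
  have "r < d" using Suc by simp
  then obtain x where x: "x \<in> carrier_vec d" "x \<noteq> 0\<^sub>v d" "\<And>i. i < r \<Longrightarrow> (\<Sum>j<d. cnj (v i $ j) * x $ j) = 0"
    using homogeneous_system[of r d "\<lambda>i j. cnj (v i $ j)"] by auto
  have xW: "x \<in> W" using x v by (auto simp: W_def cscalar_prod_sum[of _ d] mult.commute)
  have inv: "A *\<^sub>v z - e \<cdot>\<^sub>v z \<in> W" if "z \<in> W" for z e
  proof -
    have z: "z \<in> carrier_vec d" "\<And>i. i < r \<Longrightarrow> z \<bullet>c v i = 0" using that by (auto simp: W_def)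
    have "(A *\<^sub>v z - e \<cdot>\<^sub>v z) \<bullet>c v i = 0" if i: "i < r" for i
    proof -
      have "(A *\<^sub>v z - e \<cdot>\<^sub>v z) \<bullet>c v i = (A *\<^sub>v z) \<bullet>c v i - (e \<cdot>\<^sub>v z) \<bullet>c v i"
        using A z v i by (intro minus_scalar_prod_distrib) auto
      also have "(A *\<^sub>v z) \<bullet>c v i = 0"
        using hermitian_cscalar_prod[OF A z(1) v(1)[OF i]] v(2)[OF i] z(2)[OF i]
          cscalar_prod_smult(2)[OF z(1) v(1)[OF i]] by simp
      also have "(e \<cdot>\<^sub>v z) \<bullet>c v i = 0"
        using cscalar_prod_smult(1)[OF z(1) v(1)[OF i]] z(2)[OF i] by simp
      finally show ?thesis by simp
    qed
    then show ?thesis using A z by (auto simp: W_def)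
  qed
  obtain y e where y: "y \<in> W" "y \<noteq> 0\<^sub>v d" and e: "A *\<^sub>v y = e \<cdot>\<^sub>v y"
    using eigenvector_in_invariant_subspace[OF A(1) _ inv xW x(2)] by (auto simp: W_def)
  have yc: "y \<in> carrier_vec d" and y0: "\<And>i. i < r \<Longrightarrow> y \<bullet>c v i = 0" using y by (auto simp: W_def)
  have er: "e = complex_of_real (Re e)"
    using hermitian_eigenvalue_real[OF A yc y(2) e] .
  define s where "s = (\<Sum>i<d. (cmod (y $ i))\<^sup>2)"
  have ys: "y \<bullet>c y = complex_of_real s" using cscalar_prod_self[OF yc] by (simp add: s_def)
  have "s \<noteq> 0" using ys yc y by (metis cscalar_prod_self_eq_0 of_real_0)
  then have s: "s > 0" unfolding s_def by (metis less_eq_real_def sum_nonneg zero_le_power2)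
  define w where "w = complex_of_real (1 / sqrt s) \<cdot>\<^sub>v y"
  have w: "w \<in> carrier_vec d" using yc by (simp add: w_def)
  have "complex_of_real (1 / sqrt s) * (complex_of_real (1 / sqrt s) * complex_of_real s) = 1"
    using s by (simp flip: of_real_mult)
  then have ww: "w \<bullet>c w = 1"
    using cscalar_prod_smult[OF yc yc] cscalar_prod_smult[OF yc, of "complex_of_real (1 / sqrt s) \<cdot>\<^sub>v y"] yc ys
    by (simp add: w_def)
  have wv: "w \<bullet>c v i = 0" if "i < r" for i
    using cscalar_prod_smult(1)[OF yc v(1)[OF that]] y0[OF that] by (simp add: w_def)
  have vw: "v i \<bullet>c w = 0" if "i < r" for i
    using cnj_cscalar_prod[OF w v(1)[OF that]] wv[OF that] by simp
  have Aw: "A *\<^sub>v w = complex_of_real (Re e) \<cdot>\<^sub>v w"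
    using e er A yc by (simp add: w_def mult_mat_vec smult_smult_assoc mult.commute)
  show ?case
  proof (intro exI conjI)
    show "\<forall>i<Suc r. (v(r := w)) i \<in> carrier_vec d \<and> A *\<^sub>v (v(r := w)) i = complex_of_real ((ev(r := Re e)) i) \<cdot>\<^sub>v (v(r := w)) i"
      using v w Aw by (auto simp: less_Suc_eq)
    show "\<forall>i<Suc r. \<forall>j<Suc r. (v(r := w)) i \<bullet>c (v(r := w)) j = (if i = j then 1 else 0)"
      using on ww wv vw by (auto simp: less_Suc_eq)
  qed
qed

text \<open>Sorting gives the index of an eigenvalue a meaning that does not depend on the chosen
  eigenvectors, so that equal positions can be compared across matrices. Values of \<open>ev\<close>
  from \<open>d\<close> on are unconstrained.\<close>

definition eigen_decomp :: "nat \<Rightarrow> complex mat \<Rightarrow> complex mat \<Rightarrow> (nat \<Rightarrow> real) \<Rightarrow> bool" where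
  "eigen_decomp d A U ev \<longleftrightarrow> U \<in> carrier_mat d d \<and> mat_adjoint U * U = 1\<^sub>m d \<and> U * mat_adjoint U = 1\<^sub>m d \<and>
     A * U = U * mat d d (\<lambda>(i, j). if i = j then complex_of_real (ev i) else 0) \<and>
     (\<forall>i j. i \<le> j \<longrightarrow> j < d \<longrightarrow> ev j \<le> ev i)"

lemma exists_decreasing_enumeration:
  fixes ev :: "nat \<Rightarrow> real"
  obtains \<pi> where "bij_betw \<pi> {..<d} {..<d}" "\<And>i j. i \<le> j \<Longrightarrow> j < d \<Longrightarrow> ev (\<pi> j) \<le> ev (\<pi> i)"
proof -
  define xs where "xs = sort_key (\<lambda>i. - ev i) [0..<d]"
  have xs: "length xs = d" "distinct xs" "set xs = {..<d}" "sorted (map (\<lambda>i. - ev i) xs)"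
    by (auto simp: xs_def)
  have "bij_betw (\<lambda>i. xs ! i) {..<d} {..<d}"
    by (rule bij_betw_nth[OF xs(2)]) (simp_all add: xs(1,3))
  moreover have "ev (xs ! j) \<le> ev (xs ! i)" if "i \<le> j" "j < d" for i j
    using sorted_nth_mono[OF xs(4), of i j] that xs(1) by simp
  ultimately show ?thesis using that by blast
qed

theorem hermitian_eigen_decomp:
  fixes A :: "complex mat"
  assumes A: "A \<in> carrier_mat d d" "mat_adjoint A = A"
  obtains U ev where "eigen_decomp d A U ev"
proof -
  obtain v and ev :: "nat \<Rightarrow> real" where
    v: "\<And>i. i < d \<Longrightarrow> v i \<in> carrier_vec d" "\<And>i. i < d \<Longrightarrow> A *\<^sub>v v i = complex_of_real (ev i) \<cdot>\<^sub>v v i"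
    and on: "\<And>i j. i < d \<Longrightarrow> j < d \<Longrightarrow> v i \<bullet>c v j = (if i = j then 1 else 0)"
    using orthonormal_eigenvectors[OF A order_refl] by blast
  obtain \<pi> where bij: "bij_betw \<pi> {..<d} {..<d}" and dec: "\<And>i j. i \<le> j \<Longrightarrow> j < d \<Longrightarrow> ev (\<pi> j) \<le> ev (\<pi> i)"
    using exists_decreasing_enumeration[of d ev] by blast
  have \<pi>: "\<pi> i < d" if "i < d" for i using bij that by (auto simp: bij_betw_def)
  have \<pi>_inj: "\<pi> i = \<pi> j \<longleftrightarrow> i = j" if "i < d" "j < d" for i j
    using bij that by (auto simp: bij_betw_def inj_on_def)
  define U where "U = mat d d (\<lambda>(i, j). v (\<pi> j) $ i)"
  have U: "U \<in> carrier_mat d d" by (simp add: U_def)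
  have 1: "mat_adjoint U * U = 1\<^sub>m d"
  proof (rule eq_matI)
    fix i j assume "i < dim_row (1\<^sub>m d :: complex mat)" "j < dim_col (1\<^sub>m d :: complex mat)"
    then have ij: "i < d" "j < d" by auto
    have "(mat_adjoint U * U) $$ (i, j) = (\<Sum>k<d. cnj (v (\<pi> i) $ k) * v (\<pi> j) $ k)"
      using ij U by (auto simp: scalar_prod_def atLeast0LessThan adjoint_index U_def intro!: sum.cong)
    also have "\<dots> = v (\<pi> j) \<bullet>c v (\<pi> i)"
      using v(1)[OF \<pi>[OF ij(1)]] by (simp add: cscalar_prod_sum[of _ d] mult.commute)
    finally show "(mat_adjoint U * U) $$ (i, j) = 1\<^sub>m d $$ (i, j)"
      using ij on[OF \<pi>[OF ij(2)] \<pi>[OF ij(1)]] \<pi>_inj[OF ij] by auto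
  qed (use U in auto)
  have 2: "U * mat_adjoint U = 1\<^sub>m d"
    using mat_mult_left_right_inverse[OF adjoint_carrier[OF U] U 1] .
  have 3: "A * U = U * mat d d (\<lambda>(i, j). if i = j then complex_of_real (ev (\<pi> i)) else 0)" (is "_ = U * ?D")
  proof (rule eq_matI)
    fix i j assume "i < dim_row (U * ?D)" "j < dim_col (U * ?D)"
    then have ij: "i < d" "j < d" using U by auto
    have "(A * U) $$ (i, j) = (A *\<^sub>v v (\<pi> j)) $ i"
      using ij A U v(1)[OF \<pi>[OF ij(2)]]
      by (auto simp: scalar_prod_def atLeast0LessThan U_def intro!: sum.cong)
    also have "\<dots> = complex_of_real (ev (\<pi> j)) * v (\<pi> j) $ i"
      unfolding v(2)[OF \<pi>[OF ij(2)]] using ij v(1)[OF \<pi>[OF ij(2)]] by simp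
    also have "\<dots> = (\<Sum>k<d. U $$ (i, k) * ?D $$ (k, j))"
    proof -
      have "(\<Sum>k<d. U $$ (i, k) * ?D $$ (k, j)) = (\<Sum>k<d. if k = j then complex_of_real (ev (\<pi> j)) * v (\<pi> j) $ i else 0)"
        using ij by (intro sum.cong refl) (auto simp: U_def)
      then show ?thesis using ij by simp
    qed
    also have "\<dots> = (U * ?D) $$ (i, j)"
      using ij U by (auto simp: scalar_prod_def atLeast0LessThan intro!: sum.cong)
    finally show "(A * U) $$ (i, j) = (U * ?D) $$ (i, j)" .
  qed (use A U in auto)
  show ?thesis
    using that[of U "\<lambda>i. ev (\<pi> i)"] U 1 2 3 dec by (simp add: eigen_decomp_def)
qed

section \<open>Quadratic forms and multiplicities in eigencoordinates\<close>

definition qform :: "complex mat \<Rightarrow> complex vec \<Rightarrow> real" where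
  "qform A x = Re ((A *\<^sub>v x) \<bullet>c x)"

definition sqnorm :: "complex vec \<Rightarrow> real" where
  "sqnorm x = Re (x \<bullet>c x)"

lemma sqnorm_sum: "x \<in> carrier_vec d \<Longrightarrow> sqnorm x = (\<Sum>i<d. (cmod (x $ i))\<^sup>2)"
  by (simp add: sqnorm_def cscalar_prod_self)

lemma sqnorm_nonneg: "x \<in> carrier_vec d \<Longrightarrow> sqnorm x \<ge> 0"
  by (simp add: sqnorm_sum[of x d] sum_nonneg)

lemma sqnorm_pos:
  assumes x: "x \<in> carrier_vec d" "x \<noteq> 0\<^sub>v d"
  shows "sqnorm x > 0"
proof -
  have "x \<bullet>c x = complex_of_real (sqnorm x)"
    using cscalar_prod_self[OF x(1)] sqnorm_sum[OF x(1)] by simp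
  then have "sqnorm x \<noteq> 0" using x cscalar_prod_self_eq_0[OF x(1)] by auto
  then show ?thesis using sqnorm_nonneg[OF x(1)] by simp
qed

context
  fixes d A U ev
  assumes ed: "eigen_decomp d A U ev" and A: "A \<in> carrier_mat d d"
begin

lemma ed_carrier: "U \<in> carrier_mat d d" "mat_adjoint U \<in> carrier_mat d d"
  using ed by (auto simp: eigen_decomp_def)

lemma ed_decreasing: "i \<le> j \<Longrightarrow> j < d \<Longrightarrow> ev j \<le> ev i"
  using ed by (auto simp: eigen_decomp_def)

lemma ed_coords_carrier: "x \<in> carrier_vec d \<Longrightarrow> mat_adjoint U *\<^sub>v x \<in> carrier_vec d"
  using ed_carrier(2) by simp

lemma ed_expand: "x \<in> carrier_vec d \<Longrightarrow> U *\<^sub>v (mat_adjoint U *\<^sub>v x) = x"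
  using ed ed_carrier by (simp add: eigen_decomp_def flip: assoc_mult_mat_vec[of _ d d _ d])

lemma ed_coords_of: "y \<in> carrier_vec d \<Longrightarrow> mat_adjoint U *\<^sub>v (U *\<^sub>v y) = y"
  using ed ed_carrier by (simp add: eigen_decomp_def flip: assoc_mult_mat_vec[of _ d d _ d])

lemma ed_mult_coords:
  assumes y: "y \<in> carrier_vec d"
  shows "A *\<^sub>v (U *\<^sub>v y) = U *\<^sub>v vec d (\<lambda>i. complex_of_real (ev i) * y $ i)"
proof -
  define D where "D = mat d d (\<lambda>(i, j). if i = j then complex_of_real (ev i) else 0)"
  have D: "D \<in> carrier_mat d d" by (simp add: D_def)
  have "D *\<^sub>v y = vec d (\<lambda>i. complex_of_real (ev i) * y $ i)"
  proof (rule eq_vecI)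
    fix i assume "i < dim_vec (vec d (\<lambda>i. complex_of_real (ev i) * y $ i))"
    then have i: "i < d" by simp
    have "(D *\<^sub>v y) $ i = (\<Sum>j<d. if j = i then complex_of_real (ev i) * y $ i else 0)"
      unfolding mult_mat_vec_sum[OF D y i] using i by (intro sum.cong refl) (auto simp: D_def)
    then show "(D *\<^sub>v y) $ i = vec d (\<lambda>i. complex_of_real (ev i) * y $ i) $ i" using i by simp
  qed (simp add: D_def)
  moreover have "A *\<^sub>v (U *\<^sub>v y) = U *\<^sub>v (D *\<^sub>v y)"
    using ed A ed_carrier D y
    by (simp add: eigen_decomp_def D_def flip: assoc_mult_mat_vec[of _ d d _ d])
  ultimately show ?thesis by simp
qed

lemma ed_coords_mult:
  assumes x: "x \<in> carrier_vec d" and i: "i < d"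
  shows "(mat_adjoint U *\<^sub>v (A *\<^sub>v x)) $ i = complex_of_real (ev i) * (mat_adjoint U *\<^sub>v x) $ i"
  using ed_mult_coords[OF ed_coords_carrier[OF x]] ed_expand[OF x] i
  by (simp add: ed_coords_of del: index_mult_mat_vec)

lemma ed_sqnorm:
  assumes x: "x \<in> carrier_vec d"
  shows "sqnorm x = (\<Sum>i<d. (cmod ((mat_adjoint U *\<^sub>v x) $ i))\<^sup>2)"
  using cscalar_prod_adjoint[OF ed_carrier(1) ed_coords_carrier[OF x] x] ed_expand[OF x]
    sqnorm_sum[OF ed_coords_carrier[OF x]] by (simp add: sqnorm_def)

lemma ed_qform:
  assumes x: "x \<in> carrier_vec d"
  shows "qform A x = (\<Sum>i<d. ev i * (cmod ((mat_adjoint U *\<^sub>v x) $ i))\<^sup>2)"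
proof -
  define y where "y = mat_adjoint U *\<^sub>v x"
  have y: "y \<in> carrier_vec d" using ed_coords_carrier[OF x] by (simp add: y_def)
  have "A *\<^sub>v x = U *\<^sub>v vec d (\<lambda>i. complex_of_real (ev i) * y $ i)"
    using ed_mult_coords[OF y] ed_expand[OF x] by (simp add: y_def)
  then have "(A *\<^sub>v x) \<bullet>c x = vec d (\<lambda>i. complex_of_real (ev i) * y $ i) \<bullet>c y"
    using cscalar_prod_adjoint[OF ed_carrier(1) _ x] by (simp add: y_def)
  also have "\<dots> = (\<Sum>i<d. complex_of_real (ev i) * (y $ i * cnj (y $ i)))"
    by (simp add: cscalar_prod_sum[OF y] mult.assoc)
  also have "\<dots> = complex_of_real (\<Sum>i<d. ev i * (cmod (y $ i))\<^sup>2)"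
    by (simp add: complex_norm_square[symmetric])
  finally show ?thesis by (simp add: qform_def y_def)
qed

text \<open>One half of the min-max principle: only eigenvalues at most \<open>ev i\<close>
  contribute. For \<open>i = 0\<close> there is no condition on \<open>x\<close>, and the bound is
  by the largest eigenvalue.\<close>

lemma ed_qform_le:
  assumes x: "x \<in> carrier_vec d" and i: "i < d" and "\<And>j. j < i \<Longrightarrow> (mat_adjoint U *\<^sub>v x) $ j = 0"
  shows "qform A x \<le> ev i * sqnorm x"
  unfolding ed_qform[OF x] ed_sqnorm[OF x] sum_distrib_left
proof (rule sum_mono)
  fix j assume "j \<in> {..<d}"
  then show "ev j * (cmod ((mat_adjoint U *\<^sub>v x) $ j))\<^sup>2 \<le> ev i * (cmod ((mat_adjoint U *\<^sub>v x) $ j))\<^sup>2"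
    using assms(3)[of j] ed_decreasing[of i j]
    by (cases "j < i") (auto intro: mult_right_mono simp del: index_mult_mat_vec)
qed

lemma ed_qform_ge:
  assumes x: "x \<in> carrier_vec d" and i: "i < d"
    and "\<And>j. i < j \<Longrightarrow> j < d \<Longrightarrow> (mat_adjoint U *\<^sub>v x) $ j = 0"
  shows "qform A x \<ge> ev i * sqnorm x"
  unfolding ed_qform[OF x] ed_sqnorm[OF x] sum_distrib_left
proof (rule sum_mono)
  fix j assume "j \<in> {..<d}"
  then show "ev j * (cmod ((mat_adjoint U *\<^sub>v x) $ j))\<^sup>2 \<ge> ev i * (cmod ((mat_adjoint U *\<^sub>v x) $ j))\<^sup>2"
    using assms(3)[of j] ed_decreasing[of j i] i
    by (cases "i < j") (auto intro: mult_right_mono simp del: index_mult_mat_vec)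
qed

lemma ed_eigenvector:
  assumes "i < d"
  obtains x where "x \<in> carrier_vec d" "x \<noteq> 0\<^sub>v d" "A *\<^sub>v x = complex_of_real (ev i) \<cdot>\<^sub>v x"
proof -
  define x where "x = U *\<^sub>v unit_vec d i"
  have x: "x \<in> carrier_vec d" using ed_carrier by (simp add: x_def)
  have 1: "mat_adjoint U *\<^sub>v x = unit_vec d i"
    by (simp add: x_def ed_coords_of)
  have "x \<noteq> 0\<^sub>v d"
  proof
    assume "x = 0\<^sub>v d"
    then have "mat_adjoint U *\<^sub>v x = 0\<^sub>v d" using mult_mat_zero_vec[OF ed_carrier(2)] by simp
    with 1 show False using assms by (metis index_unit_vec(2) index_zero_vec(1) zero_neq_one)
  qed
  moreover have "A *\<^sub>v x = complex_of_real (ev i) \<cdot>\<^sub>v x"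
  proof -
    have "vec d (\<lambda>j. complex_of_real (ev j) * (unit_vec d i :: complex vec) $ j) = complex_of_real (ev i) \<cdot>\<^sub>v unit_vec d i"
      using assms by (intro eq_vecI) auto
    then show ?thesis
      using ed_mult_coords[of "unit_vec d i"] ed_carrier(1) by (simp add: x_def mult_mat_vec)
  qed
  ultimately show ?thesis using x that by blast
qed

text \<open>Turns multiplicities, defined as suprema over independent families, into counts of
  positions. Eigenvectors for \<open>\<mu>\<close> have zero coordinates outside the positions with
  \<open>ev i = \<mu>\<close>, so a larger family is dependent; the columns of \<open>U\<close> at
  these positions attain the count.\<close>

lemma ed_multiplicity:
  "Sup {enat k | k. \<exists>vs. (\<forall>l<k. vs l \<in> carrier_vec d \<and> A *\<^sub>v vs l = complex_of_real \<mu> \<cdot>\<^sub>v vs l) \<and> vec_indep d k vs}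
     = enat (card {i. i < d \<and> ev i = \<mu>})" (is "Sup ?S = enat (card ?I)")
proof (rule antisym)
  define r where "r = card ?I"
  have fin: "finite ?I" by simp
  obtain g where g: "bij_betw g {..<r} ?I"
    using ex_bij_betw_nat_finite[OF fin] by (auto simp: r_def atLeast0LessThan)
  have gI: "g l < d" "ev (g l) = \<mu>" if "l < r" for l
    using g that by (auto simp: bij_betw_def)
  show "Sup ?S \<le> enat (card ?I)"
  proof (rule Sup_least)
    fix s assume "s \<in> ?S"
    then obtain k vs where s: "s = enat k"
      and vs: "\<And>l. l < k \<Longrightarrow> vs l \<in> carrier_vec d" "\<And>l. l < k \<Longrightarrow> A *\<^sub>v vs l = complex_of_real \<mu> \<cdot>\<^sub>v vs l"
      and ind: "vec_indep d k vs" by auto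
    have "k \<le> r"
    proof (rule ccontr)
      assume "\<not> k \<le> r"
      then have rk: "r < k" by simp
      define y where "y l = mat_adjoint U *\<^sub>v vs l" for l
      obtain c where c: "c \<in> carrier_vec k" "c \<noteq> 0\<^sub>v k" "\<And>i. i < r \<Longrightarrow> (\<Sum>l<k. y l $ g i * c $ l) = 0"
        using homogeneous_system[OF rk, of "\<lambda>i l. y l $ g i"] by auto
      have yl: "y l \<in> carrier_vec d" "vs l = U *\<^sub>v y l" if "l < k" for l
        using ed_coords_carrier[OF vs(1)[OF that]] ed_expand[OF vs(1)[OF that]] by (auto simp: y_def)
      have y0: "y l $ j = 0" if l: "l < k" and j: "j < d" "ev j \<noteq> \<mu>" for l j
      proof -
        have "complex_of_real \<mu> * y l $ j = complex_of_real (ev j) * y l $ j"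
          using ed_coords_mult[OF vs(1)[OF l] j(1)] vs[OF l] ed_carrier(2) j(1) carrier_vecD[OF ed_coords_carrier[OF vs(1)[OF l]]]
          by (simp add: y_def mult_mat_vec[of _ d d] del: index_mult_mat_vec)
        then show ?thesis using j by simp
      qed
      have sy: "(\<Sum>l<k. y l $ j * c $ l) = 0" if j: "j < d" for j
      proof (cases "ev j = \<mu>")
        case True
        then have "j \<in> g ` {..<r}" using bij_betw_imp_surj_on[OF g] j by simp
        then show ?thesis using c(3) by auto
      next
        case False
        then show ?thesis using y0[OF _ j] by simp
      qed
      have "(\<Sum>l<k. c $ l * vs l $ q) = 0" if q: "q < d" for q
      proof -
        have "(\<Sum>l<k. c $ l * vs l $ q) = (\<Sum>l<k. c $ l * (\<Sum>j<d. U $$ (q, j) * y l $ j))"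
          using mult_mat_vec_sum[OF ed_carrier(1) yl(1) q] yl(2) by (intro sum.cong refl) simp
        also have "\<dots> = (\<Sum>j<d. \<Sum>l<k. c $ l * (U $$ (q, j) * y l $ j))"
          unfolding sum_distrib_left by (rule sum.swap)
        also have "\<dots> = (\<Sum>j<d. U $$ (q, j) * (\<Sum>l<k. y l $ j * c $ l))"
          by (simp add: sum_distrib_left mult_ac)
        finally show ?thesis using sy by simp
      qed
      then have "\<forall>l<k. c $ l = 0"
        using ind unfolding vec_indep_def by blast
      then show False using c(1,2) by (metis carrier_vecD eq_vecI index_zero_vec)
    qed
    then show "s \<le> enat (card ?I)" by (simp add: s r_def)
  qed
  show "enat (card ?I) \<le> Sup ?S"
  proof (rule Sup_upper)
    define vs where "vs l = U *\<^sub>v unit_vec d (g l)" for l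
    have "vs l \<in> carrier_vec d" for l using ed_carrier by (simp add: vs_def)
    moreover have "A *\<^sub>v vs l = complex_of_real \<mu> \<cdot>\<^sub>v vs l" if "l < r" for l
    proof -
      have "vec d (\<lambda>j. complex_of_real (ev j) * (unit_vec d (g l) :: complex vec) $ j)
          = complex_of_real \<mu> \<cdot>\<^sub>v unit_vec d (g l)"
        using gI[OF that] by (intro eq_vecI) auto
      then show ?thesis
        using ed_mult_coords[of "unit_vec d (g l)"] ed_carrier(1) by (simp add: vs_def mult_mat_vec)
    qed
    moreover have "vec_indep d r vs"
      unfolding vec_indep_def
    proof (intro allI impI)
      fix c :: "nat \<Rightarrow> complex" and l
      assume c: "\<forall>q<d. (\<Sum>l<r. c l * vs l $ q) = 0" and l: "l < r"
      define z where "z = vec d (\<lambda>j. \<Sum>l<r. c l * (unit_vec d (g l) :: complex vec) $ j)"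
      have z: "z \<in> carrier_vec d" by (simp add: z_def)
      have "U *\<^sub>v z = 0\<^sub>v d"
      proof (rule eq_vecI)
        fix q assume "q < dim_vec (0\<^sub>v d :: complex vec)"
        then have q: "q < d" by simp
        have "(U *\<^sub>v z) $ q = (\<Sum>j<d. \<Sum>l<r. U $$ (q, j) * (c l * (unit_vec d (g l) :: complex vec) $ j))"
          unfolding mult_mat_vec_sum[OF ed_carrier(1) z q]
          by (intro sum.cong refl) (simp add: z_def sum_distrib_left)
        also have "\<dots> = (\<Sum>l<r. c l * (\<Sum>j<d. U $$ (q, j) * (unit_vec d (g l) :: complex vec) $ j))"
          by (subst sum.swap) (simp add: sum_distrib_left mult_ac)
        also have "\<dots> = (\<Sum>l<r. c l * vs l $ q)"
          unfolding vs_def by (subst mult_mat_vec_sum[OF ed_carrier(1) _ q]) auto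
        finally show "(U *\<^sub>v z) $ q = 0\<^sub>v d $ q" using c q by simp
      qed (use ed_carrier in auto)
      then have "z = 0\<^sub>v d" using ed_coords_of[OF z] mult_mat_zero_vec[OF ed_carrier(2)] by simp
      then have "0 = z $ g l" using gI[OF l] by simp
      also have "\<dots> = (\<Sum>l'<r. if l' = l then c l else 0)"
      proof -
        have "c l' * (unit_vec d (g l') :: complex vec) $ g l = (if l' = l then c l else 0)" if "l' < r" for l'
          using gI that l bij_betw_imp_inj_on[OF g] by (auto simp: inj_on_def)
        then show ?thesis using gI[OF l] by (simp add: z_def)
      qed
      finally show "c l = 0" using l by simp
    qed
    ultimately show "enat (card ?I) \<in> ?S" unfolding r_def by blast
  qed
qed

end

text \<open>Replaces the min-max principle by one test vector. Removing the first \<open>i\<close>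
  eigenvectors of \<open>B\<close> and those of \<open>A\<close> after position \<open>i\<close>
  takes d - 1 equations, so a common nonzero solution exists.\<close>

lemma eigenvalue_comparison:
  assumes A: "eigen_decomp d A U ev" "A \<in> carrier_mat d d"
    and B: "eigen_decomp d B W \<mu>" "B \<in> carrier_mat d d" and i: "i < d"
  obtains x where "x \<in> carrier_vec d" "x \<noteq> 0\<^sub>v d" "ev i * sqnorm x \<le> qform A x" "qform B x \<le> \<mu> i * sqnorm x"
proof -
  note Uc = ed_carrier[OF A] and Wc = ed_carrier[OF B]
  have "d - 1 < d" using i by simp
  \<comment> \<open>From row \<open>i\<close> on, row \<open>j\<close> refers to coordinate
    \<open>Suc j\<close>: coordinate \<open>i\<close> is skipped, which leaves d - 1 rows.\<close>
  then obtain x where x: "x \<in> carrier_vec d" "x \<noteq> 0\<^sub>v d"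
    "\<And>j. j < d - 1 \<Longrightarrow> (\<Sum>q<d. (if j < i then mat_adjoint W $$ (j, q) else mat_adjoint U $$ (Suc j, q)) * x $ q) = 0"
    using homogeneous_system[of "d - 1" d "\<lambda>j q. if j < i then mat_adjoint W $$ (j, q) else mat_adjoint U $$ (Suc j, q)"]
    by blast
  have "(mat_adjoint W *\<^sub>v x) $ j = 0" if "j < i" for j
    using x(3)[of j] that i mult_mat_vec_sum[OF Wc(2) x(1), of j] by (simp del: index_mult_mat_vec)
  moreover have "(mat_adjoint U *\<^sub>v x) $ j = 0" if "i < j" "j < d" for j
  proof -
    obtain j' where j': "j = Suc j'" using \<open>i < j\<close> by (cases j) auto
    show ?thesis
      using x(3)[of j'] that i mult_mat_vec_sum[OF Uc(2) x(1), of j]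
      by (simp add: j' del: index_mult_mat_vec)
  qed
  ultimately show ?thesis
    using that[OF x(1,2)] ed_qform_ge[OF A x(1) i] ed_qform_le[OF B x(1) i] by blast
qed

lemma eigenvalue_mono:
  assumes A: "eigen_decomp d A U ev" "A \<in> carrier_mat d d"
    and B: "eigen_decomp d B W \<mu>" "B \<in> carrier_mat d d" and i: "i < d"
    and le: "\<And>x. x \<in> carrier_vec d \<Longrightarrow> qform A x \<le> qform B x + c * sqnorm x"
  shows "ev i \<le> \<mu> i + c"
proof -
  obtain x where x: "x \<in> carrier_vec d" "x \<noteq> 0\<^sub>v d" "ev i * sqnorm x \<le> qform A x" "qform B x \<le> \<mu> i * sqnorm x"
    using eigenvalue_comparison[OF A B i] by blast
  then have "ev i * sqnorm x \<le> (\<mu> i + c) * sqnorm x" using le[OF x(1)] by (simp add: distrib_right)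
  then show ?thesis using sqnorm_pos[OF x(1,2)] by simp
qed

lemma eigenvalue_strict_mono:
  assumes A: "eigen_decomp d A U ev" "A \<in> carrier_mat d d"
    and B: "eigen_decomp d B W \<mu>" "B \<in> carrier_mat d d" and i: "i < d"
    and le: "\<And>x. x \<in> carrier_vec d \<Longrightarrow> x \<noteq> 0\<^sub>v d \<Longrightarrow> qform A x < qform B x"
  shows "ev i < \<mu> i"
proof -
  obtain x where x: "x \<in> carrier_vec d" "x \<noteq> 0\<^sub>v d" "ev i * sqnorm x \<le> qform A x" "qform B x \<le> \<mu> i * sqnorm x"
    using eigenvalue_comparison[OF A B i] by blast
  then have "ev i * sqnorm x < \<mu> i * sqnorm x" using le[OF x(1,2)] by simp
  then show ?thesis using sqnorm_pos[OF x(1,2)] by simp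
qed

section \<open>Self-adjoint boundary conditions\<close>

lemma adjoint_minus:
  fixes A B :: "complex mat"
  assumes "A \<in> carrier_mat nr nc" "B \<in> carrier_mat nr nc"
  shows "mat_adjoint (A - B) = mat_adjoint A - mat_adjoint B"
  using assms by (intro eq_matI) (auto simp: adjoint_index)

lemma adjoint_smult:
  fixes A :: "complex mat"
  shows "mat_adjoint (c \<cdot>\<^sub>m A) = cnj c \<cdot>\<^sub>m mat_adjoint A"
  by (intro eq_matI) (auto simp: adjoint_index)

lemma adjoint_add:
  fixes A B :: "complex mat"
  assumes "A \<in> carrier_mat nr nc" "B \<in> carrier_mat nr nc"
  shows "mat_adjoint (A + B) = mat_adjoint A + mat_adjoint B"
  using assms by (intro eq_matI) (auto simp: adjoint_index)

lemma adjoint_one: "mat_adjoint (1\<^sub>m d) = (1\<^sub>m d :: complex mat)"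
  by (intro eq_matI) (auto simp: adjoint_index)

lemma eq_mat_by_mult_vec:
  fixes A B :: "complex mat"
  assumes A: "A \<in> carrier_mat nr nc" and B: "B \<in> carrier_mat nr nc"
    and eq: "\<And>x. x \<in> carrier_vec nc \<Longrightarrow> A *\<^sub>v x = B *\<^sub>v x"
  shows "A = B"
proof (rule eq_matI)
  fix i j assume ij: "i < dim_row B" "j < dim_col B"
  have i: "i < nr" using ij B by simp
  have entry: "(M *\<^sub>v unit_vec nc j) $ i = M $$ (i, j)" if M: "M \<in> carrier_mat nr nc" for M :: "complex mat"
  proof -
    have "(M *\<^sub>v unit_vec nc j) $ i = (\<Sum>k<nc. if k = j then M $$ (i, j) else 0)"
      unfolding mult_mat_vec_sum[OF M unit_vec_carrier i] using ij B
      by (intro sum.cong refl) auto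
    then show ?thesis using ij B by simp
  qed
  have "A *\<^sub>v unit_vec nc j = B *\<^sub>v unit_vec nc j" by (rule eq) simp
  then show "A $$ (i, j) = B $$ (i, j)" using entry[OF A] entry[OF B] by simp
qed (use A B in auto)

lemma smult_mat_mult_vec:
  fixes A :: "complex mat"
  assumes "A \<in> carrier_mat nr nc" "x \<in> carrier_vec nc"
  shows "(c \<cdot>\<^sub>m A) *\<^sub>v x = c \<cdot>\<^sub>v (A *\<^sub>v x)"
  using assms by (intro eq_vecI) auto

lemma vec_diff_eq_0:
  fixes x y :: "complex vec"
  assumes "x \<in> carrier_vec d" "y \<in> carrier_vec d"
  shows "x - y = 0\<^sub>v d \<longleftrightarrow> x = y"
proof
  assume e: "x - y = 0\<^sub>v d"
  show "x = y"
  proof (rule eq_vecI)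
    fix i assume "i < dim_vec y"
    then have i: "i < d" using assms by simp
    have "(x - y) $ i = 0" using e i by simp
    then show "x $ i = y $ i" using i assms by simp
  qed (use assms in auto)
qed (use assms in auto)

lemma adjoint_mult_vec_eq_0:
  fixes B :: "complex mat"
  assumes B: "B \<in> carrier_mat nr nc" and x: "x \<in> carrier_vec nc"
    and 0: "mat_adjoint B *\<^sub>v (B *\<^sub>v x) = 0\<^sub>v nc"
  shows "B *\<^sub>v x = 0\<^sub>v nr"
proof -
  have Bx: "B *\<^sub>v x \<in> carrier_vec nr" using B x by simp
  have "(B *\<^sub>v x) \<bullet>c (B *\<^sub>v x) = x \<bullet>c (mat_adjoint B *\<^sub>v (B *\<^sub>v x))"
    by (rule cscalar_prod_adjoint[OF B x Bx])
  also have "\<dots> = 0" using 0 x by simp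
  finally show ?thesis using cscalar_prod_self_eq_0[OF Bx] by simp
qed

text \<open>Here \<open>B\<^sup>* Q\<close> is the orthogonal projector onto the range of \<open>B\<^sup>*\<close>.  With \<open>N = B\<^sup>* B\<close> and its
pseudo-inverse \<open>N\<^sup>+\<close> one takes \<open>Q = B (N\<^sup>+)\<^sup>2 N\<close>, so that \<open>B\<^sup>* Q = N (N\<^sup>+)\<^sup>2 N\<close>.\<close>

lemma range_adjoint_projector:
  fixes B :: "complex mat"
  assumes B: "B \<in> carrier_mat d d"
  obtains Q where "Q \<in> carrier_mat d d" "mat_adjoint Q * B = mat_adjoint B * Q"
    "B * (mat_adjoint B * Q) = B"
proof -
  note Ba = adjoint_carrier[OF B]
  define N where "N = mat_adjoint B * B"
  have N: "N \<in> carrier_mat d d" using B Ba by (simp add: N_def)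
  have Nh: "mat_adjoint N = N" using adjoint_mult[OF Ba B] by (simp add: N_def)
  obtain U ev where ed: "eigen_decomp d N U ev" using hermitian_eigen_decomp[OF N Nh] .
  note U = ed_carrier[OF ed N]
  \<comment> \<open>\<open>F\<close> below is \<open>f\<close> applied to \<open>N\<close>, the
    square of the pseudo-inverse, with value 0 on the kernel.\<close>
  define f where "f t = (if t = 0 then 0 else 1 / t\<^sup>2)" for t :: real
  define \<Delta> where "\<Delta> = mat d d (\<lambda>(i, j). if i = j then complex_of_real (f (ev i)) else 0)"
  have \<Delta>: "\<Delta> \<in> carrier_mat d d" by (simp add: \<Delta>_def)
  have \<Delta>h: "mat_adjoint \<Delta> = \<Delta>" by (intro eq_matI) (auto simp: adjoint_index \<Delta>_def)
  define F where "F = U * (\<Delta> * mat_adjoint U)"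
  have F: "F \<in> carrier_mat d d" using U \<Delta> by (simp add: F_def)
  have Fh: "mat_adjoint F = F"
    using U \<Delta> \<Delta>h by (simp add: F_def adjoint_mult[of _ d d _ d] assoc_mult_mat[of _ d d _ d _ d])
  have coords_F: "(mat_adjoint U *\<^sub>v (F *\<^sub>v x)) $ i = complex_of_real (f (ev i)) * (mat_adjoint U *\<^sub>v x) $ i"
    if x: "x \<in> carrier_vec d" and i: "i < d" for x i
  proof -
    define y where "y = mat_adjoint U *\<^sub>v x"
    have y: "y \<in> carrier_vec d" using U x by (simp add: y_def)
    have "F *\<^sub>v x = U *\<^sub>v (\<Delta> *\<^sub>v y)"
      using U \<Delta> x by (simp add: F_def y_def assoc_mult_mat_vec[of _ d d _ d])
    then have "mat_adjoint U *\<^sub>v (F *\<^sub>v x) = \<Delta> *\<^sub>v y"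
      using ed_coords_of[OF ed N, of "\<Delta> *\<^sub>v y"] \<Delta> y by simp
    then have "(mat_adjoint U *\<^sub>v (F *\<^sub>v x)) $ i = (\<Sum>j<d. \<Delta> $$ (i, j) * y $ j)"
      using mult_mat_vec_sum[OF \<Delta> y i] by simp
    also have "\<dots> = (\<Sum>j<d. if j = i then complex_of_real (f (ev i)) * y $ i else 0)"
      using i by (intro sum.cong refl) (auto simp: \<Delta>_def)
    finally show ?thesis using i by (simp add: y_def)
  qed
  \<comment> \<open>The trailing \<open>N\<close> makes the product with the adjoint of
    \<open>B\<close> the palindrome \<open>N * (F * N)\<close>, which is visibly Hermitian without a
    proof that \<open>F\<close> and \<open>N\<close> commute.\<close>
  define Q where "Q = B * (F * N)"
  have Q: "Q \<in> carrier_mat d d" using B F N by (simp add: Q_def)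
  have BQ: "mat_adjoint B * Q = N * (F * N)"
    using B Ba F N by (simp add: Q_def N_def assoc_mult_mat[of _ d d _ d _ d])
  have QB: "mat_adjoint Q * B = N * (F * N)"
    using B Ba F N Nh Fh
    by (simp add: Q_def N_def adjoint_mult[of _ d d _ d] assoc_mult_mat[of _ d d _ d _ d])
  have BP: "B * (mat_adjoint B * Q) = B"
  proof (rule eq_mat_by_mult_vec)
    show "B * (mat_adjoint B * Q) \<in> carrier_mat d d" "B \<in> carrier_mat d d" using B Q Ba by auto
    fix x :: "complex vec" assume x: "x \<in> carrier_vec d"
    define z where "z = N *\<^sub>v (F *\<^sub>v (N *\<^sub>v x))"
    have z: "z \<in> carrier_vec d" using N F x by (simp add: z_def)
    have Nzc: "N *\<^sub>v z \<in> carrier_vec d" using N z by simp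
    have Nxc: "N *\<^sub>v x \<in> carrier_vec d" and FNxc: "F *\<^sub>v (N *\<^sub>v x) \<in> carrier_vec d" using N F x by auto
    \<comment> \<open>In eigencoordinates both sides carry the factor t, since t * t * f t * t = t
      for every t including 0. As \<open>N\<close> and \<open>B\<close> have the same kernel, this
      carries over to \<open>B\<close>.\<close>
    have Nz: "N *\<^sub>v z = N *\<^sub>v x"
    proof -
      have "mat_adjoint U *\<^sub>v (N *\<^sub>v z) = mat_adjoint U *\<^sub>v (N *\<^sub>v x)"
      proof (rule eq_vecI)
        fix i assume "i < dim_vec (mat_adjoint U *\<^sub>v (N *\<^sub>v x))"
        then have i: "i < d" using U by simp
        show "(mat_adjoint U *\<^sub>v (N *\<^sub>v z)) $ i = (mat_adjoint U *\<^sub>v (N *\<^sub>v x)) $ i"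
          unfolding ed_coords_mult[OF ed N z i] ed_coords_mult[OF ed N x i]
          unfolding z_def ed_coords_mult[OF ed N FNxc i] coords_F[OF Nxc i] ed_coords_mult[OF ed N x i]
          by (simp add: f_def power2_eq_square)
      qed (use U in auto)
      then have "U *\<^sub>v (mat_adjoint U *\<^sub>v (N *\<^sub>v z)) = U *\<^sub>v (mat_adjoint U *\<^sub>v (N *\<^sub>v x))"
        by (rule arg_cong)
      then show ?thesis unfolding ed_expand[OF ed N Nxc] ed_expand[OF ed N Nzc] .
    qed
    have "mat_adjoint B *\<^sub>v (B *\<^sub>v (z - x)) = N *\<^sub>v (z - x)"
      unfolding N_def using z x by (intro assoc_mult_mat_vec[OF Ba B, symmetric]) simp
    also have "\<dots> = 0\<^sub>v d"
      using mult_minus_distrib_mat_vec[OF N z x] Nz vec_diff_eq_0[OF Nzc Nxc] by simp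
    finally have "B *\<^sub>v (z - x) = 0\<^sub>v d" by (rule adjoint_mult_vec_eq_0[OF B minus_carrier_vec[OF z x]])
    then have "B *\<^sub>v z = B *\<^sub>v x"
      unfolding mult_minus_distrib_mat_vec[OF B z x]
      using vec_diff_eq_0[OF square_mult_closed(2)[OF B z] square_mult_closed(2)[OF B x]] by simp
    moreover have "B * (N * (F * N)) *\<^sub>v x = B *\<^sub>v z"
    proof -
      have "B * (N * (F * N)) *\<^sub>v x = B *\<^sub>v (N * (F * N) *\<^sub>v x)"
        using N F by (intro assoc_mult_mat_vec[OF B _ x]) simp
      also have "N * (F * N) *\<^sub>v x = N *\<^sub>v (F * N *\<^sub>v x)"
        using N F by (intro assoc_mult_mat_vec[OF N _ x]) simp
      also have "F * N *\<^sub>v x = F *\<^sub>v (N *\<^sub>v x)" by (rule assoc_mult_mat_vec[OF F N x])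
      finally show ?thesis unfolding z_def .
    qed
    ultimately show "B * (mat_adjoint B * Q) *\<^sub>v x = B *\<^sub>v x" unfolding BQ by metis
  qed
  show ?thesis using that[OF Q] BQ QB BP by simp
qed

text \<open>\<open>Q\<close> acts on Ran B* as a right inverse of the adjoint of \<open>B\<close>,
  and its own adjoint is a left inverse of \<open>B\<close> there. With it the projector and L
  become explicit matrix products instead of definite descriptions.\<close>

locale boundary_conditions =
  fixes d :: nat and A B Q :: "complex mat"
  assumes A: "A \<in> carrier_mat d d" and B: "B \<in> carrier_mat d d" and Q: "Q \<in> carrier_mat d d"
    and surj: "\<forall>y \<in> carrier_vec d. \<exists>u \<in> carrier_vec d. \<exists>v \<in> carrier_vec d. A *\<^sub>v u + B *\<^sub>v v = y"
    and selfadj: "mat_adjoint (A * mat_adjoint B) = A * mat_adjoint B"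
    and QB: "mat_adjoint Q * B = mat_adjoint B * Q"
    and BBQ: "B * (mat_adjoint B * Q) = B"
begin

text \<open>\<open>P\<close> is the paper's \<open>P\<^sup>\<bottom>\<close>, and \<open>Lt\<close> is \<open>L\<close> extended by zero to the kernel of \<open>B\<close>.\<close>

definition P :: "complex mat" where "P = mat_adjoint B * Q"
definition Lt :: "complex mat" where "Lt = mat_adjoint Q * (A * mat_adjoint B * Q)"

section \<open>The projector onto Ran B* and the matrix of L\<close>

lemmas carriers [simp] = A B Q adjoint_carrier[OF A] adjoint_carrier[OF B] adjoint_carrier[OF Q]

lemma P_carrier [simp]: "P \<in> carrier_mat d d" by (simp add: P_def)
lemma Lt_carrier [simp]: "Lt \<in> carrier_mat d d" by (auto simp: Lt_def intro!: mult_carrier_mat[of _ d d])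

lemmas massoc = assoc_mult_mat[of _ d d _ d _ d]
lemmas vassoc = assoc_mult_mat_vec[of _ d d _ d]

lemma AB_comm: "A * mat_adjoint B = B * mat_adjoint A"
  using selfadj adjoint_mult[OF A carriers(5)] by simp

lemma P_hermitian: "mat_adjoint P = P"
  using QB by (simp add: P_def adjoint_mult[of _ d d _ d])

lemma BP: "B * P = B" using BBQ by (simp add: P_def)

lemma P_adjB: "P * mat_adjoint B = mat_adjoint B"
  using adjoint_mult[OF B P_carrier] BP P_hermitian by simp

lemma P_idem: "P * P = P"
  using P_adjB massoc[of P "mat_adjoint B" Q] by (simp add: P_def)

lemma Lt_hermitian: "mat_adjoint Lt = Lt"
proof -
  have c: "A * mat_adjoint B \<in> carrier_mat d d" by simp
  show ?thesis
    unfolding Lt_def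
    using adjoint_mult[OF carriers(6) mult_carrier_mat[OF c Q]] adjoint_mult[OF c Q] selfadj
      massoc[of "mat_adjoint Q" "A * mat_adjoint B" Q] c by simp
qed

text \<open>Self-adjointness of A B* brings the adjoint of \<open>B\<close> to the front, which
  shows that the range of \<open>Lt\<close> is contained in Ran B*.\<close>

lemma Lt_adjB: "Lt = mat_adjoint B * (Q * (mat_adjoint A * Q))"
proof -
  have "Lt = mat_adjoint Q * (B * mat_adjoint A * Q)" by (simp add: Lt_def AB_comm)
  also have "\<dots> = (mat_adjoint Q * B) * (mat_adjoint A * Q)" by (simp add: massoc)
  also have "\<dots> = mat_adjoint B * (Q * (mat_adjoint A * Q))" by (simp add: QB massoc)
  finally show ?thesis .
qed

lemma P_Lt: "P * Lt = Lt"
proof -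
  have "P * Lt = (P * mat_adjoint B) * (Q * (mat_adjoint A * Q))"
    unfolding Lt_adjB by (rule massoc[symmetric]) auto
  then show ?thesis by (simp add: P_adjB Lt_adjB)
qed

text \<open>The equation that characterizes L. Self-adjointness of A B* is what places the range of
  \<open>A * P\<close> inside that of \<open>B\<close>, where the inverse of \<open>B\<close> makes
  sense.\<close>

lemma B_Lt: "B * Lt = A * P"
proof -
  have "B * Lt = (B * (mat_adjoint B * Q)) * (mat_adjoint A * Q)"
    unfolding Lt_adjB by (simp add: massoc)
  also have "\<dots> = (B * mat_adjoint A) * Q" by (simp add: BBQ massoc)
  also have "\<dots> = A * P" by (simp add: AB_comm[symmetric] P_def massoc)
  finally show ?thesis .
qed

lemma ran_adjB_iff: "x \<in> ran_adjB d B \<longleftrightarrow> x \<in> carrier_vec d \<and> P *\<^sub>v x = x"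
proof
  assume "x \<in> ran_adjB d B"
  then obtain y where y: "y \<in> carrier_vec d" "x = mat_adjoint B *\<^sub>v y" by (auto simp: ran_adjB_def)
  have "P *\<^sub>v x = (P * mat_adjoint B) *\<^sub>v y" using y by (simp add: vassoc)
  then show "x \<in> carrier_vec d \<and> P *\<^sub>v x = x" using y by (auto simp: P_adjB intro: mult_mat_vec_carrier carriers)
next
  assume x: "x \<in> carrier_vec d \<and> P *\<^sub>v x = x"
  then have "x \<in> carrier_vec d" by simp
  then have "mat_adjoint B *\<^sub>v (Q *\<^sub>v x) = P *\<^sub>v x" by (simp add: P_def vassoc)
  then have "x = mat_adjoint B *\<^sub>v (Q *\<^sub>v x)" using x by simp
  moreover have "Q *\<^sub>v x \<in> carrier_vec d" using x by (auto intro: mult_mat_vec_carrier carriers)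
  ultimately show "x \<in> ran_adjB d B" by (auto simp: ran_adjB_def)
qed

lemma kerB_ran_trivial:
  assumes "x \<in> ran_adjB d B" "B *\<^sub>v x = 0\<^sub>v d"
  shows "x = 0\<^sub>v d"
proof -
  obtain y where y: "y \<in> carrier_vec d" "x = mat_adjoint B *\<^sub>v y" using assms by (auto simp: ran_adjB_def)
  show ?thesis using adjoint_mult_vec_eq_0[of "mat_adjoint B" d d y] y assms(2) by simp
qed

lemma ran_adjB_eqI:
  assumes "x \<in> ran_adjB d B" "y \<in> ran_adjB d B" "B *\<^sub>v x = B *\<^sub>v y"
  shows "x = y"
proof -
  have c: "x \<in> carrier_vec d" "y \<in> carrier_vec d" and p: "P *\<^sub>v x = x" "P *\<^sub>v y = y"
    using assms by (auto simp: ran_adjB_iff)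
  have "x - y \<in> ran_adjB d B"
    using c p by (simp add: ran_adjB_iff mult_minus_distrib_mat_vec[of _ d d])
  moreover have "B *\<^sub>v (x - y) = 0\<^sub>v d"
    using c assms(3) by (simp add: mult_minus_distrib_mat_vec[of _ d d])
  ultimately show ?thesis using kerB_ran_trivial vec_diff_eq_0[OF c] by blast
qed

lemma P_in_ran: "x \<in> carrier_vec d \<Longrightarrow> P *\<^sub>v x \<in> ran_adjB d B"
  using P_idem by (simp add: ran_adjB_iff vassoc[symmetric])

lemma Lt_in_ran: "x \<in> carrier_vec d \<Longrightarrow> Lt *\<^sub>v x \<in> ran_adjB d B"
  using P_Lt by (simp add: ran_adjB_iff vassoc[symmetric])

lemma B_P: "x \<in> carrier_vec d \<Longrightarrow> B *\<^sub>v (P *\<^sub>v x) = B *\<^sub>v x"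
  by (simp add: vassoc[symmetric] BP)

lemma Pperp_eq:
  assumes x: "x \<in> carrier_vec d"
  shows "Pperp d B x = P *\<^sub>v x"
  unfolding Pperp_def
proof (rule the_equality)
  \<comment> \<open>Orthogonality to Ran B* means membership in Ker B, so the description of the
    projection becomes an equation for \<open>B\<close>.\<close>
  have *: "B *\<^sub>v (x - y) = 0\<^sub>v d \<longleftrightarrow> (\<forall>z\<in>ran_adjB d B. (x - y) \<bullet>c z = 0)" if y: "y \<in> carrier_vec d" for y
  proof
    assume 0: "B *\<^sub>v (x - y) = 0\<^sub>v d"
    show "\<forall>z\<in>ran_adjB d B. (x - y) \<bullet>c z = 0"
    proof
      fix z assume "z \<in> ran_adjB d B"
      then obtain w where w: "w \<in> carrier_vec d" "z = mat_adjoint B *\<^sub>v w" by (auto simp: ran_adjB_def)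
      then show "(x - y) \<bullet>c z = 0" using cscalar_prod_adjoint[OF B _ w(1), of "x - y"] 0 x y by simp
    qed
  next
    assume "\<forall>z\<in>ran_adjB d B. (x - y) \<bullet>c z = 0"
    moreover have "mat_adjoint B *\<^sub>v (B *\<^sub>v (x - y)) \<in> ran_adjB d B" using x y by (auto simp: ran_adjB_def)
    ultimately have "(B *\<^sub>v (x - y)) \<bullet>c (B *\<^sub>v (x - y)) = 0"
      using cscalar_prod_adjoint[OF B, of "x - y" "B *\<^sub>v (x - y)"] x y by simp
    then show "B *\<^sub>v (x - y) = 0\<^sub>v d" using cscalar_prod_self_eq_0[of "B *\<^sub>v (x - y)" d] x y by simp
  qed
  have **: "B *\<^sub>v (x - y) = 0\<^sub>v d \<longleftrightarrow> B *\<^sub>v x = B *\<^sub>v y" if y: "y \<in> carrier_vec d" for y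
    using x y vec_diff_eq_0[of "B *\<^sub>v x" d "B *\<^sub>v y"] by (simp add: mult_minus_distrib_mat_vec[of _ d d])
  show "P *\<^sub>v x \<in> ran_adjB d B \<and> (\<forall>z\<in>ran_adjB d B. (x - P *\<^sub>v x) \<bullet>c z = 0)"
    using *[of "P *\<^sub>v x"] **[of "P *\<^sub>v x"] P_in_ran[OF x] B_P[OF x] x by simp
  fix y assume y: "y \<in> ran_adjB d B \<and> (\<forall>z\<in>ran_adjB d B. (x - y) \<bullet>c z = 0)"
  then have yc: "y \<in> carrier_vec d" by (simp add: ran_adjB_iff)
  then have "B *\<^sub>v x = B *\<^sub>v y" using y *[OF yc] **[OF yc] by blast
  then show "y = P *\<^sub>v x" using ran_adjB_eqI[of y "P *\<^sub>v x"] y P_in_ran[OF x] B_P[OF x] by simp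
qed

lemma Lop_eq:
  assumes x: "x \<in> carrier_vec d"
  shows "Lop d A B x = Lt *\<^sub>v x"
  unfolding Lop_def Pperp_eq[OF x]
proof (rule the_equality)
  have B_Lt': "B *\<^sub>v (Lt *\<^sub>v x) = A *\<^sub>v (P *\<^sub>v x)" using x by (simp add: vassoc[symmetric] B_Lt)
  then show "Lt *\<^sub>v x \<in> ran_adjB d B \<and> B *\<^sub>v (Lt *\<^sub>v x) = A *\<^sub>v (P *\<^sub>v x)"
    using Lt_in_ran[OF x] by simp
  fix y assume "y \<in> ran_adjB d B \<and> B *\<^sub>v y = A *\<^sub>v (P *\<^sub>v x)"
  then show "y = Lt *\<^sub>v x" using ran_adjB_eqI[of y "Lt *\<^sub>v x"] Lt_in_ran[OF x] B_Lt' by simp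
qed

text \<open>An eigenvector for a nonzero value is a multiple of its image under \<open>Lt\<close>
  and hence lies in Ran B*. For the value 0 this fails, because \<open>Lt\<close> vanishes on all of
  Ker B.\<close>

lemma kerL_iff:
  assumes "\<mu> \<noteq> 0"
  shows "x \<in> kerL d A B \<mu> \<longleftrightarrow> x \<in> carrier_vec d \<and> Lt *\<^sub>v x = complex_of_real \<mu> \<cdot>\<^sub>v x"
proof
  assume "x \<in> kerL d A B \<mu>"
  then show "x \<in> carrier_vec d \<and> Lt *\<^sub>v x = complex_of_real \<mu> \<cdot>\<^sub>v x"
    using Lop_eq by (auto simp: kerL_def ran_adjB_iff)
next
  assume x: "x \<in> carrier_vec d \<and> Lt *\<^sub>v x = complex_of_real \<mu> \<cdot>\<^sub>v x"
  then have "x = complex_of_real (1 / \<mu>) \<cdot>\<^sub>v (Lt *\<^sub>v x)"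
    using assms by (simp add: smult_smult_assoc)
  moreover have "P *\<^sub>v (complex_of_real (1 / \<mu>) \<cdot>\<^sub>v (Lt *\<^sub>v x)) = complex_of_real (1 / \<mu>) \<cdot>\<^sub>v (Lt *\<^sub>v x)"
    using x Lt_in_ran[of x] by (simp add: ran_adjB_iff mult_mat_vec[of _ d d])
  ultimately have "P *\<^sub>v x = x" by simp
  then show "x \<in> kerL d A B \<mu>" using x Lop_eq[of x] by (auto simp: kerL_def ran_adjB_iff)
qed

text \<open>The matrices \<open>A \<plusminus> iB\<close> satisfy \<open>(A \<plusminus> iB)(A \<plusminus> iB)\<^sup>* = AA\<^sup>* + BB\<^sup>*\<close>, which surjectivity
makes invertible; solving for \<open>u \<mp> iv\<close> exhibits \<open>u\<close> as an element of the range of \<open>B\<^sup>*\<close>.\<close>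

lemma kernel_in_ran:
  assumes u: "u \<in> carrier_vec d" and v: "v \<in> carrier_vec d" and 0: "A *\<^sub>v u + B *\<^sub>v v = 0\<^sub>v d"
  shows "u \<in> ran_adjB d B"
proof -
  define C where "C = A * mat_adjoint A + B * mat_adjoint B"
  have C: "C \<in> carrier_mat d d" by (simp add: C_def)
  have "det C \<noteq> 0"
  proof
    assume "det C = 0"
    then obtain w where w: "w \<in> carrier_vec d" "w \<noteq> 0\<^sub>v d" "C *\<^sub>v w = 0\<^sub>v d"
      using det_0_iff_vec_prod_zero[OF C] by auto
    \<comment> \<open>A kernel vector \<open>w\<close> of \<open>C\<close> is annihilated by both
      adjoints, hence orthogonal to every A u' + B v'. By surjectivity \<open>w\<close> is itself of
      this form.\<close>
    define p where "p = mat_adjoint A *\<^sub>v w"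
    define q where "q = mat_adjoint B *\<^sub>v w"
    have pq: "p \<in> carrier_vec d" "q \<in> carrier_vec d" using w by (auto simp: p_def q_def)
    have "C *\<^sub>v w = A *\<^sub>v p + B *\<^sub>v q"
      using w by (simp add: C_def p_def q_def add_mult_distrib_mat_vec[of _ d d] vassoc)
    moreover have "(C *\<^sub>v w) \<bullet>c w = 0" using w by simp
    ultimately have "0 = (A *\<^sub>v p + B *\<^sub>v q) \<bullet>c w" by simp
    also have "\<dots> = (A *\<^sub>v p) \<bullet>c w + (B *\<^sub>v q) \<bullet>c w"
      using w pq by (intro add_scalar_prod_distrib[of _ d]) auto
    also have "\<dots> = p \<bullet>c p + q \<bullet>c q"
      using cscalar_prod_adjoint[OF A pq(1) w(1)] cscalar_prod_adjoint[OF B pq(2) w(1)] by (simp add: p_def q_def)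
    finally have "sqnorm p + sqnorm q = 0" by (simp add: sqnorm_def flip: plus_complex.sel(1))
    then have "sqnorm p = 0" "sqnorm q = 0"
      using sqnorm_nonneg[OF pq(1)] sqnorm_nonneg[OF pq(2)] by auto
    then have p0: "p = 0\<^sub>v d" and q0: "q = 0\<^sub>v d" using sqnorm_pos pq by force+
    obtain u' v' where u': "u' \<in> carrier_vec d" and v': "v' \<in> carrier_vec d" and "A *\<^sub>v u' + B *\<^sub>v v' = w"
      using surj w by blast
    then have "w \<bullet>c w = (A *\<^sub>v u' + B *\<^sub>v v') \<bullet>c w" by simp
    also have "\<dots> = (A *\<^sub>v u') \<bullet>c w + (B *\<^sub>v v') \<bullet>c w"
      using w u' v' by (intro add_scalar_prod_distrib[of _ d]) auto
    also have "\<dots> = u' \<bullet>c p + v' \<bullet>c q"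
      using cscalar_prod_adjoint[OF A u' w(1)] cscalar_prod_adjoint[OF B v' w(1)] by (simp add: p_def q_def)
    also have "\<dots> = 0" using p0 q0 u' v' by simp
    finally show False using w cscalar_prod_self_eq_0 by blast
  qed
  then obtain C' where C': "C' \<in> carrier_mat d d" "C * C' = 1\<^sub>m d"
    using det_non_zero_imp_unit[OF C, of "()"] by (auto simp: Units_def ring_mat_def)
  define w where "w = C' *\<^sub>v (A *\<^sub>v v - B *\<^sub>v u)"
  have w: "w \<in> carrier_vec d" using C' u v by (simp add: w_def)
  have Cw: "C *\<^sub>v w = A *\<^sub>v v - B *\<^sub>v u"
    using C C' u v by (simp add: w_def vassoc[symmetric])
  \<comment> \<open>With S = A + e B the hypothesis reads S (u - e v) = - e (A v - B u), and S has
    the inverse S* C', so u - e v = - e S* w. Adding the cases e = \<i> and e = - \<i> eliminates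
    \<open>v\<close>.\<close>
  have solve: "u $ i - e * v $ i = - (mat_adjoint B *\<^sub>v w) $ i - e * (mat_adjoint A *\<^sub>v w) $ i"
    if e: "e = \<i> \<or> e = - \<i>" and i: "i < d" for e i
  proof -
    define S where "S = A + e \<cdot>\<^sub>m B"
    have S: "S \<in> carrier_mat d d" "mat_adjoint S \<in> carrier_mat d d" by (auto simp: S_def)
    have adjS: "mat_adjoint S = mat_adjoint A + cnj e \<cdot>\<^sub>m mat_adjoint B"
      by (simp add: S_def adjoint_add[of _ d d] adjoint_smult)
    \<comment> \<open>The cross terms cancel because A B* is self-adjoint and e + cnj e = 0; the
      last coefficient is |e|^2 = 1.\<close>
    have "S * mat_adjoint S = A * mat_adjoint A + e \<cdot>\<^sub>m (B * mat_adjoint A)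
        + (cnj e \<cdot>\<^sub>m (A * mat_adjoint B) + (cnj e * e) \<cdot>\<^sub>m (B * mat_adjoint B))"
    proof (rule eq_mat_by_mult_vec)
      fix x :: "complex vec" assume x: "x \<in> carrier_vec d"
      show "S * mat_adjoint S *\<^sub>v x = (A * mat_adjoint A + e \<cdot>\<^sub>m (B * mat_adjoint A)
        + (cnj e \<cdot>\<^sub>m (A * mat_adjoint B) + (cnj e * e) \<cdot>\<^sub>m (B * mat_adjoint B))) *\<^sub>v x"
        using x S unfolding adjS
        by (simp add: S_def vassoc add_mult_distrib_mat_vec[of _ d d] smult_mat_mult_vec[of _ d d]
            mult_add_distrib_mat_vec[of _ d d] mult_mat_vec[of _ d d] smult_add_distrib_vec[of _ d] smult_smult_assoc)
    qed (use S in auto)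
    also have "\<dots> = C"
    proof -
      have *: "X + e \<cdot>\<^sub>m Z + (cnj e \<cdot>\<^sub>m Z + (cnj e * e) \<cdot>\<^sub>m Y) = X + Y"
        if "X \<in> carrier_mat d d" "Y \<in> carrier_mat d d" "Z \<in> carrier_mat d d" for X Y Z :: "complex mat"
        using e that by (intro eq_matI) auto
      show ?thesis unfolding C_def AB_comm by (rule *) simp_all
    qed
    finally have "S * mat_adjoint S = C" .
    then have "S * (mat_adjoint S * C') = 1\<^sub>m d"
      using S C' by (simp add: massoc[symmetric])
    then have inv: "mat_adjoint S * C' * S = 1\<^sub>m d"
      using mat_mult_left_right_inverse[OF S(1) mult_carrier_mat[OF S(2) C'(1)]] by simp
    define x where "x = u - e \<cdot>\<^sub>v v"
    have x: "x \<in> carrier_vec d" using u v by (simp add: x_def)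
    have Sx: "S *\<^sub>v x = - e \<cdot>\<^sub>v (A *\<^sub>v v - B *\<^sub>v u)"
    proof (rule eq_vecI)
      fix j assume "j < dim_vec (- e \<cdot>\<^sub>v (A *\<^sub>v v - B *\<^sub>v u))"
      then have j: "j < d" using B by auto
      have "(A *\<^sub>v u + B *\<^sub>v v) $ j = 0" using 0 j by simp
      then have z: "(A *\<^sub>v u) $ j + (B *\<^sub>v v) $ j = 0" using j B by (simp del: index_mult_mat_vec)
      have "S *\<^sub>v x = A *\<^sub>v u + e \<cdot>\<^sub>v (B *\<^sub>v u) - e \<cdot>\<^sub>v (A *\<^sub>v v + e \<cdot>\<^sub>v (B *\<^sub>v v))"
        using u v by (simp add: S_def x_def add_mult_distrib_mat_vec[of _ d d] smult_mat_mult_vec[of _ d d]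
            mult_minus_distrib_mat_vec[of _ d d] mult_mat_vec[of _ d d])
      then have "(S *\<^sub>v x) $ j = (A *\<^sub>v u) $ j + e * (B *\<^sub>v u) $ j - e * ((A *\<^sub>v v) $ j + e * (B *\<^sub>v v) $ j)"
        using j carrier_matD[OF A] carrier_matD[OF B] by (simp del: index_mult_mat_vec)
      also have "\<dots> = ((A *\<^sub>v u) $ j + (B *\<^sub>v v) $ j) - e * ((A *\<^sub>v v) $ j - (B *\<^sub>v u) $ j)"
        using e by (auto simp: algebra_simps)
      finally show "(S *\<^sub>v x) $ j = (- e \<cdot>\<^sub>v (A *\<^sub>v v - B *\<^sub>v u)) $ j"
        using z j carrier_matD[OF A] carrier_matD[OF B] by (simp add: algebra_simps del: index_mult_mat_vec)
    qed (use S carrier_matD[OF A] carrier_matD[OF B] in auto)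
    have "x = (mat_adjoint S * C' * S) *\<^sub>v x" using inv x by simp
    also have "\<dots> = mat_adjoint S *\<^sub>v (C' *\<^sub>v (S *\<^sub>v x))" using S C' x by (simp add: vassoc)
    also have "C' *\<^sub>v (S *\<^sub>v x) = - e \<cdot>\<^sub>v w"
      unfolding Sx w_def using C' u v by (simp add: mult_mat_vec[of _ d d])
    finally have "x = - e \<cdot>\<^sub>v (mat_adjoint A *\<^sub>v w + cnj e \<cdot>\<^sub>v (mat_adjoint B *\<^sub>v w))"
      using w unfolding adjS
      by (simp add: mult_mat_vec[of _ d d] add_mult_distrib_mat_vec[of _ d d] smult_mat_mult_vec[of _ d d])
    then have "x $ i = - e * ((mat_adjoint A *\<^sub>v w) $ i + cnj e * (mat_adjoint B *\<^sub>v w) $ i)"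
      using i carrier_matD[OF A] carrier_matD[OF B] by (simp del: index_mult_mat_vec)
    moreover have "x $ i = u $ i - e * v $ i" using i u v by (simp add: x_def)
    ultimately show ?thesis using e by (auto simp: algebra_simps)
  qed
  have "u = mat_adjoint B *\<^sub>v (- 1 \<cdot>\<^sub>v w)"
  proof (rule eq_vecI)
    fix i assume "i < dim_vec (mat_adjoint B *\<^sub>v (- 1 \<cdot>\<^sub>v w))"
    then have i: "i < d" using B by simp
    have "(u $ i - \<i> * v $ i) + (u $ i - (- \<i>) * v $ i)
        = (- (mat_adjoint B *\<^sub>v w) $ i - \<i> * (mat_adjoint A *\<^sub>v w) $ i)
          + (- (mat_adjoint B *\<^sub>v w) $ i - (- \<i>) * (mat_adjoint A *\<^sub>v w) $ i)"
      unfolding solve[OF disjI1[OF refl] i] solve[OF disjI2[OF refl] i] ..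
    then have "u $ i = - (mat_adjoint B *\<^sub>v w) $ i" by (simp del: index_mult_mat_vec)
    moreover have "mat_adjoint B *\<^sub>v (- 1 \<cdot>\<^sub>v w) = - 1 \<cdot>\<^sub>v (mat_adjoint B *\<^sub>v w)"
      using w by (simp add: mult_mat_vec[of _ d d])
    ultimately show "u $ i = (mat_adjoint B *\<^sub>v (- 1 \<cdot>\<^sub>v w)) $ i"
      using i carrier_matD[OF B] by (simp del: index_mult_mat_vec)
  qed (use u carrier_matD[OF B] in auto)
  then show ?thesis using w by (auto simp: ran_adjB_def)
qed

text \<open>Once \<open>u\<close> lies in Ran B*, applying \<open>B\<close> to L u + P v gives A u +
  B v, and \<open>B\<close> is injective on Ran B*.\<close>

lemma boundary_condition_iff:
  assumes u: "u \<in> carrier_vec d" and v: "v \<in> carrier_vec d"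
  shows "A *\<^sub>v u + B *\<^sub>v v = 0\<^sub>v d \<longleftrightarrow> P *\<^sub>v u = u \<and> Lt *\<^sub>v u + P *\<^sub>v v = 0\<^sub>v d"
proof -
  have eq: "B *\<^sub>v (Lt *\<^sub>v u + P *\<^sub>v v) = A *\<^sub>v (P *\<^sub>v u) + B *\<^sub>v v"
    using u v by (simp add: mult_add_distrib_mat_vec[of _ d d] vassoc[symmetric] B_Lt BP)
  show ?thesis
  proof
    assume 0: "A *\<^sub>v u + B *\<^sub>v v = 0\<^sub>v d"
    then have Pu: "P *\<^sub>v u = u" using kernel_in_ran[OF u v] by (simp add: ran_adjB_iff)
    have "Lt *\<^sub>v u + P *\<^sub>v v \<in> ran_adjB d B"
      using u v Lt_in_ran[OF u] P_in_ran[OF v] by (simp add: ran_adjB_iff mult_add_distrib_mat_vec[of _ d d])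
    then show "P *\<^sub>v u = u \<and> Lt *\<^sub>v u + P *\<^sub>v v = 0\<^sub>v d"
      using Pu 0 eq kerB_ran_trivial by simp
  next
    assume "P *\<^sub>v u = u \<and> Lt *\<^sub>v u + P *\<^sub>v v = 0\<^sub>v d"
    then show "A *\<^sub>v u + B *\<^sub>v v = 0\<^sub>v d" using eq mult_mat_zero_vec[OF B] by simp
  qed
qed

end

section \<open>The dispersion functions\<close>

definition ktanh :: "real \<Rightarrow> real \<Rightarrow> real" where "ktanh a k = k * tanh (k * a / 2)"
definition kcoth :: "real \<Rightarrow> real \<Rightarrow> real" where "kcoth a k = k / tanh (k * a / 2)"

section \<open>Monotonicity and bounds\<close>

lemma ktanh_strict_mono:
  assumes "0 < a" "0 \<le> k" "k < k'"
  shows "ktanh a k < ktanh a k'"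
proof -
  have "tanh (k * a / 2) < tanh (k' * a / 2)" using assms by (simp add: divide_strict_right_mono)
  moreover have "0 \<le> tanh (k * a / 2)" using assms by simp
  ultimately show ?thesis unfolding ktanh_def using assms by (intro mult_strict_mono') auto
qed

lemma ktanh_strict_mono_length:
  assumes "0 < k" "a < a'"
  shows "ktanh a k < ktanh a' k"
proof -
  have "tanh (k * a / 2) < tanh (k * a' / 2)" using assms by simp
  then show ?thesis using assms by (simp add: ktanh_def)
qed

lemma kcoth_antimono_length:
  assumes "0 < k" "0 < a" "a \<le> a'"
  shows "kcoth a' k \<le> kcoth a k"
proof -
  have "tanh (k * a / 2) \<le> tanh (k * a' / 2)" "0 < tanh (k * a / 2)" using assms by auto
  then show ?thesis using assms unfolding kcoth_def by (intro divide_left_mono) auto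
qed

lemma ktanh_less:
  assumes "0 < k" shows "ktanh a k < k"
  using assms tanh_real_lt_1[of "k * a / 2"] by (simp add: ktanh_def)

lemma less_kcoth:
  assumes "0 < k" "0 < a" shows "k < kcoth a k"
proof -
  have "0 < tanh (k * a / 2)" "tanh (k * a / 2) < 1" using assms tanh_real_lt_1 by auto
  then show ?thesis using assms by (simp add: kcoth_def less_divide_eq)
qed

lemma sinh_gt_self:
  fixes x :: real
  assumes "0 < x" shows "x < sinh x"
proof -
  have "sinh 0 - 0 < sinh x - x"
  proof (rule DERIV_pos_imp_increasing_open[where f = "\<lambda>x. sinh x - x", OF assms])
    fix y :: real assume y: "0 < y" "y < x"
    have "cosh y > 1" using y by (metis cosh_0 cosh_real_strict_mono order_refl)
    then show "\<exists>z. ((\<lambda>x. sinh x - x) has_real_derivative z) (at y) \<and> 0 < z"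
      by (intro exI[of _ "cosh y - 1"]) (auto intro!: derivative_eq_intros)
  qed (auto intro!: continuous_intros)
  then show ?thesis by simp
qed

text \<open>With x = k a / 2 this is the monotonicity of x coth x, whose derivative has the
  numerator sinh x cosh x - x = sinh (2 x) / 2 - x, positive by \<open>sinh_gt_self\<close>.\<close>

lemma kcoth_strict_mono:
  assumes "0 < a" "0 < k" "k < k'"
  shows "kcoth a k < kcoth a k'"
proof -
  define f where "f = (\<lambda>x::real. x * cosh x / sinh x)"
  have "f (k * a / 2) < f (k' * a / 2)"
  proof (rule DERIV_pos_imp_increasing[where f = f])
    show "k * a / 2 < k' * a / 2" using assms by simp
    fix x assume x: "k * a / 2 \<le> x" "x \<le> k' * a / 2"
    have x0: "0 < x" using assms x(1) by (smt (verit) divide_pos_pos mult_pos_pos)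
    have s: "0 < sinh x" using x0 by simp
    have "2 * x < sinh (2 * x)" using x0 by (intro sinh_gt_self) simp
    then have gt: "x < sinh x * cosh x" by (simp add: sinh_double)
    have sq: "cosh x * cosh x = sinh x * sinh x + 1"
      using cosh_square_eq[of x] by (simp add: power2_eq_square)
    have "(f has_real_derivative ((cosh x + x * sinh x) * sinh x - x * cosh x * cosh x) / (sinh x * sinh x)) (at x)"
      unfolding f_def using s by (auto intro!: derivative_eq_intros)
    moreover have "(cosh x + x * sinh x) * sinh x - x * cosh x * cosh x = sinh x * cosh x - x"
      using sq by (simp add: algebra_simps)
    ultimately show "\<exists>y. (f has_real_derivative y) (at x) \<and> 0 < y"
      using gt s by (intro exI[of _ "(sinh x * cosh x - x) / (sinh x * sinh x)"]) auto
  qed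
  moreover have "kcoth a q = 2 / a * f (q * a / 2)" if "0 < q" for q
    using assms that by (simp add: kcoth_def f_def tanh_def)
  ultimately show ?thesis using assms by (simp add: divide_strict_right_mono)
qed

text \<open>For x = k a / 2 the claim x coth x \<le> x + 1 is equivalent to 1 + 2 x \<le> exp (2
  x).\<close>

lemma kcoth_le:
  assumes "0 < a" "0 < k" shows "kcoth a k \<le> k + 2 / a"
proof -
  define x where "x = k * a / 2"
  have x: "0 < x" using assms by (simp add: x_def)
  have e: "1 + 2 * x \<le> exp (2 * x)" by (rule exp_ge_add_one_self)
  have e1: "exp (2 * x) - 1 > 0" using x by simp
  have th: "tanh x = (exp (2 * x) - 1) / (exp (2 * x) + 1)"
  proof -
    have "tanh x = (1 - exp (- 2 * x)) / (1 + exp (- 2 * x))" by (rule tanh_real_altdef)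
    also have "\<dots> = (exp (2 * x) * (1 - exp (- 2 * x))) / (exp (2 * x) * (1 + exp (- 2 * x)))" by simp
    also have "\<dots> = (exp (2 * x) - 1) / (exp (2 * x) + 1)"
      by (simp add: right_diff_distrib distrib_left flip: exp_add)
    finally show ?thesis .
  qed
  have "x / tanh x \<le> x + 1"
  proof -
    have "x * (exp (2 * x) + 1) \<le> (x + 1) * (exp (2 * x) - 1)" using e by (simp add: algebra_simps)
    then show ?thesis unfolding th using e1 by (simp add: pos_divide_le_eq)
  qed
  moreover have "kcoth a k = 2 / a * (x / tanh x)" using assms by (simp add: kcoth_def x_def)
  ultimately have "kcoth a k \<le> 2 / a * (x + 1)"
    using assms mult_left_mono[of "x / tanh x" "x + 1" "2 / a"] by simp
  also have "\<dots> = k + 2 / a" using assms by (simp add: x_def field_simps)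
  finally show ?thesis .
qed

section \<open>Continuity and the inverse functions \<open>nu\<close> and \<open>eta\<close>\<close>

lemma continuous_ktanh: "continuous (at k within S) (ktanh a)"
  unfolding ktanh_def by (intro continuous_intros) (auto simp: cosh_real_nonzero)

lemma continuous_kcoth: "0 < k \<Longrightarrow> 0 < a \<Longrightarrow> continuous (at k within S) (kcoth a)"
  unfolding kcoth_def by (intro continuous_intros) (auto simp: cosh_real_nonzero)

lemma ktanh_unbounded:
  assumes "0 < a"
  obtains K where "0 < K" "C < ktanh a K"
proof -
  \<comment> \<open>From 2/a on the factor tanh is at least tanh 1, so \<open>ktanh a\<close> grows
    at least linearly; the second entry pushes it beyond \<open>C\<close>.\<close>
  define K where "K = max (2 / a) (\<bar>C\<bar> / tanh 1 + 1)"
  have t: "0 < tanh (1::real)" by simp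
  have K: "2 / a \<le> K" "\<bar>C\<bar> / tanh 1 + 1 \<le> K" by (auto simp: K_def)
  have K0: "0 < K" using K(1) assms by (smt (verit) divide_pos_pos)
  have "1 \<le> K * a / 2" using K(1) assms by (simp add: field_simps)
  then have "tanh 1 \<le> tanh (K * a / 2)" by simp
  then have "K * tanh 1 \<le> ktanh a K" using K0 by (simp add: ktanh_def)
  moreover have "C < K * tanh 1"
  proof -
    have "C \<le> \<bar>C\<bar>" by simp
    also have "\<dots> < (\<bar>C\<bar> / tanh 1 + 1) * tanh 1" using t by (simp add: distrib_right)
    also have "\<dots> \<le> K * tanh 1" using K(2) t by (intro mult_right_mono) auto
    finally show ?thesis .
  qed
  ultimately show ?thesis using that K0 by force
qed

lemma nu_ktanh:
  assumes "0 < m" "0 < a"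
  shows "0 < nu m a" "ktanh a (nu m a) = m"
proof -
  obtain K where K: "0 < K" "m < ktanh a K" using ktanh_unbounded[OF assms(2)] .
  have "\<exists>k\<ge>0. k \<le> K \<and> ktanh a k = m"
    using K assms by (intro IVT') (auto intro!: continuous_at_imp_continuous_on continuous_ktanh simp: ktanh_def[of a 0])
  then obtain k where k: "0 \<le> k" "ktanh a k = m" by blast
  then have k0: "0 < k" using assms by (cases "k = 0") (auto simp: ktanh_def)
  have "\<exists>!k. 0 < k \<and> m = k * tanh (k * a / 2)"
  proof (rule ex1I[of _ k])
    show "0 < k \<and> m = k * tanh (k * a / 2)" using k k0 by (simp add: ktanh_def)
    fix k' assume "0 < k' \<and> m = k' * tanh (k' * a / 2)"
    then have "0 < k'" "ktanh a k' = ktanh a k" using k by (auto simp: ktanh_def)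
    then show "k' = k"
      using ktanh_strict_mono[OF assms(2), of k k'] ktanh_strict_mono[OF assms(2), of k' k] k0
      by (cases k k' rule: linorder_cases) auto
  qed
  from theI'[OF this] show "0 < nu m a" "ktanh a (nu m a) = m" unfolding nu_def ktanh_def by auto
qed

lemma eta_kcoth:
  assumes "0 < l" "0 < a"
  shows "0 < eta l a" "kcoth a (eta l a) = l + 2 / a"
proof -
  \<comment> \<open>The interval for the intermediate value theorem must avoid 0, where division by
    zero gives \<open>kcoth\<close> the value 0 instead of its limit 2/a. At l/2 the estimate
    \<open>kcoth_le\<close> leaves enough room.\<close>
  have "kcoth a (l / 2) \<le> l + 2 / a" using kcoth_le[of a "l / 2"] assms by simp
  moreover have "l + 2 / a \<le> kcoth a (l + 2 / a)" using less_kcoth[of "l + 2 / a" a] assms by (simp add: add_pos_pos)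
  moreover have "l / 2 \<le> l + 2 / a" using assms by (smt (verit) divide_pos_pos field_sum_of_halves)
  moreover have "continuous_on {l / 2..l + 2 / a} (kcoth a)"
    using assms by (intro continuous_at_imp_continuous_on ballI continuous_kcoth) auto
  ultimately have "\<exists>k\<ge>l/2. k \<le> l + 2 / a \<and> kcoth a k = l + 2 / a" by (intro IVT') auto
  then obtain k where k: "l / 2 \<le> k" "kcoth a k = l + 2 / a" by blast
  then have k0: "0 < k" using assms by linarith
  have "\<exists>!k. 0 < k \<and> l = k / tanh (k * a / 2) - 2 / a"
  proof (rule ex1I[of _ k])
    show "0 < k \<and> l = k / tanh (k * a / 2) - 2 / a" using k k0 by (simp add: kcoth_def)
    fix k' assume "0 < k' \<and> l = k' / tanh (k' * a / 2) - 2 / a"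
    then have "0 < k'" "kcoth a k' = kcoth a k" using k by (auto simp: kcoth_def)
    then show "k' = k"
      using kcoth_strict_mono[OF assms(2), of k k'] kcoth_strict_mono[OF assms(2), of k' k] k0
      by (cases k k' rule: linorder_cases) auto
  qed
  from theI'[OF this] show "0 < eta l a" "kcoth a (eta l a) = l + 2 / a" unfolding eta_def kcoth_def by auto
qed

section \<open>Solutions of the edge equation\<close>

lemma first_order_ode:
  fixes \<phi> :: "real \<Rightarrow> complex" and c :: real
  assumes S: "convex S" and der: "\<And>x. x \<in> S \<Longrightarrow> (\<phi> has_vector_derivative complex_of_real c * \<phi> x) (at x within S)"
  obtains C where "\<And>x. x \<in> S \<Longrightarrow> \<phi> x = C * complex_of_real (exp (c * x))"
proof -
  have e: "((\<lambda>x. complex_of_real (exp (- c * x))) has_vector_derivative complex_of_real (- c * exp (- c * x))) (at x within S)" for x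
    by (intro has_vector_derivative_of_real) (auto intro!: derivative_eq_intros)
  have "((\<lambda>x. complex_of_real (exp (- c * x)) * \<phi> x) has_vector_derivative 0) (at x within S)" if "x \<in> S" for x
    using has_vector_derivative_mult[OF e der[OF that]] by (simp add: algebra_simps)
  then obtain C where C: "\<And>x. x \<in> S \<Longrightarrow> complex_of_real (exp (- c * x)) * \<phi> x = C"
    using has_vector_derivative_zero_constant[OF S, of "\<lambda>x. complex_of_real (exp (- c * x)) * \<phi> x"] by blast
  have "\<phi> x = C * complex_of_real (exp (c * x))" if "x \<in> S" for x
  proof -
    have "C * complex_of_real (exp (c * x)) = complex_of_real (exp (- c * x) * exp (c * x)) * \<phi> x"
      unfolding C[OF that, symmetric] by simp
    also have "exp (- c * x) * exp (c * x) = 1" by (simp flip: exp_add)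
    finally show ?thesis by simp
  qed
  then show ?thesis using that by blast
qed

text \<open>The operator factors: D + c \<psi> with c = k or c = - k solves a first-order equation,
  and the two exponentials determine \<psi> and D. Derivatives within \<open>S\<close> include the
  endpoints of closed edges.\<close>

lemma second_order_ode:
  fixes \<psi> D :: "real \<Rightarrow> complex" and k :: real
  assumes S: "convex S" and k: "k > 0"
    and d1: "\<And>x. x \<in> S \<Longrightarrow> (\<psi> has_vector_derivative D x) (at x within S)"
    and d2: "\<And>x. x \<in> S \<Longrightarrow> (D has_vector_derivative complex_of_real (k\<^sup>2) * \<psi> x) (at x within S)"
  obtains C E where
    "\<And>x. x \<in> S \<Longrightarrow> \<psi> x = C * complex_of_real (exp (k * x)) + E * complex_of_real (exp (- k * x))"
    "\<And>x. x \<in> S \<Longrightarrow> D x = complex_of_real k * (C * complex_of_real (exp (k * x)) - E * complex_of_real (exp (- k * x)))"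
proof -
  have "((\<lambda>x. D x + complex_of_real c * \<psi> x) has_vector_derivative complex_of_real c * (D x + complex_of_real c * \<psi> x)) (at x within S)"
    if c: "c\<^sup>2 = k\<^sup>2" and x: "x \<in> S" for c x
  proof -
    have "((\<lambda>x. D x + complex_of_real c * \<psi> x) has_vector_derivative complex_of_real (k\<^sup>2) * \<psi> x + complex_of_real c * D x) (at x within S)"
      by (intro has_vector_derivative_add d2[OF x] has_vector_derivative_mult_right d1[OF x])
    moreover have "complex_of_real c * (D x + complex_of_real c * \<psi> x) = complex_of_real (c\<^sup>2) * \<psi> x + complex_of_real c * D x"
      by (simp add: power2_eq_square algebra_simps)
    ultimately show ?thesis using c by simp
  qed
  note h = this
  obtain C1 where C1: "\<And>x. x \<in> S \<Longrightarrow> D x + complex_of_real k * \<psi> x = C1 * complex_of_real (exp (k * x))"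
    using first_order_ode[OF S h[of k]] by blast
  obtain C2 where C2: "\<And>x. x \<in> S \<Longrightarrow> D x + complex_of_real (- k) * \<psi> x = C2 * complex_of_real (exp (- k * x))"
    using first_order_ode[OF S h[of "- k"]] by auto
  let ?k = "complex_of_real k"
  have k0: "?k \<noteq> 0" using k by simp
  have "\<psi> x = C1 / (2 * ?k) * complex_of_real (exp (k * x)) + (- C2 / (2 * ?k)) * complex_of_real (exp (- k * x))" if "x \<in> S" for x
  proof -
    have "2 * ?k * \<psi> x = C1 * complex_of_real (exp (k * x)) - C2 * complex_of_real (exp (- k * x))"
      unfolding C1[OF that, symmetric] C2[OF that, symmetric] by (simp add: algebra_simps)
    then have "\<psi> x = (C1 * complex_of_real (exp (k * x)) - C2 * complex_of_real (exp (- k * x))) / (2 * ?k)"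
      using k0 by (simp add: field_simps)
    then show ?thesis by (simp add: diff_divide_distrib)
  qed
  moreover have "D x = ?k * (C1 / (2 * ?k) * complex_of_real (exp (k * x)) - (- C2 / (2 * ?k)) * complex_of_real (exp (- k * x)))" if "x \<in> S" for x
  proof -
    have "2 * D x = C1 * complex_of_real (exp (k * x)) + C2 * complex_of_real (exp (- k * x))"
      unfolding C1[OF that, symmetric] C2[OF that, symmetric] by (simp add: algebra_simps)
    then have "D x = (C1 * complex_of_real (exp (k * x)) + C2 * complex_of_real (exp (- k * x))) / 2"
      by (metis nonzero_mult_div_cancel_left zero_neq_numeral)
    also have "\<dots> = ?k * (C1 / (2 * ?k) * complex_of_real (exp (k * x)) - (- C2 / (2 * ?k)) * complex_of_real (exp (- k * x)))"
      using k0 by (simp add: field_simps)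
    finally show ?thesis .
  qed
  ultimately show ?thesis using that by blast
qed

lemma square_integrable_exp_solution:
  fixes C E :: complex and k :: real
  assumes k: "k > 0"
    and int: "(\<lambda>x. (cmod (C * complex_of_real (exp (k * x)) + E * complex_of_real (exp (- k * x))))\<^sup>2) integrable_on {0..}"
  shows "C = 0"
proof (rule ccontr)
  assume "C \<noteq> 0"
  then have C: "cmod C > 0" by simp
  define g where "g = (\<lambda>x. (cmod (C * complex_of_real (exp (k * x)) + E * complex_of_real (exp (- k * x))))\<^sup>2)"
  \<comment> \<open>Since exp t \<ge> t, from \<open>R\<close> on the growing term has modulus at
    least |C| k R = 1 + |E| and so exceeds the decaying one by at least 1.\<close>
  define R where "R = (1 + cmod E) / (cmod C * k)"
  have R: "R \<ge> 0" using C k by (simp add: R_def)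
  have ge1: "1 \<le> g x" if "x \<ge> R" for x
  proof -
    have x0: "x \<ge> 0" using that R by simp
    have "1 + cmod E = cmod C * (k * R)" using C k by (simp add: R_def field_simps)
    also have "\<dots> \<le> cmod C * (k * x)" using that C k by simp
    also have "\<dots> \<le> cmod C * exp (k * x)"
    proof -
      have "k * x \<le> exp (k * x)" using exp_ge_add_one_self[of "k * x"] by linarith
      then show ?thesis using C by simp
    qed
    finally have 1: "1 + cmod E \<le> cmod C * exp (k * x)" .
    have "cmod E * exp (- k * x) \<le> cmod E * 1"
      using k x0 by (intro mult_left_mono) auto
    then have "1 \<le> cmod (C * complex_of_real (exp (k * x))) - cmod (E * complex_of_real (exp (- k * x)))"
      using 1 by (simp add: norm_mult del: of_real_exp)
    also have "\<dots> \<le> cmod (C * complex_of_real (exp (k * x)) + E * complex_of_real (exp (- k * x)))"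
      by (rule norm_diff_ineq)
    finally show ?thesis unfolding g_def by (simp add: one_le_power)
  qed
  have gint: "g integrable_on {0..}" using int by (simp add: g_def)
  define I where "I = integral {0..} g"
  define N where "N = \<bar>I\<bar> + 1"
  have sub: "{R..R + N} \<subseteq> {0..}" using R by auto
  have cont: "continuous_on {R..R + N} g" unfolding g_def by (intro continuous_intros)
  then have gi: "g integrable_on {R..R + N}" by (rule integrable_continuous_interval)
  have "N = integral {R..R + N} (\<lambda>x. 1)" by (simp add: N_def)
  also have "\<dots> \<le> integral {R..R + N} g"
    using ge1 gi by (intro integral_le) auto
  also have "\<dots> \<le> I" unfolding I_def
    using sub gi gint by (intro integral_subset_le) (auto simp: g_def)
  finally show False by (simp add: N_def)
qed

lemma exp_decay_square_integrable:
  fixes E :: complex and k :: real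
  assumes k: "k > 0"
  shows "(\<lambda>x. (cmod (E * complex_of_real (exp (- k * x))))\<^sup>2) integrable_on {0..}"
proof -
  have "((\<lambda>x. exp (- (2 * k) * x)) has_integral exp (- (2 * k) * 0) / (2 * k)) {0..}"
    using k by (intro has_integral_exp_minus_to_infinity) simp
  then have "(\<lambda>x. (cmod E)\<^sup>2 * exp (- (2 * k) * x)) integrable_on {0..}"
    by (intro integrable_on_mult_right) (auto simp: integrable_on_def)
  moreover have "(cmod (E * complex_of_real (exp (- k * x))))\<^sup>2 = (cmod E)\<^sup>2 * exp (- (2 * k) * x)" for x
    by (simp add: norm_mult power_mult_distrib del: of_real_exp flip: exp_double)
  ultimately show ?thesis by simp
qed

section \<open>The Dirichlet-to-Neumann matrix\<close>

text \<open>These are k coth (k a) and - k / sinh (k a), the entries of the Dirichlet-to-Neumann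
  matrix of an interval, written through its eigenvalues on (1, 1) and (1, -1).\<close>

definition dtn_diag :: "real \<Rightarrow> real \<Rightarrow> real" where "dtn_diag a k = (ktanh a k + kcoth a k) / 2"
definition dtn_off :: "real \<Rightarrow> real \<Rightarrow> real" where "dtn_off a k = (ktanh a k - kcoth a k) / 2"

text \<open>As rational functions of exp (k a) the entries match the end derivatives of combinations
  of exp (k x) and exp (- k x).\<close>

lemma dtn_exp:
  assumes "a > 0" "k > 0"
  defines "p \<equiv> exp (k * a)"
  shows "dtn_diag a k = k * (p\<^sup>2 + 1) / (p\<^sup>2 - 1)" "dtn_off a k = - 2 * k * p / (p\<^sup>2 - 1)"
proof -
  have p: "p > 1" using assms by simp
  have "tanh (k * a / 2) = (1 - exp (- 2 * (k * a / 2))) / (1 + exp (- 2 * (k * a / 2)))" by (rule tanh_real_altdef)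
  also have "exp (- 2 * (k * a / 2)) = 1 / p" by (simp add: p_def exp_minus field_simps)
  also have "(1 - 1 / p) / (1 + 1 / p) = (p * (1 - 1 / p)) / (p * (1 + 1 / p))" using p by simp
  also have "\<dots> = (p - 1) / (p + 1)" using p by (simp add: right_diff_distrib distrib_left)
  finally have th: "tanh (k * a / 2) = (p - 1) / (p + 1)" .
  have t: "ktanh a k = k * (p - 1) / (p + 1)" and c: "kcoth a k = k * (p + 1) / (p - 1)"
    unfolding ktanh_def kcoth_def th using p by (auto simp: field_simps)
  have f: "p\<^sup>2 - 1 = (p - 1) * (p + 1)" by (simp add: power2_eq_square algebra_simps)
  have nz: "p - 1 \<noteq> 0" "p + 1 \<noteq> 0" using p by auto
  show "dtn_diag a k = k * (p\<^sup>2 + 1) / (p\<^sup>2 - 1)" "dtn_off a k = - 2 * k * p / (p\<^sup>2 - 1)"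
    unfolding dtn_diag_def dtn_off_def t c f using nz
    by (auto simp: divide_simps) (auto simp: algebra_simps power2_eq_square)
qed

locale metric_graph =
  fixes ne ni :: nat and a :: "nat \<Rightarrow> real"
  assumes ni_pos: "ni \<ge> 1" and a_pos: "\<And>i. i < ni \<Longrightarrow> a i > 0"
begin

abbreviation d :: nat where "d \<equiv> dimK ne ni"

lemma sum_dimK:
  fixes f :: "nat \<Rightarrow> 'b::comm_monoid_add"
  shows "sum f {..<d} = sum f {..<ne} + (\<Sum>i<ni. f (ne + i) + f (ne + ni + i))"
proof -
  have split: "sum f {..<p + q} = sum f {..<p} + (\<Sum>i<q. f (p + i))" for p q
    by (induction q) (auto simp: add.assoc)
  have "sum f {..<d} = sum f {..<(ne + ni) + ni}" by (simp add: dimK_def mult_2 add.assoc)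
  then show ?thesis unfolding split sum.distrib by (simp only: add.assoc)
qed

text \<open>The matrix mapping \<open>\<psi>\<close> to \<open>- \<psi>'\<close> at the ends of the edges, for solutions of \<open>\<psi>'' = k\<^sup>2 \<psi>\<close> that are square
integrable on the external edges.\<close>

definition dtn :: "real \<Rightarrow> complex mat" where
  "dtn k = mat d d (\<lambda>(r, c). complex_of_real (
     if r < ne then (if c = r then k else 0)
     else if r < ne + ni then (if c = r then dtn_diag (a (r - ne)) k else if c = r + ni then dtn_off (a (r - ne)) k else 0)
     else (if c = r then dtn_diag (a (r - ne - ni)) k else if c + ni = r \<and> ne \<le> c then dtn_off (a (r - ne - ni)) k else 0)))"

lemma dtn_carrier [simp]: "dtn k \<in> carrier_mat d d"
  by (simp add: dtn_def)

lemma dtn_hermitian: "mat_adjoint (dtn k) = dtn k"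
  by (intro eq_matI) (auto simp: adjoint_index dtn_def dimK_def)

lemma dtn_mult:
  assumes u: "u \<in> carrier_vec d"
  shows "r < ne \<Longrightarrow> (dtn k *\<^sub>v u) $ r = complex_of_real k * u $ r"
    and "i < ni \<Longrightarrow> (dtn k *\<^sub>v u) $ (ne + i) = complex_of_real (dtn_diag (a i) k) * u $ (ne + i) + complex_of_real (dtn_off (a i) k) * u $ (ne + ni + i)"
    and "i < ni \<Longrightarrow> (dtn k *\<^sub>v u) $ (ne + ni + i) = complex_of_real (dtn_diag (a i) k) * u $ (ne + ni + i) + complex_of_real (dtn_off (a i) k) * u $ (ne + i)"
proof -
  note ms = mult_mat_vec_sum[OF dtn_carrier u]
  show "(dtn k *\<^sub>v u) $ r = complex_of_real k * u $ r" if r: "r < ne"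
  proof -
    have rd: "r < d" using r by (simp add: dimK_def)
    have "(dtn k *\<^sub>v u) $ r = (\<Sum>c<d. if c = r then complex_of_real k * u $ r else 0)"
      unfolding ms[OF rd] using r rd by (intro sum.cong refl) (auto simp: dtn_def)
    then show ?thesis using rd by simp
  qed
  show "(dtn k *\<^sub>v u) $ (ne + i) = complex_of_real (dtn_diag (a i) k) * u $ (ne + i) + complex_of_real (dtn_off (a i) k) * u $ (ne + ni + i)" if i: "i < ni"
  proof -
    have rd: "ne + i < d" "ne + ni + i < d" using i by (auto simp: dimK_def)
    have "(dtn k *\<^sub>v u) $ (ne + i) = (\<Sum>c<d. (if c = ne + i then complex_of_real (dtn_diag (a i) k) * u $ (ne + i) else 0)
        + (if c = ne + ni + i then complex_of_real (dtn_off (a i) k) * u $ (ne + ni + i) else 0))"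
      unfolding ms[OF rd(1)] using i rd by (intro sum.cong refl) (auto simp: dtn_def)
    then show ?thesis using rd by (simp add: sum.distrib)
  qed
  show "(dtn k *\<^sub>v u) $ (ne + ni + i) = complex_of_real (dtn_diag (a i) k) * u $ (ne + ni + i) + complex_of_real (dtn_off (a i) k) * u $ (ne + i)" if i: "i < ni"
  proof -
    have rd: "ne + i < d" "ne + ni + i < d" using i by (auto simp: dimK_def)
    have "(dtn k *\<^sub>v u) $ (ne + ni + i) = (\<Sum>c<d. (if c = ne + ni + i then complex_of_real (dtn_diag (a i) k) * u $ (ne + ni + i) else 0)
        + (if c = ne + i then complex_of_real (dtn_off (a i) k) * u $ (ne + i) else 0))"
      unfolding ms[OF rd(2)] using i rd by (intro sum.cong refl) (auto simp: dtn_def)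
    then show ?thesis using rd by (simp add: sum.distrib)
  qed
qed

text \<open>The symmetric and the antisymmetric part of the boundary values on edge \<open>i\<close> carry the weights
\<open>\<tau> i\<close> and \<open>\<sigma> i\<close>; all quadratic forms below are of this shape, so that they can be compared
weight by weight.\<close>

definition weighted :: "real \<Rightarrow> (nat \<Rightarrow> real) \<Rightarrow> (nat \<Rightarrow> real) \<Rightarrow> complex vec \<Rightarrow> real" where
  "weighted \<alpha> \<tau> \<sigma> u = (\<Sum>e<ne. \<alpha> * (cmod (u $ e))\<^sup>2)
     + (\<Sum>i<ni. \<tau> i * ((cmod (u $ (ne + i) + u $ (ne + ni + i)))\<^sup>2 / 2) + \<sigma> i * ((cmod (u $ (ne + i) - u $ (ne + ni + i)))\<^sup>2 / 2))"

lemma parallelogram: "(cmod (x + y))\<^sup>2 + (cmod (x - y))\<^sup>2 = 2 * (cmod x)\<^sup>2 + 2 * (cmod y)\<^sup>2"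
  unfolding cmod_power2 by (simp add: power2_eq_square algebra_simps)

text \<open>The factors 1/2 in \<open>weighted\<close> are chosen so that, by the parallelogram law,
  equal weights give back the norm.\<close>

lemma weighted_const:
  assumes "u \<in> carrier_vec d"
  shows "weighted c (\<lambda>_. c) (\<lambda>_. c) u = c * sqnorm u"
proof -
  have "c * ((cmod (x + y))\<^sup>2 / 2) + c * ((cmod (x - y))\<^sup>2 / 2) = c * (cmod x)\<^sup>2 + c * (cmod y)\<^sup>2" for x y
  proof -
    have "c * ((cmod (x + y))\<^sup>2 / 2) + c * ((cmod (x - y))\<^sup>2 / 2) = c * (((cmod (x + y))\<^sup>2 + (cmod (x - y))\<^sup>2) / 2)"
      by (simp only: distrib_left add_divide_distrib)
    then show ?thesis unfolding parallelogram by (simp add: distrib_left)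
  qed
  then show ?thesis
    unfolding weighted_def sqnorm_sum[OF assms] sum_dimK by (simp add: sum_distrib_left distrib_left)
qed

lemma weighted_mono:
  assumes "\<alpha> \<le> \<alpha>'" "\<And>i. i < ni \<Longrightarrow> \<tau> i \<le> \<tau>' i" "\<And>i. i < ni \<Longrightarrow> \<sigma> i \<le> \<sigma>' i"
  shows "weighted \<alpha> \<tau> \<sigma> u \<le> weighted \<alpha>' \<tau>' \<sigma>' u"
  unfolding weighted_def using assms by (intro add_mono sum_mono mult_right_mono) auto

lemma weighted_diff:
  "weighted (\<alpha> - \<alpha>') (\<lambda>i. \<tau> i - \<tau>' i) (\<lambda>i. \<sigma> i - \<sigma>' i) u = weighted \<alpha> \<tau> \<sigma> u - weighted \<alpha>' \<tau>' \<sigma>' u"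
  unfolding weighted_def left_diff_distrib sum_subtractf sum.distrib by simp

text \<open>The symmetric weights may vanish: in the equality case \<open>\<tau> i\<close> is zero
  on the shortest edges, and there the symmetric part stays free.\<close>

lemma weighted_eq_0:
  assumes u: "u \<in> carrier_vec d" and nn: "\<alpha> > 0" "\<And>i. i < ni \<Longrightarrow> \<tau> i \<ge> 0" "\<And>i. i < ni \<Longrightarrow> \<sigma> i > 0"
    and 0: "weighted \<alpha> \<tau> \<sigma> u = 0"
  shows "\<And>e. e < ne \<Longrightarrow> u $ e = 0" "\<And>i. i < ni \<Longrightarrow> u $ (ne + i) = u $ (ne + ni + i)"
    "\<And>i. i < ni \<Longrightarrow> \<tau> i > 0 \<Longrightarrow> u $ (ne + i) = 0"
proof -
  let ?f = "\<lambda>e. \<alpha> * (cmod (u $ e))\<^sup>2"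
  let ?s = "\<lambda>i. \<tau> i * ((cmod (u $ (ne + i) + u $ (ne + ni + i)))\<^sup>2 / 2)"
  let ?t = "\<lambda>i. \<sigma> i * ((cmod (u $ (ne + i) - u $ (ne + ni + i)))\<^sup>2 / 2)"
  have f: "?f e \<ge> 0" for e using nn by simp
  have s: "?s i \<ge> 0" and t: "?t i \<ge> 0" if "i < ni" for i using nn(2,3)[OF that] by auto
  have sf: "sum ?f {..<ne} \<ge> 0" using f by (rule sum_nonneg)
  have sst: "(\<Sum>i<ni. ?s i + ?t i) \<ge> 0" using s t by (intro sum_nonneg add_nonneg_nonneg) auto
  have z: "sum ?f {..<ne} = 0" "(\<Sum>i<ni. ?s i + ?t i) = 0"
    using 0 sf sst unfolding weighted_def by linarith+
  show "u $ e = 0" if "e < ne" for e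
    using z(1) f nn(1) that by (subst (asm) sum_nonneg_eq_0_iff) auto
  have st: "?s i + ?t i = 0" if "i < ni" for i
    using z(2) s t that by (subst (asm) sum_nonneg_eq_0_iff) (auto intro: add_nonneg_nonneg)
  show eq: "u $ (ne + i) = u $ (ne + ni + i)" if i: "i < ni" for i
  proof -
    have "?t i = 0" using st[OF i] s[OF i] t[OF i] by linarith
    then show ?thesis using nn(3)[OF i] by simp
  qed
  show "u $ (ne + i) = 0" if i: "i < ni" and "\<tau> i > 0" for i
  proof -
    have "?s i = 0" using st[OF i] s[OF i] t[OF i] by linarith
    then have "u $ (ne + i) + u $ (ne + ni + i) = 0" using that by simp
    then show ?thesis using eq[OF i] by simp
  qed
qed

lemma qform_dtn:
  assumes u: "u \<in> carrier_vec d"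
  shows "qform (dtn k) u = weighted k (\<lambda>i. ktanh (a i) k) (\<lambda>i. kcoth (a i) k) u"
proof -
  have c: "Re ((complex_of_real p * x + complex_of_real q * y) * cnj x + (complex_of_real p * y + complex_of_real q * x) * cnj y)
      = (p + q) * ((cmod (x + y))\<^sup>2 / 2) + (p - q) * ((cmod (x - y))\<^sup>2 / 2)" for p q x y
    unfolding cmod_power2 by (simp add: power2_eq_square field_simps)
  have "qform (dtn k) u = (\<Sum>r<d. Re ((dtn k *\<^sub>v u) $ r * cnj (u $ r)))"
    unfolding qform_def cscalar_prod_sum[OF u] by simp
  also have "\<dots> = (\<Sum>e<ne. k * (cmod (u $ e))\<^sup>2) + (\<Sum>i<ni. ktanh (a i) k * ((cmod (u $ (ne + i) + u $ (ne + ni + i)))\<^sup>2 / 2) + kcoth (a i) k * ((cmod (u $ (ne + i) - u $ (ne + ni + i)))\<^sup>2 / 2))"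
    unfolding sum_dimK
  proof (rule arg_cong2[where f = "(+)"]; rule sum.cong[OF refl])
    fix e assume "e \<in> {..<ne}"
    then show "Re ((dtn k *\<^sub>v u) $ e * cnj (u $ e)) = k * (cmod (u $ e))\<^sup>2"
      using dtn_mult(1)[OF u, of e k] unfolding cmod_power2
      by (simp add: power2_eq_square algebra_simps del: index_mult_mat_vec)
  next
    fix i assume "i \<in> {..<ni}"
    then have i: "i < ni" by simp
    have pm: "dtn_diag (a i) k + dtn_off (a i) k = ktanh (a i) k" "dtn_diag (a i) k - dtn_off (a i) k = kcoth (a i) k"
      by (auto simp: dtn_diag_def dtn_off_def field_simps)
    show "Re ((dtn k *\<^sub>v u) $ (ne + i) * cnj (u $ (ne + i))) + Re ((dtn k *\<^sub>v u) $ (ne + ni + i) * cnj (u $ (ne + ni + i)))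
      = ktanh (a i) k * ((cmod (u $ (ne + i) + u $ (ne + ni + i)))\<^sup>2 / 2) + kcoth (a i) k * ((cmod (u $ (ne + i) - u $ (ne + ni + i)))\<^sup>2 / 2)"
      unfolding dtn_mult(2,3)[OF u i] plus_complex.sel(1)[symmetric] c pm ..
  qed
  finally show ?thesis by (simp add: weighted_def)
qed

end

section \<open>Eigenfunctions and boundary values\<close>

context metric_graph
begin

section \<open>Edges and indices of boundary vectors\<close>

lemma edge_interval_convex: "convex (edge_interval ne a j)"
  by (simp add: edge_interval_def)

text \<open>Makes derivatives within an edge unique, so that \<open>edge_deriv\<close> can be
  computed; positive lengths guarantee more than one point.\<close>

lemma edge_interval_at_nontrivial:
  assumes "j < ne + ni" "x \<in> edge_interval ne a j"
  shows "at x within edge_interval ne a j \<noteq> bot"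
proof -
  have "edge_interval ne a j \<noteq> {y}" for y
  proof (cases "j < ne")
    case True
    then have "0 \<in> edge_interval ne a j" "1 \<in> edge_interval ne a j" by (auto simp: edge_interval_def)
    then show ?thesis by (metis singletonD zero_neq_one)
  next
    case False
    then have p: "a (j - ne) > 0" using assms(1) a_pos by simp
    then have "0 \<in> edge_interval ne a j" "a (j - ne) \<in> edge_interval ne a j"
      using False by (auto simp: edge_interval_def)
    then show ?thesis using p by (metis singletonD less_irrefl)
  qed
  then have "x islimpt edge_interval ne a j"
    using assms(2) edge_interval_convex by (intro connected_imp_perfect convex_connected) auto
  then show ?thesis by (simp add: trivial_limit_within)
qed

lemma zero_in_edge: "j < ne + ni \<Longrightarrow> 0 \<in> edge_interval ne a j"
  by (cases "j < ne") (auto simp: edge_interval_def intro!: less_imp_le[OF a_pos])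

lemma end_in_edge: "i < ni \<Longrightarrow> a i \<in> edge_interval ne a (ne + i)"
  using a_pos[of i] by (auto simp: edge_interval_def)

lemma bval_index:
  "j < ne + ni \<Longrightarrow> bval ne ni a \<psi> $ j = \<psi> j 0"
  "i < ni \<Longrightarrow> bval ne ni a \<psi> $ (ne + ni + i) = \<psi> (ne + i) (a i)"
  by (auto simp: bval_def dimK_def)

lemma bder_index:
  "j < ne + ni \<Longrightarrow> bder ne ni a \<psi> $ j = edge_deriv ne a \<psi> j 0"
  "i < ni \<Longrightarrow> bder ne ni a \<psi> $ (ne + ni + i) = - edge_deriv ne a \<psi> (ne + i) (a i)"
  by (auto simp: bder_def dimK_def)

lemma dimK_cases:
  assumes "r < d"
  obtains "r < ne" | i where "i < ni" "r = ne + i" | i where "i < ni" "r = ne + ni + i"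
proof -
  consider "r < ne" | "ne \<le> r" "r < ne + ni" | "ne + ni \<le> r" by linarith
  then show ?thesis
  proof cases
    case 2
    then show ?thesis using that(2)[of "r - ne"] by auto
  next
    case 3
    then show ?thesis using that(3)[of "r - ne - ni"] assms by (auto simp: dimK_def)
  qed (use that in auto)
qed

text \<open>The coefficient of \<open>exp (k x)\<close> in the solution on edge \<open>j\<close> with boundary values \<open>u\<close>; it vanishes
on external edges by square integrability.\<close>

definition grow :: "real \<Rightarrow> complex vec \<Rightarrow> nat \<Rightarrow> complex" where
  "grow k u j = (if j < ne then 0 else
     (u $ (j + ni) * complex_of_real (exp (k * a (j - ne))) - u $ j) / ((complex_of_real (exp (k * a (j - ne))))\<^sup>2 - 1))"

text \<open>The coefficient of the decaying exponential is the one that gives the value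
  \<open>u $ j\<close> at 0.\<close>

definition sol :: "real \<Rightarrow> complex vec \<Rightarrow> nat \<Rightarrow> real \<Rightarrow> complex" where
  "sol k u j x = grow k u j * complex_of_real (exp (k * x)) + (u $ j - grow k u j) * complex_of_real (exp (- k * x))"

definition dsol :: "real \<Rightarrow> complex vec \<Rightarrow> nat \<Rightarrow> real \<Rightarrow> complex" where
  "dsol k u j x = complex_of_real k * (grow k u j * complex_of_real (exp (k * x)) - (u $ j - grow k u j) * complex_of_real (exp (- k * x)))"

section \<open>Correspondence between eigenfunctions and boundary vectors\<close>

lemma exp_sq_ne_1:
  assumes "k > 0" "i < ni"
  shows "(complex_of_real (exp (k * a i)))\<^sup>2 - 1 \<noteq> 0"
proof -
  have "exp (k * a i) > 1" using assms a_pos by simp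
  then have "(exp (k * a i))\<^sup>2 \<noteq> 1" by (smt (verit) one_less_power pos2)
  then show ?thesis by (metis eq_iff_diff_eq_0 of_real_eq_1_iff of_real_power)
qed

lemma sol_derivative: "(sol k u j has_vector_derivative dsol k u j x) (at x within S)"
proof -
  have e: "((\<lambda>x. complex_of_real (exp (c * x))) has_vector_derivative complex_of_real (c * exp (c * x))) (at x within S)" for c
    by (intro has_vector_derivative_of_real) (auto intro!: derivative_eq_intros)
  have "(sol k u j has_vector_derivative grow k u j * complex_of_real (k * exp (k * x))
      + (u $ j - grow k u j) * complex_of_real (- k * exp (- k * x))) (at x within S)"
    unfolding sol_def[abs_def] by (intro has_vector_derivative_add has_vector_derivative_mult_right e)
  then show ?thesis by (simp add: dsol_def algebra_simps)
qed

lemma dsol_derivative: "(dsol k u j has_vector_derivative complex_of_real (k\<^sup>2) * sol k u j x) (at x within S)"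
proof -
  have e: "((\<lambda>x. complex_of_real (exp (c * x))) has_vector_derivative complex_of_real (c * exp (c * x))) (at x within S)" for c
    by (intro has_vector_derivative_of_real) (auto intro!: derivative_eq_intros)
  have "(dsol k u j has_vector_derivative complex_of_real k * (grow k u j * complex_of_real (k * exp (k * x))
      - (u $ j - grow k u j) * complex_of_real (- k * exp (- k * x)))) (at x within S)"
    unfolding dsol_def[abs_def] by (intro has_vector_derivative_diff has_vector_derivative_mult_right e)
  then show ?thesis by (simp add: sol_def power2_eq_square algebra_simps)
qed

lemma sol_0: "sol k u j 0 = u $ j"
  by (simp add: sol_def)

lemma sol_end:
  assumes "k > 0" "i < ni"
  shows "sol k u (ne + i) (a i) = u $ (ne + ni + i)"
proof -
  define p where "p = complex_of_real (exp (k * a i))"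
  have p: "p\<^sup>2 - 1 \<noteq> 0" using exp_sq_ne_1[OF assms] by (simp add: p_def)
  have p0: "p \<noteq> 0" by (simp add: p_def)
  have pm: "complex_of_real (exp (- k * a i)) = 1 / p" by (simp add: p_def exp_minus inverse_eq_divide)
  have g: "grow k u (ne + i) = (u $ (ne + ni + i) * p - u $ (ne + i)) / (p\<^sup>2 - 1)"
    by (simp add: grow_def p_def add.commute add.left_commute)
  have "(X * p - Y) / (p\<^sup>2 - 1) * p + (Y - (X * p - Y) / (p\<^sup>2 - 1)) * (1 / p) = X" for X Y
    using p p0 by (simp add: divide_simps) (simp add: algebra_simps power2_eq_square)
  then show ?thesis unfolding sol_def g pm p_def[symmetric] .
qed

lemma bval_sol:
  assumes "k > 0" "u \<in> carrier_vec d"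
  shows "bval ne ni a (sol k u) = u"
proof (rule eq_vecI)
  fix r assume "r < dim_vec u"
  then have "r < d" using assms by simp
  then show "bval ne ni a (sol k u) $ r = u $ r"
    by (cases rule: dimK_cases) (auto simp: bval_index sol_0 sol_end[OF assms(1)])
qed (use assms in \<open>auto simp: bval_def\<close>)

text \<open>\<open>bder\<close> collects the derivatives pointing into the edges and
  \<open>dtn\<close> the outward ones, hence the sign. Only the derivatives of \<open>\<psi>\<close>
  are prescribed, so the lemma serves both for a given eigenfunction and for \<open>sol\<close>
  itself.\<close>

lemma bder_eq_dtn:
  assumes k: "k > 0" and u: "u \<in> carrier_vec d"
    and D: "\<And>j x. j < ne + ni \<Longrightarrow> x \<in> edge_interval ne a j \<Longrightarrow> edge_deriv ne a \<psi> j x = dsol k u j x"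
  shows "bder ne ni a \<psi> = - (dtn k *\<^sub>v u)"
proof (rule eq_vecI)
  fix r assume "r < dim_vec (- (dtn k *\<^sub>v u))"
  then have r: "r < d" by (simp add: dtn_def)
  have neg: "(- (dtn k *\<^sub>v u)) $ r = - ((dtn k *\<^sub>v u) $ r)"
    using r by (simp add: dtn_def del: index_mult_mat_vec)
  from r show "bder ne ni a \<psi> $ r = (- (dtn k *\<^sub>v u)) $ r"
    unfolding neg
  proof (cases rule: dimK_cases)
    case 1
    then show "bder ne ni a \<psi> $ r = - ((dtn k *\<^sub>v u) $ r)"
      using D[of r 0] zero_in_edge[of r] dtn_mult(1)[OF u 1]
      by (simp add: bder_index dsol_def grow_def del: index_mult_mat_vec)
  next
    case (2 i)
    define p where "p = complex_of_real (exp (k * a i))"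
    have p: "p\<^sup>2 - 1 \<noteq> 0" using exp_sq_ne_1[OF k 2(1)] by (simp add: p_def)
    have g: "grow k u (ne + i) = (u $ (ne + ni + i) * p - u $ (ne + i)) / (p\<^sup>2 - 1)"
      by (simp add: grow_def p_def add.commute add.left_commute)
    have dd: "complex_of_real (dtn_diag (a i) k) = complex_of_real k * (p\<^sup>2 + 1) / (p\<^sup>2 - 1)"
      and oo: "complex_of_real (dtn_off (a i) k) = - 2 * complex_of_real k * p / (p\<^sup>2 - 1)"
      using dtn_exp[OF a_pos[OF 2(1)] k] by (simp_all add: p_def)
    have "K * ((X * p - Y) / (p\<^sup>2 - 1) - (Y - (X * p - Y) / (p\<^sup>2 - 1)))
        = - (K * (p\<^sup>2 + 1) / (p\<^sup>2 - 1) * Y + - 2 * K * p / (p\<^sup>2 - 1) * X)" for K X Y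
      using p by (simp add: divide_simps) (simp add: algebra_simps power2_eq_square)
    moreover have "bder ne ni a \<psi> $ r = dsol k u (ne + i) 0"
      using D[of "ne + i" 0] zero_in_edge[of "ne + i"] 2 by (simp add: bder_index)
    ultimately show "bder ne ni a \<psi> $ r = - ((dtn k *\<^sub>v u) $ r)"
      unfolding 2(2) dtn_mult(2)[OF u 2(1)] dd oo by (simp add: dsol_def g)
  next
    case (3 i)
    define p where "p = complex_of_real (exp (k * a i))"
    have p: "p\<^sup>2 - 1 \<noteq> 0" using exp_sq_ne_1[OF k 3(1)] by (simp add: p_def)
    have p0: "p \<noteq> 0" by (simp add: p_def)
    have pm: "complex_of_real (exp (- k * a i)) = 1 / p" by (simp add: p_def exp_minus inverse_eq_divide)
    have g: "grow k u (ne + i) = (u $ (ne + ni + i) * p - u $ (ne + i)) / (p\<^sup>2 - 1)"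
      by (simp add: grow_def p_def add.commute add.left_commute)
    have dd: "complex_of_real (dtn_diag (a i) k) = complex_of_real k * (p\<^sup>2 + 1) / (p\<^sup>2 - 1)"
      and oo: "complex_of_real (dtn_off (a i) k) = - 2 * complex_of_real k * p / (p\<^sup>2 - 1)"
      using dtn_exp[OF a_pos[OF 3(1)] k] by (simp_all add: p_def)
    have "K * ((X * p - Y) / (p\<^sup>2 - 1) * p - (Y - (X * p - Y) / (p\<^sup>2 - 1)) * (1 / p))
        = K * (p\<^sup>2 + 1) / (p\<^sup>2 - 1) * X + - 2 * K * p / (p\<^sup>2 - 1) * Y" for K X Y
      using p p0 by (simp add: divide_simps) (simp add: algebra_simps power2_eq_square)
    then have "dsol k u (ne + i) (a i) = (dtn k *\<^sub>v u) $ (ne + ni + i)"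
      unfolding dtn_mult(3)[OF u 3(1)] dd oo dsol_def g pm p_def[symmetric] .
    then show "bder ne ni a \<psi> $ r = - ((dtn k *\<^sub>v u) $ r)"
      using D[of "ne + i" "a i"] end_in_edge[OF 3(1)] 3 by (simp add: bder_index del: index_mult_mat_vec)
  qed
qed (auto simp: bder_def dtn_def)

lemma eigfun_eq_sol:
  assumes k: "k > 0" and eig: "is_eigfun ne ni a A B (- (k\<^sup>2)) \<psi>"
    and j: "j < ne + ni" and x: "x \<in> edge_interval ne a j"
  shows "\<psi> j x = sol k (bval ne ni a \<psi>) j x \<and> edge_deriv ne a \<psi> j x = dsol k (bval ne ni a \<psi>) j x"
proof -
  let ?S = "edge_interval ne a j" and ?u = "bval ne ni a \<psi>"
  have d1: "(\<psi> j has_vector_derivative edge_deriv ne a \<psi> j x) (at x within ?S)" if "x \<in> ?S" for x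
    using eig j that unfolding is_eigfun_def edge_deriv_def by (auto simp: vector_derivative_works)
  have d2: "(edge_deriv ne a \<psi> j has_vector_derivative complex_of_real (k\<^sup>2) * \<psi> j x) (at x within ?S)" if "x \<in> ?S" for x
    using eig j that unfolding is_eigfun_def by auto
  obtain C E where C: "\<And>x. x \<in> ?S \<Longrightarrow> \<psi> j x = C * complex_of_real (exp (k * x)) + E * complex_of_real (exp (- k * x))"
    "\<And>x. x \<in> ?S \<Longrightarrow> edge_deriv ne a \<psi> j x = complex_of_real k * (C * complex_of_real (exp (k * x)) - E * complex_of_real (exp (- k * x)))"
    using second_order_ode[OF edge_interval_convex k d1 d2] by blast
  have u0: "?u $ j = C + E" using C(1)[OF zero_in_edge[OF j]] bval_index(1)[OF j] by simp
  \<comment> \<open>Since C + E is the value at 0, only \<open>C\<close> has to be identified: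
    integrability makes it 0 on external edges, the value at the far end determines it on internal
    ones.\<close>
  have "grow k ?u j = C"
  proof (cases "j < ne")
    case True
    have "(\<lambda>x. (cmod (\<psi> j x))\<^sup>2) integrable_on {0..}" using eig True unfolding is_eigfun_def by auto
    then have "(\<lambda>x. (cmod (C * complex_of_real (exp (k * x)) + E * complex_of_real (exp (- k * x))))\<^sup>2) integrable_on {0..}"
      by (rule integrable_eq) (use C(1) True in \<open>auto simp: edge_interval_def\<close>)
    then have "C = 0" by (rule square_integrable_exp_solution[OF k])
    then show ?thesis using True by (simp add: grow_def)
  next
    case False
    define i where "i = j - ne"
    have i: "i < ni" "j = ne + i" using False j by (auto simp: i_def)
    define p where "p = complex_of_real (exp (k * a i))"
    have p: "p\<^sup>2 - 1 \<noteq> 0" using exp_sq_ne_1[OF k i(1)] by (simp add: p_def)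
    have p0: "p \<noteq> 0" by (simp add: p_def)
    have pm: "complex_of_real (exp (- k * a i)) = 1 / p" by (simp add: p_def exp_minus inverse_eq_divide)
    have "?u $ (j + ni) = \<psi> j (a i)"
      using bval_index(2)[OF i(1), of \<psi>] i(2) by (simp add: ac_simps)
    also have "\<dots> = C * complex_of_real (exp (k * a i)) + E * complex_of_real (exp (- k * a i))"
      by (rule C(1)) (use end_in_edge[OF i(1)] i(2) in simp)
    also have "\<dots> = C * p + E * (1 / p)" unfolding pm p_def[symmetric] ..
    finally have u1: "?u $ (j + ni) = C * p + E * (1 / p)" .
    have "grow k ?u j = ((C * p + E * (1 / p)) * p - (C + E)) / (p\<^sup>2 - 1)"
      using False unfolding grow_def u0 u1 by (simp add: p_def i_def)
    also have "\<dots> = C" using p p0 by (simp add: divide_simps) (simp add: algebra_simps power2_eq_square)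
    finally show ?thesis .
  qed
  then show ?thesis using C x u0 by (simp add: sol_def dsol_def)
qed

lemma eigfun_boundary:
  assumes k: "k > 0" and eig: "is_eigfun ne ni a A B (- (k\<^sup>2)) \<psi>"
  shows "bval ne ni a \<psi> \<in> carrier_vec d"
    "A *\<^sub>v bval ne ni a \<psi> + B *\<^sub>v (- (dtn k *\<^sub>v bval ne ni a \<psi>)) = 0\<^sub>v d"
proof -
  show u: "bval ne ni a \<psi> \<in> carrier_vec d" by (simp add: bval_def)
  have "bder ne ni a \<psi> = - (dtn k *\<^sub>v bval ne ni a \<psi>)"
    using bder_eq_dtn[OF k u] eigfun_eq_sol[OF k eig] by blast
  then show "A *\<^sub>v bval ne ni a \<psi> + B *\<^sub>v (- (dtn k *\<^sub>v bval ne ni a \<psi>)) = 0\<^sub>v d"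
    using eig by (simp add: is_eigfun_def)
qed

lemma sol_is_eigfun:
  assumes k: "k > 0" and u: "u \<in> carrier_vec d" and bc: "A *\<^sub>v u + B *\<^sub>v (- (dtn k *\<^sub>v u)) = 0\<^sub>v d"
  shows "is_eigfun ne ni a A B (- (k\<^sup>2)) (sol k u)"
proof -
  have ed: "edge_deriv ne a (sol k u) j x = dsol k u j x" if "j < ne + ni" "x \<in> edge_interval ne a j" for j x
    unfolding edge_deriv_def
    by (rule vector_derivative_within[OF edge_interval_at_nontrivial[OF that] sol_derivative])
  have "sol k u j differentiable (at x within edge_interval ne a j)" for j x
    using sol_derivative by (rule differentiableI_vector)
  moreover have "(edge_deriv ne a (sol k u) j has_vector_derivative (- complex_of_real (- (k\<^sup>2)) * sol k u j x))
      (at x within edge_interval ne a j)" if "j < ne + ni" "x \<in> edge_interval ne a j" for j x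
    by (rule has_vector_derivative_transform[OF that(2) ed[OF that(1)]]) (use dsol_derivative in simp_all)
  moreover have "(\<lambda>x. (cmod (sol k u j x))\<^sup>2) integrable_on {0..}" if "j < ne" for j
    using exp_decay_square_integrable[OF k, of "u $ j"] that by (simp add: sol_def grow_def)
  moreover have "A *\<^sub>v bval ne ni a (sol k u) + B *\<^sub>v bder ne ni a (sol k u) = 0\<^sub>v d"
    using bder_eq_dtn[OF k u ed] bc by (simp add: bval_sol[OF k u])
  ultimately show ?thesis unfolding is_eigfun_def by blast
qed

text \<open>Linearity of \<open>grow\<close> in the boundary vector, in the form that carries a
  linear relation between boundary vectors over to the solutions.\<close>

lemma grow_sum:
  assumes "j < ne + ni"
    and "\<And>r. r < d \<Longrightarrow> (\<Sum>l<n. c l * u l $ r) = 0"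
  shows "(\<Sum>l<n. c l * grow k (u l) j) = 0"
proof (cases "j < ne")
  case False
  define p where "p = complex_of_real (exp (k * a (j - ne)))"
  have jd: "j < d" "j + ni < d" using assms(1) by (auto simp: dimK_def)
  have "(\<Sum>l<n. c l * grow k (u l) j) = (\<Sum>l<n. p / (p\<^sup>2 - 1) * (c l * u l $ (j + ni)) - 1 / (p\<^sup>2 - 1) * (c l * u l $ j))"
    using False by (intro sum.cong refl) (simp add: grow_def p_def diff_divide_distrib algebra_simps)
  also have "\<dots> = p / (p\<^sup>2 - 1) * (\<Sum>l<n. c l * u l $ (j + ni)) - 1 / (p\<^sup>2 - 1) * (\<Sum>l<n. c l * u l $ j)"
    by (simp only: sum_subtractf sum_distrib_left)
  finally show ?thesis using assms(2) jd by simp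
qed (simp add: grow_def)

text \<open>Taking boundary values and \<open>sol k\<close> are mutually inverse linear maps between
  the eigenspace and the vectors on the right, so independence passes in both directions.\<close>

lemma eig_mult_eq:
  assumes k: "k > 0"
  shows "eig_mult ne ni a A B (- (k\<^sup>2)) = Sup {enat n | n. \<exists>vs.
      (\<forall>l<n. vs l \<in> carrier_vec d \<and> A *\<^sub>v vs l + B *\<^sub>v (- (dtn k *\<^sub>v vs l)) = 0\<^sub>v d) \<and> vec_indep d n vs}"
proof -
  have "(\<exists>\<psi>s. (\<forall>l<n. is_eigfun ne ni a A B (- (k\<^sup>2)) (\<psi>s l)) \<and> fun_indep ne a ni n \<psi>s)
    \<longleftrightarrow> (\<exists>vs. (\<forall>l<n. vs l \<in> carrier_vec d \<and> A *\<^sub>v vs l + B *\<^sub>v (- (dtn k *\<^sub>v vs l)) = 0\<^sub>v d) \<and> vec_indep d n vs)"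
    (is "?L \<longleftrightarrow> ?R") for n
  proof
    assume ?L
    then obtain \<psi>s where e: "\<And>l. l < n \<Longrightarrow> is_eigfun ne ni a A B (- (k\<^sup>2)) (\<psi>s l)" and fi: "fun_indep ne a ni n \<psi>s"
      by blast
    define vs where "vs l = bval ne ni a (\<psi>s l)" for l
    have "vec_indep d n vs"
      unfolding vec_indep_def
    proof (intro allI impI)
      fix c l assume c: "\<forall>r<d. (\<Sum>l<n. c l * vs l $ r) = 0" and l: "l < n"
      have "(\<Sum>l<n. c l * \<psi>s l j x) = 0" if jx: "j < ne + ni" "x \<in> edge_interval ne a j" for j x
      proof -
        have gs: "(\<Sum>l<n. c l * grow k (vs l) j) = 0" using grow_sum[OF jx(1)] c by blast
        have us: "(\<Sum>l<n. c l * vs l $ j) = 0" using c jx(1) by (simp add: dimK_def)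
        have "\<psi>s l j x = sol k (vs l) j x" if "l < n" for l
          using eigfun_eq_sol[OF k e[OF that] jx] by (simp add: vs_def)
        then have "(\<Sum>l<n. c l * \<psi>s l j x) = (\<Sum>l<n. c l * sol k (vs l) j x)" by simp
        also have "\<dots> = (\<Sum>l<n. c l * grow k (vs l) j * complex_of_real (exp (k * x))
            + (c l * vs l $ j - c l * grow k (vs l) j) * complex_of_real (exp (- k * x)))"
          by (intro sum.cong refl) (simp add: sol_def algebra_simps)
        also have "\<dots> = (\<Sum>l<n. c l * grow k (vs l) j) * complex_of_real (exp (k * x))
            + ((\<Sum>l<n. c l * vs l $ j) - (\<Sum>l<n. c l * grow k (vs l) j)) * complex_of_real (exp (- k * x))"
          by (simp only: sum.distrib sum_subtractf sum_distrib_right[symmetric])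
        finally show ?thesis using gs us by simp
      qed
      then show "c l = 0" using fi l unfolding fun_indep_def by blast
    qed
    then show ?R using eigfun_boundary[OF k e] by (intro exI[of _ vs]) (auto simp: vs_def)
  next
    assume ?R
    then obtain vs where v: "\<And>l. l < n \<Longrightarrow> vs l \<in> carrier_vec d"
      "\<And>l. l < n \<Longrightarrow> A *\<^sub>v vs l + B *\<^sub>v (- (dtn k *\<^sub>v vs l)) = 0\<^sub>v d" and vi: "vec_indep d n vs" by blast
    have "fun_indep ne a ni n (\<lambda>l. sol k (vs l))"
      unfolding fun_indep_def
    proof (intro allI impI)
      fix c l assume c: "\<forall>j<ne + ni. \<forall>x\<in>edge_interval ne a j. (\<Sum>l<n. c l * sol k (vs l) j x) = 0" and l: "l < n"
      have "(\<Sum>l<n. c l * vs l $ r) = 0" if "r < d" for r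
        using that
      proof (cases rule: dimK_cases)
        case 1
        then show ?thesis using c zero_in_edge[of r] by (auto simp: sol_0 dest!: spec[of _ r])
      next
        case (2 i)
        then show ?thesis using c zero_in_edge[of r] by (auto simp: sol_0 dest!: spec[of _ r])
      next
        case (3 i)
        then show ?thesis using c end_in_edge[of i] sol_end[OF k, of i] by (auto dest!: spec[of _ "ne + i"])
      qed
      then show "c l = 0" using vi l unfolding vec_indep_def by blast
    qed
    then show ?L using sol_is_eigfun[OF k v] by (intro exI[of _ "\<lambda>l. sol k (vs l)"]) auto
  qed
  then show ?thesis unfolding eig_mult_def by simp
qed

end

section \<open>Counting zeros of decreasing branches\<close>

text \<open>Sums the fibre counts over the finitely many values of \<open>f\<close> from
  \<open>t\<close> on. It is one-sided because \<open>m\<close> and the spectrum of L are compared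
  on different ranges in the two directions.\<close>

lemma card_ge_le_of_fibres:
  fixes f :: "'i \<Rightarrow> real" and g :: "'j \<Rightarrow> real"
  assumes I: "finite I" and J: "finite J"
    and le: "\<And>q. t \<le> q \<Longrightarrow> card {i \<in> I. f i = q} \<le> card {j \<in> J. g j = q}"
  shows "card {i \<in> I. t \<le> f i} \<le> card {j \<in> J. t \<le> g j}"
proof -
  define V where "V = f ` I \<inter> {t..}"
  have V: "finite V" using I by (simp add: V_def)
  have "{i \<in> I. t \<le> f i} = (\<Union>q\<in>V. {i \<in> I. f i = q})" by (auto simp: V_def)
  then have "card {i \<in> I. t \<le> f i} = card (\<Union>q\<in>V. {i \<in> I. f i = q})" by simp
  also have "\<dots> = (\<Sum>q\<in>V. card {i \<in> I. f i = q})"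
    using V I by (intro card_UN_disjoint) auto
  also have "\<dots> \<le> (\<Sum>q\<in>V. card {j \<in> J. g j = q})"
    by (intro sum_mono le) (auto simp: V_def)
  also have "\<dots> = card (\<Union>q\<in>V. {j \<in> J. g j = q})"
    using V J by (intro card_UN_disjoint[symmetric]) auto
  also have "\<dots> \<le> card {j \<in> J. t \<le> g j}"
    using J by (intro card_mono) (auto simp: V_def)
  finally show ?thesis .
qed

text \<open>In a decreasing sequence the entries that are at least \<open>t\<close> form an initial
  segment, so their number decides whether it reaches index \<open>i\<close>, the
  \<open>Suc i\<close>-th entry.\<close>

lemma le_card_ge_iff:
  fixes g :: "nat \<Rightarrow> real"
  assumes dec: "\<And>i j. i \<le> j \<Longrightarrow> j < d \<Longrightarrow> g j \<le> g i"
  shows "Suc i \<le> card {l \<in> {..<d}. t \<le> g l} \<longleftrightarrow> i < d \<and> t \<le> g i"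
proof
  assume "i < d \<and> t \<le> g i"
  then have "{..i} \<subseteq> {l \<in> {..<d}. t \<le> g l}" using dec by force
  then have "card {..i} \<le> card {l \<in> {..<d}. t \<le> g l}" by (intro card_mono) auto
  then show "Suc i \<le> card {l \<in> {..<d}. t \<le> g l}" by simp
next
  assume c: "Suc i \<le> card {l \<in> {..<d}. t \<le> g l}"
  show "i < d \<and> t \<le> g i"
  proof (rule ccontr)
    assume n: "\<not> (i < d \<and> t \<le> g i)"
    have "{l \<in> {..<d}. t \<le> g l} \<subseteq> {..<i}"
    proof
      fix l assume l: "l \<in> {l \<in> {..<d}. t \<le> g l}"
      show "l \<in> {..<i}"
      proof (rule ccontr)
        assume "l \<notin> {..<i}"
        then have "g l \<le> g i" "i < d" using l dec[of i l] by auto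
        then show False using n l by auto
      qed
    qed
    then have "card {l \<in> {..<d}. t \<le> g l} \<le> card {..<i}" by (intro card_mono) auto
    then show False using c by simp
  qed
qed

lemma le_card_ge_iff_1:
  fixes \<kappa> :: "nat \<Rightarrow> real"
  assumes dec: "\<forall>i\<in>{1..n}. \<forall>j\<in>{1..n}. i \<le> j \<longrightarrow> \<kappa> j \<le> \<kappa> i" and i: "i \<in> {1..n}"
  shows "i \<le> card {j \<in> {1..n}. t \<le> \<kappa> j} \<longleftrightarrow> t \<le> \<kappa> i"
proof -
  have "{j \<in> {1..n}. t \<le> \<kappa> j} = Suc ` {l \<in> {..<n}. t \<le> \<kappa> (Suc l)}"
  proof
    show "{j \<in> {1..n}. t \<le> \<kappa> j} \<subseteq> Suc ` {l \<in> {..<n}. t \<le> \<kappa> (Suc l)}"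
    proof
      fix j assume "j \<in> {j \<in> {1..n}. t \<le> \<kappa> j}"
      then have "j = Suc (j - 1)" "j - 1 \<in> {l \<in> {..<n}. t \<le> \<kappa> (Suc l)}" by auto
      then show "j \<in> Suc ` {l \<in> {..<n}. t \<le> \<kappa> (Suc l)}" by (rule image_eqI)
    qed
  qed auto
  then have "card {j \<in> {1..n}. t \<le> \<kappa> j} = card {l \<in> {..<n}. t \<le> \<kappa> (Suc l)}"
    by (simp add: card_image)
  moreover obtain i' where "i = Suc i'" "i' < n" using i by (cases i) auto
  ultimately show ?thesis
    using le_card_ge_iff[of n "\<lambda>l. \<kappa> (Suc l)" i' t] dec by auto
qed

text \<open>A strictly decreasing branch \<open>f l\<close> crosses zero at most once, so counting the crossing points
beyond \<open>k\<close> amounts to counting the branches that are nonnegative at \<open>k\<close>.\<close>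

lemma card_crossings:
  fixes f :: "nat \<Rightarrow> real \<Rightarrow> real" and \<kappa> :: "nat \<Rightarrow> real"
  assumes cont: "\<And>l q. l < d \<Longrightarrow> 0 < q \<Longrightarrow> isCont (f l) q"
    and dec: "\<And>l p q. l < d \<Longrightarrow> 0 < p \<Longrightarrow> p < q \<Longrightarrow> f l q < f l p"
    and neg: "\<And>l. l < d \<Longrightarrow> \<exists>K>0. f l K < 0"
    and mult: "\<And>q. 0 < q \<Longrightarrow> card {i \<in> {1..n}. \<kappa> i = q} = card {l. l < d \<and> f l q = 0}"
    and k: "0 < k"
  shows "card {i \<in> {1..n}. k \<le> \<kappa> i} = card {l \<in> {..<d}. 0 \<le> f l k}"
proof -
  define J where "J = {l \<in> {..<d}. 0 \<le> f l k}"
  have "\<exists>q\<ge>k. f l q = 0" if l: "l \<in> J" for l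
  proof -
    have l': "l < d" "0 \<le> f l k" using l by (auto simp: J_def)
    obtain K where K: "K > 0" "f l K < 0" using neg[OF l'(1)] by blast
    have kK: "k \<le> K" using dec[OF l'(1) K(1), of k] K l' by (cases "k \<le> K") auto
    have "\<exists>q\<ge>k. q \<le> K \<and> f l q = 0"
      using l' K kK k cont[OF l'(1)] by (intro IVT2') (auto intro!: continuous_at_imp_continuous_on)
    then show ?thesis by blast
  qed
  \<comment> \<open>\<open>z l\<close> is the zero of branch \<open>l\<close> beyond
    \<open>k\<close>. These zeros and the list \<open>\<kappa>\<close> have the same fibre sizes
    over every value from \<open>k\<close> on.\<close>
  then obtain z where z: "\<And>l. l \<in> J \<Longrightarrow> k \<le> z l \<and> f l (z l) = 0" by metis
  have fibre: "{l \<in> J. z l = q} = {l. l < d \<and> f l q = 0}" if q: "k \<le> q" for q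
  proof (rule Set.set_eqI, rule iffI)
    fix l assume "l \<in> {l \<in> J. z l = q}"
    then show "l \<in> {l. l < d \<and> f l q = 0}" using z by (auto simp: J_def)
  next
    fix l assume l: "l \<in> {l. l < d \<and> f l q = 0}"
    then have "0 \<le> f l k" using dec[of l k q] k q by (cases "k = q") auto
    then have lJ: "l \<in> J" using l by (simp add: J_def)
    have "z l = q"
      using z[OF lJ] l k q dec[of l "z l" q] dec[of l q "z l"] by (cases "z l" q rule: linorder_cases) auto
    then show "l \<in> {l \<in> J. z l = q}" using lJ by simp
  qed
  have J: "finite J" by (simp add: J_def)
  have eq: "card {i \<in> {1..n}. \<kappa> i = q} = card {l \<in> J. z l = q}" if "k \<le> q" for q
    using mult[of q] fibre[OF that] k that by simp
  have "card {i \<in> {1..n}. k \<le> \<kappa> i} = card {l \<in> J. k \<le> z l}"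
    using J eq by (intro antisym card_ge_le_of_fibres) auto
  also have "{l \<in> J. k \<le> z l} = J" using z by auto
  finally show ?thesis by (simp add: J_def)
qed

section \<open>The secular matrix\<close>

locale graph_bvp = metric_graph ne ni a + boundary_conditions "dimK ne ni" A B Q
  for ne ni a A B Q
begin

text \<open>The penalty \<open>k\<close> on the kernel of \<open>B\<close> makes \<open>H k\<close> strictly decreasing in \<open>k\<close> on the whole space
without creating kernel vectors outside the range of \<open>B\<^sup>*\<close>.\<close>

definition H :: "real \<Rightarrow> complex mat" where
  "H k = Lt - P * (dtn k * P) - complex_of_real k \<cdot>\<^sub>m (1\<^sub>m d - P)"

section \<open>Kernel and quadratic form of the secular matrix\<close>

lemma H_carrier [simp]: "H k \<in> carrier_mat d d"
  by (simp add: H_def minus_carrier_mat)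

lemma H_hermitian: "mat_adjoint (H k) = H k"
proof -
  have c: "Lt - P * (dtn k * P) \<in> carrier_mat d d" "complex_of_real k \<cdot>\<^sub>m (1\<^sub>m d - P) \<in> carrier_mat d d"
    "P * (dtn k * P) \<in> carrier_mat d d" "1\<^sub>m d - P \<in> carrier_mat d d"
    by (simp_all add: minus_carrier_mat)
  have "mat_adjoint (P * (dtn k * P)) = P * (dtn k * P)"
    by (simp add: adjoint_mult[of _ d d _ d] P_hermitian dtn_hermitian massoc)
  then show ?thesis
    unfolding H_def adjoint_minus[OF c(1,2)] adjoint_minus[OF Lt_carrier c(3)] adjoint_smult
      adjoint_minus[OF one_carrier_mat P_carrier]
    by (simp add: Lt_hermitian P_hermitian adjoint_one)
qed

lemma H_mult:
  assumes x: "x \<in> carrier_vec d"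
  shows "H k *\<^sub>v x = Lt *\<^sub>v x - P *\<^sub>v (dtn k *\<^sub>v (P *\<^sub>v x)) - complex_of_real k \<cdot>\<^sub>v (x - P *\<^sub>v x)"
  unfolding H_def using x
  by (simp add: minus_mult_distrib_mat_vec[of _ d d] smult_mat_mult_vec[of _ d d] vassoc minus_carrier_mat)

lemma P_P: "x \<in> carrier_vec d \<Longrightarrow> P *\<^sub>v (P *\<^sub>v x) = P *\<^sub>v x"
  by (simp add: vassoc[symmetric] P_idem)

text \<open>\<open>H k\<close> maps \<open>x\<close> to a vector of Ran B* minus \<open>k\<close>
  times the Ker B component of \<open>x\<close>; applying \<open>P\<close> separates the two, so
  both vanish.\<close>

lemma H_kernel:
  assumes x: "x \<in> carrier_vec d" and k: "k > 0"
  shows "H k *\<^sub>v x = 0\<^sub>v d \<longleftrightarrow> P *\<^sub>v x = x \<and> Lt *\<^sub>v x = P *\<^sub>v (dtn k *\<^sub>v x)"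
proof
  assume 0: "H k *\<^sub>v x = 0\<^sub>v d"
  define y where "y = Lt *\<^sub>v x - P *\<^sub>v (dtn k *\<^sub>v (P *\<^sub>v x))"
  define z where "z = x - P *\<^sub>v x"
  have c: "y \<in> carrier_vec d" "z \<in> carrier_vec d" using x by (auto simp: y_def z_def)
  have Py: "P *\<^sub>v y = y"
    using x Lt_in_ran[OF x] by (simp add: y_def mult_minus_distrib_mat_vec[of _ d d] P_P ran_adjB_iff)
  have Pz: "P *\<^sub>v z = 0\<^sub>v d"
    using x by (simp add: z_def mult_minus_distrib_mat_vec[of _ d d] P_P)
  have yz: "y - complex_of_real k \<cdot>\<^sub>v z = 0\<^sub>v d" using 0 H_mult[OF x] by (simp add: y_def z_def)
  then have eq: "y = complex_of_real k \<cdot>\<^sub>v z" using vec_diff_eq_0 c by simp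
  have "y = P *\<^sub>v (complex_of_real k \<cdot>\<^sub>v z)" using Py eq by simp
  also have "\<dots> = complex_of_real k \<cdot>\<^sub>v (P *\<^sub>v z)" using c by (simp add: mult_mat_vec[of _ d d])
  finally have "y = complex_of_real k \<cdot>\<^sub>v 0\<^sub>v d" unfolding Pz .
  then have y0: "y = 0\<^sub>v d" by (intro eq_vecI) auto
  have "z = 0\<^sub>v d"
  proof (rule eq_vecI)
    fix i assume i: "i < dim_vec (0\<^sub>v d :: complex vec)"
    then have "complex_of_real k * z $ i = 0" using y0 eq c by (metis carrier_vecD index_smult_vec(1) index_zero_vec)
    then show "z $ i = 0\<^sub>v d $ i" using k i by simp
  qed (use c in auto)
  then have Px: "P *\<^sub>v x = x" unfolding z_def using vec_diff_eq_0[of x d "P *\<^sub>v x"] x by simp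
  moreover have "Lt *\<^sub>v x = P *\<^sub>v (dtn k *\<^sub>v (P *\<^sub>v x))"
    using y0 vec_diff_eq_0[of "Lt *\<^sub>v x" d "P *\<^sub>v (dtn k *\<^sub>v (P *\<^sub>v x))"] x by (simp add: y_def)
  ultimately show "P *\<^sub>v x = x \<and> Lt *\<^sub>v x = P *\<^sub>v (dtn k *\<^sub>v x)" by simp
next
  assume "P *\<^sub>v x = x \<and> Lt *\<^sub>v x = P *\<^sub>v (dtn k *\<^sub>v x)"
  then have Px: "P *\<^sub>v x = x" and L: "Lt *\<^sub>v x = P *\<^sub>v (dtn k *\<^sub>v x)" by auto
  have w: "P *\<^sub>v (dtn k *\<^sub>v x) \<in> carrier_vec d" using x by simp
  have "x - x = 0\<^sub>v d" "P *\<^sub>v (dtn k *\<^sub>v x) - P *\<^sub>v (dtn k *\<^sub>v x) = 0\<^sub>v d" using x w vec_diff_eq_0 by blast+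
  then show "H k *\<^sub>v x = 0\<^sub>v d" unfolding H_mult[OF x] Px L by simp (intro eq_vecI, auto)
qed

lemma boundary_condition_H:
  assumes x: "x \<in> carrier_vec d" and k: "k > 0"
  shows "A *\<^sub>v x + B *\<^sub>v (- (dtn k *\<^sub>v x)) = 0\<^sub>v d \<longleftrightarrow> H k *\<^sub>v x = 0\<^sub>v d"
proof -
  have v: "- (dtn k *\<^sub>v x) \<in> carrier_vec d" using x by simp
  have "- (dtn k *\<^sub>v x) = - 1 \<cdot>\<^sub>v (dtn k *\<^sub>v x)" by (intro eq_vecI) auto
  then have "P *\<^sub>v (- (dtn k *\<^sub>v x)) = - 1 \<cdot>\<^sub>v (P *\<^sub>v (dtn k *\<^sub>v x))"
    using x by (simp add: mult_mat_vec[of _ d d])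
  then have "Lt *\<^sub>v x + P *\<^sub>v (- (dtn k *\<^sub>v x)) = Lt *\<^sub>v x - P *\<^sub>v (dtn k *\<^sub>v x)"
    by (intro eq_vecI) auto
  then show ?thesis
    using boundary_condition_iff[OF x v] H_kernel[OF x k] vec_diff_eq_0[of "Lt *\<^sub>v x" d "P *\<^sub>v (dtn k *\<^sub>v x)"] x
    by simp
qed

text \<open>The two parts of \<open>x\<close> are orthogonal. The weight \<open>k\<close> on the
  second one lies between \<open>ktanh amin k\<close> and \<open>kcoth amin k\<close> like the other
  weights, which is why the bounds below hold on the whole space.\<close>

lemma qform_H:
  assumes x: "x \<in> carrier_vec d"
  shows "qform (H k) x = qform Lt x - weighted k (\<lambda>i. ktanh (a i) k) (\<lambda>i. kcoth (a i) k) (P *\<^sub>v x)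
      - k * sqnorm (x - P *\<^sub>v x)"
    and "sqnorm x = sqnorm (P *\<^sub>v x) + sqnorm (x - P *\<^sub>v x)"
proof -
  define y where "y = P *\<^sub>v x"
  define z where "z = x - y"
  have c: "y \<in> carrier_vec d" "z \<in> carrier_vec d" using x by (auto simp: y_def z_def)
  have Pz: "P *\<^sub>v z = 0\<^sub>v d"
    using x by (simp add: z_def y_def mult_minus_distrib_mat_vec[of _ d d] P_P)
  have Py: "P *\<^sub>v y = y" using x by (simp add: y_def P_P)
  have zy: "z \<bullet>c y = 0"
    using hermitian_cscalar_prod[OF P_carrier P_hermitian c(2) c(1)] Pz Py c by simp
  have yz: "y \<bullet>c z = 0" using cnj_cscalar_prod[OF c(2) c(1)] zy by simp
  have x_eq: "x = y + z" using x c by (intro eq_vecI) (auto simp: z_def)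
  have split: "w \<bullet>c x = w \<bullet>c y + w \<bullet>c z" if w: "w \<in> carrier_vec d" for w
    unfolding x_eq using w c by (simp add: cscalar_prod_sum[of _ d] sum.distrib algebra_simps)
  have zx: "z \<bullet>c x = z \<bullet>c z" using split[OF c(2)] zy by simp
  have yx: "y \<bullet>c x = y \<bullet>c y" using split[OF c(1)] yz by simp
  have "x \<bullet>c x = (y + z) \<bullet>c x" using x_eq by simp
  also have "\<dots> = y \<bullet>c x + z \<bullet>c x" using c x by (intro add_scalar_prod_distrib[of _ d]) auto
  finally have "x \<bullet>c x = y \<bullet>c y + z \<bullet>c z" using yx zx by simp
  then show "sqnorm x = sqnorm (P *\<^sub>v x) + sqnorm (x - P *\<^sub>v x)"
    by (simp add: sqnorm_def y_def z_def)
  have dx: "(P *\<^sub>v (dtn k *\<^sub>v y)) \<bullet>c x = (dtn k *\<^sub>v y) \<bullet>c y"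
    using hermitian_cscalar_prod[OF P_carrier P_hermitian _ x, of "dtn k *\<^sub>v y"] c by (simp add: y_def)
  have kz: "(complex_of_real k \<cdot>\<^sub>v z) \<bullet>c x = complex_of_real k * (z \<bullet>c z)"
    using cscalar_prod_smult(1)[OF c(2) x] zx by simp
  have "(H k *\<^sub>v x) \<bullet>c x = (Lt *\<^sub>v x - P *\<^sub>v (dtn k *\<^sub>v y)) \<bullet>c x - (complex_of_real k \<cdot>\<^sub>v z) \<bullet>c x"
    unfolding H_mult[OF x] y_def[symmetric] z_def[symmetric]
    using x c by (intro minus_scalar_prod_distrib[of _ d]) auto
  also have "(Lt *\<^sub>v x - P *\<^sub>v (dtn k *\<^sub>v y)) \<bullet>c x = (Lt *\<^sub>v x) \<bullet>c x - (P *\<^sub>v (dtn k *\<^sub>v y)) \<bullet>c x"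
    using x c by (intro minus_scalar_prod_distrib[of _ d]) auto
  finally have "(H k *\<^sub>v x) \<bullet>c x = (Lt *\<^sub>v x) \<bullet>c x - (dtn k *\<^sub>v y) \<bullet>c y - complex_of_real k * (z \<bullet>c z)"
    unfolding dx kz .
  then have "qform (H k) x = qform Lt x - qform (dtn k) y - k * sqnorm z"
    by (simp add: qform_def sqnorm_def)
  then show "qform (H k) x = qform Lt x - weighted k (\<lambda>i. ktanh (a i) k) (\<lambda>i. kcoth (a i) k) (P *\<^sub>v x)
      - k * sqnorm (x - P *\<^sub>v x)"
    using qform_dtn[OF c(1)] by (simp add: y_def z_def)
qed

section \<open>Bounds governed by the shortest edge\<close>

abbreviation amin :: real where "amin \<equiv> a_min ni a"

lemma amin: "0 < amin" "i < ni \<Longrightarrow> amin \<le> a i"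
proof -
  have "amin \<in> a ` {..<ni}" unfolding a_min_def using ni_pos by (intro Min_in) (auto simp: lessThan_empty_iff)
  then show "0 < amin" using a_pos by auto
  show "i < ni \<Longrightarrow> amin \<le> a i" unfolding a_min_def by (intro Min_le) auto
qed

text \<open>Strictness for the antisymmetric and the external weights is what removes these
  components in the equality case.\<close>

lemma ktanh_amin_le:
  assumes "k > 0"
  shows "i < ni \<Longrightarrow> ktanh amin k \<le> ktanh (a i) k" "i < ni \<Longrightarrow> ktanh amin k < kcoth (a i) k" "ktanh amin k < k"
proof -
  show 1: "ktanh amin k < k" by (rule ktanh_less[OF assms])
  show "ktanh amin k \<le> ktanh (a i) k" if "i < ni"
    using amin(2)[OF that] ktanh_strict_mono_length[OF assms, of amin "a i"] by (cases "amin = a i") auto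
  show "ktanh amin k < kcoth (a i) k" if "i < ni"
    using 1 less_kcoth[OF assms a_pos[OF that]] by simp
qed

text \<open>The value \<open>k\<close> separates the two families: every \<open>ktanh\<close> lies
  below it and every \<open>kcoth\<close> above, and shorter edges have larger
  \<open>kcoth\<close>.\<close>

lemma le_kcoth_amin:
  assumes "k > 0"
  shows "i < ni \<Longrightarrow> ktanh (a i) k \<le> kcoth amin k" "i < ni \<Longrightarrow> kcoth (a i) k \<le> kcoth amin k" "k \<le> kcoth amin k"
proof -
  show 1: "k \<le> kcoth amin k" using less_kcoth[OF assms amin(1)] by simp
  show "ktanh (a i) k \<le> kcoth amin k" using 1 ktanh_less[OF assms, of "a i"] by simp
  show "kcoth (a i) k \<le> kcoth amin k" if "i < ni"
    using kcoth_antimono_length[OF assms amin(1) amin(2)[OF that]] .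
qed

lemma qform_H_upper:
  assumes x: "x \<in> carrier_vec d" and k: "k > 0"
  shows "qform (H k) x \<le> qform Lt x + (- ktanh amin k) * sqnorm x"
proof -
  have "ktanh amin k * sqnorm (P *\<^sub>v x) \<le> weighted k (\<lambda>i. ktanh (a i) k) (\<lambda>i. kcoth (a i) k) (P *\<^sub>v x)"
    using weighted_mono[of "ktanh amin k" k "\<lambda>_. ktanh amin k" "\<lambda>i. ktanh (a i) k" "\<lambda>_. ktanh amin k" "\<lambda>i. kcoth (a i) k" "P *\<^sub>v x"]
      ktanh_amin_le[OF k] weighted_const[of "P *\<^sub>v x" "ktanh amin k"] x by (simp add: less_imp_le)
  moreover have "ktanh amin k * sqnorm (x - P *\<^sub>v x) \<le> k * sqnorm (x - P *\<^sub>v x)"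
    using ktanh_amin_le(3)[OF k] sqnorm_nonneg[of "x - P *\<^sub>v x" d] x by (intro mult_right_mono) auto
  ultimately show ?thesis using qform_H(1)[OF x, of k] qform_H(2)[OF x] by (simp add: distrib_left)
qed

lemma qform_H_lower:
  assumes x: "x \<in> carrier_vec d" and k: "k > 0"
  shows "qform Lt x \<le> qform (H k) x + kcoth amin k * sqnorm x"
proof -
  have "weighted k (\<lambda>i. ktanh (a i) k) (\<lambda>i. kcoth (a i) k) (P *\<^sub>v x) \<le> kcoth amin k * sqnorm (P *\<^sub>v x)"
    using weighted_mono[of k "kcoth amin k" "\<lambda>i. ktanh (a i) k" "\<lambda>_. kcoth amin k" "\<lambda>i. kcoth (a i) k" "\<lambda>_. kcoth amin k" "P *\<^sub>v x"]
      le_kcoth_amin[OF k] weighted_const[of "P *\<^sub>v x" "kcoth amin k"] x by simp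
  moreover have "k * sqnorm (x - P *\<^sub>v x) \<le> kcoth amin k * sqnorm (x - P *\<^sub>v x)"
    using le_kcoth_amin(3)[OF k] sqnorm_nonneg[of "x - P *\<^sub>v x" d] x by (intro mult_right_mono) auto
  ultimately show ?thesis using qform_H(1)[OF x, of k] qform_H(2)[OF x] by (simp add: distrib_left)
qed

lemma weighted_nonneg:
  assumes "u \<in> carrier_vec d" "\<alpha> \<ge> 0" "\<And>i. i < ni \<Longrightarrow> \<tau> i \<ge> 0" "\<And>i. i < ni \<Longrightarrow> \<sigma> i \<ge> 0"
  shows "weighted \<alpha> \<tau> \<sigma> u \<ge> 0"
  using weighted_mono[of 0 \<alpha> "\<lambda>_. 0" \<tau> "\<lambda>_. 0" \<sigma> u] weighted_const[OF assms(1), of 0] assms by simp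

text \<open>All weights increase strictly with \<open>k\<close>, so the difference of the forms
  vanishes only if both \<open>P *\<^sub>v x\<close> and \<open>x - P *\<^sub>v x\<close>
  do.\<close>

lemma qform_H_strict:
  assumes x: "x \<in> carrier_vec d" "x \<noteq> 0\<^sub>v d" and p: "0 < p" "p < q"
  shows "qform (H q) x < qform (H p) x"
proof -
  let ?y = "P *\<^sub>v x" and ?z = "x - P *\<^sub>v x"
  let ?w = "weighted (q - p) (\<lambda>i. ktanh (a i) q - ktanh (a i) p) (\<lambda>i. kcoth (a i) q - kcoth (a i) p) ?y"
  have y: "?y \<in> carrier_vec d" and z: "?z \<in> carrier_vec d" using x by auto
  have t: "ktanh (a i) p < ktanh (a i) q" and c: "kcoth (a i) p < kcoth (a i) q" if "i < ni" for i
    using ktanh_strict_mono[OF a_pos[OF that]] kcoth_strict_mono[OF a_pos[OF that]] p by auto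
  have w0: "?w \<ge> 0" using p t c by (intro weighted_nonneg[OF y]) (auto simp: less_imp_le)
  have "?w + (q - p) * sqnorm ?z > 0"
  proof (cases "?y = 0\<^sub>v d")
    case True
    then have "?z = x" using x by simp
    then have "(q - p) * sqnorm ?z > 0" using sqnorm_pos[OF x] p by simp
    then show ?thesis using w0 by simp
  next
    case False
    have "?w \<noteq> 0"
    proof
      assume w: "?w = 0"
      have "?y = 0\<^sub>v d"
      proof (rule eq_vecI)
        fix r assume "r < dim_vec (0\<^sub>v d :: complex vec)"
        then have r: "r < d" by simp
        have qp: "q - p > 0" using p by simp
        have t': "ktanh (a i) q - ktanh (a i) p > 0" and c': "kcoth (a i) q - kcoth (a i) p > 0" if "i < ni" for i
          using t[OF that] c[OF that] by auto
        have zz: "e < ne \<Longrightarrow> ?y $ e = 0" "i < ni \<Longrightarrow> ?y $ (ne + i) = ?y $ (ne + ni + i)" "i < ni \<Longrightarrow> ?y $ (ne + i) = 0" for e i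
          using weighted_eq_0[OF y qp _ _ w] t' c' by (simp_all add: less_imp_le)
        from r have "?y $ r = 0"
        proof (cases rule: dimK_cases)
          case 1
          then show ?thesis by (rule zz(1))
        next
          case (2 i)
          then show ?thesis using zz(3)[OF 2(1)] by simp
        next
          case (3 i)
          then show ?thesis using zz(2)[OF 3(1)] zz(3)[OF 3(1)] by simp
        qed
        then show "?y $ r = 0\<^sub>v d $ r" using r by simp
      qed (use carrier_matD[OF P_carrier] in auto)
      then show False using False by simp
    qed
    moreover have "(q - p) * sqnorm ?z \<ge> 0" using p sqnorm_nonneg[OF z] by simp
    ultimately show ?thesis using w0 by simp
  qed
  then show ?thesis
    using qform_H(1)[OF x(1), of p] qform_H(1)[OF x(1), of q]
    unfolding weighted_diff left_diff_distrib by simp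
qed

text \<open>Weights within \<open>e\<close> of each other move the form by at most \<open>e\<close>
  times the norm; through \<open>eigenvalue_mono\<close> this yields continuity of the sorted
  eigenvalues in \<open>k\<close>.\<close>

lemma qform_H_near:
  assumes x: "x \<in> carrier_vec d" and e: "\<bar>q - p\<bar> \<le> e" "\<And>i. i < ni \<Longrightarrow> \<bar>ktanh (a i) q - ktanh (a i) p\<bar> \<le> e"
    "\<And>i. i < ni \<Longrightarrow> \<bar>kcoth (a i) q - kcoth (a i) p\<bar> \<le> e"
  shows "qform (H p) x \<le> qform (H q) x + e * sqnorm x"
proof -
  let ?y = "P *\<^sub>v x" and ?z = "x - P *\<^sub>v x"
  have y: "?y \<in> carrier_vec d" and z: "?z \<in> carrier_vec d" using x by auto
  have "weighted (q - p) (\<lambda>i. ktanh (a i) q - ktanh (a i) p) (\<lambda>i. kcoth (a i) q - kcoth (a i) p) ?y \<le> weighted e (\<lambda>_. e) (\<lambda>_. e) ?y"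
    using e by (intro weighted_mono) (auto simp: abs_le_iff)
  moreover have "(q - p) * sqnorm ?z \<le> e * sqnorm ?z"
    using e(1) sqnorm_nonneg[OF z] by (intro mult_right_mono) auto
  ultimately show ?thesis
    using qform_H(1)[OF x, of p] qform_H(1)[OF x, of q] qform_H(2)[OF x] weighted_const[OF y, of e]
    unfolding weighted_diff left_diff_distrib by (simp add: distrib_left)
qed

lemma exists_H_decomp:
  obtains U ev where "\<And>k. eigen_decomp d (H k) (U k) (ev k)"
proof -
  have "\<exists>U e. eigen_decomp d (H k) U e" for k
    using hermitian_eigen_decomp[OF H_carrier H_hermitian, of k] by blast
  then show ?thesis using that by metis
qed

section \<open>The equality case\<close>

lemma span_min_iff:
  "x \<in> span_min ne ni a \<longleftrightarrow> x \<in> carrier_vec d \<and> (\<forall>e<ne. x $ e = 0) \<and>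
     (\<forall>i<ni. x $ (ne + i) = x $ (ne + ni + i) \<and> (a i \<noteq> amin \<longrightarrow> x $ (ne + i) = 0))"
proof -
  let ?M = "{i. i < ni \<and> a i = amin}"
  define v where "v c = vec d (\<lambda>k. \<Sum>i\<in>?M. c i * e_int ne ni i $ k)" for c :: "nat \<Rightarrow> complex"
  have span: "span_min ne ni a = range v" by (auto simp: span_min_def v_def)
  have fin: "finite ?M" by simp
  have v1: "v c $ e = 0" if "e < ne" for c e
    using that by (auto simp: v_def e_int_def dimK_def intro!: sum.neutral)
  have v2: "v c $ (ne + j) = (if a j = amin then c j else 0)" if j: "j < ni" for c j
  proof -
    have "v c $ (ne + j) = (\<Sum>i\<in>?M. c i * e_int ne ni i $ (ne + j))"
      using j by (simp add: v_def dimK_def)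
    also have "\<dots> = (\<Sum>i\<in>?M. if i = j then c j else 0)"
      by (rule sum.cong[OF refl]) (use j in \<open>auto simp: e_int_def dimK_def\<close>)
    finally have "v c $ (ne + j) = (\<Sum>i\<in>?M. if i = j then c j else 0)" .
    then show ?thesis using j fin by (simp add: sum.delta)
  qed
  have v3: "v c $ (ne + ni + j) = (if a j = amin then c j else 0)" if j: "j < ni" for c j
  proof -
    have "v c $ (ne + ni + j) = (\<Sum>i\<in>?M. c i * e_int ne ni i $ (ne + ni + j))"
      using j by (simp add: v_def dimK_def)
    also have "\<dots> = (\<Sum>i\<in>?M. if i = j then c j else 0)"
      by (rule sum.cong[OF refl]) (use j in \<open>auto simp: e_int_def dimK_def\<close>)
    finally have "v c $ (ne + ni + j) = (\<Sum>i\<in>?M. if i = j then c j else 0)" .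
    then show ?thesis using j fin by (simp add: sum.delta)
  qed
  have vc: "v c \<in> carrier_vec d" for c by (simp add: v_def)
  show ?thesis
  proof
    assume "x \<in> span_min ne ni a"
    then obtain c where "x = v c" by (auto simp: span)
    then show "x \<in> carrier_vec d \<and> (\<forall>e<ne. x $ e = 0) \<and>
     (\<forall>i<ni. x $ (ne + i) = x $ (ne + ni + i) \<and> (a i \<noteq> amin \<longrightarrow> x $ (ne + i) = 0))"
      using v1 v2 v3 vc by simp
  next
    assume x: "x \<in> carrier_vec d \<and> (\<forall>e<ne. x $ e = 0) \<and>
     (\<forall>i<ni. x $ (ne + i) = x $ (ne + ni + i) \<and> (a i \<noteq> amin \<longrightarrow> x $ (ne + i) = 0))"
    have "x = v (\<lambda>i. x $ (ne + i))"
    proof (rule eq_vecI)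
      fix r assume "r < dim_vec (v (\<lambda>i. x $ (ne + i)))"
      then have "r < d" by (simp add: v_def)
      then show "x $ r = v (\<lambda>i. x $ (ne + i)) $ r"
        by (cases rule: dimK_cases) (use x v1 v2 v3 in auto)
    qed (use x vc in \<open>auto simp: v_def\<close>)
    then show "x \<in> span_min ne ni a" by (auto simp: span)
  qed
qed

lemma dtn_span_min:
  assumes "x \<in> span_min ne ni a"
  shows "dtn k *\<^sub>v x = complex_of_real (ktanh amin k) \<cdot>\<^sub>v x"
proof (rule eq_vecI)
  have x: "x \<in> carrier_vec d" and x0: "\<And>e. e < ne \<Longrightarrow> x $ e = 0"
    and xs: "\<And>i. i < ni \<Longrightarrow> x $ (ne + ni + i) = x $ (ne + i)"
    and xa: "\<And>i. i < ni \<Longrightarrow> a i \<noteq> amin \<Longrightarrow> x $ (ne + i) = 0"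
    using assms by (auto simp: span_min_iff)
  show "dim_vec (dtn k *\<^sub>v x) = dim_vec (complex_of_real (ktanh amin k) \<cdot>\<^sub>v x)" using x by (simp add: dtn_def)
  have pm: "complex_of_real (dtn_diag t k) * y + complex_of_real (dtn_off t k) * y = complex_of_real (ktanh t k) * y" for t y
  proof -
    have "dtn_diag t k + dtn_off t k = ktanh t k" by (simp add: dtn_diag_def dtn_off_def field_simps)
    then show ?thesis by (simp flip: distrib_right of_real_add)
  qed
  fix r assume "r < dim_vec (complex_of_real (ktanh amin k) \<cdot>\<^sub>v x)"
  then have r: "r < d" using x by simp
  then have "(dtn k *\<^sub>v x) $ r = complex_of_real (ktanh amin k) * x $ r"
  proof (cases rule: dimK_cases)
    case 1
    then show ?thesis using dtn_mult(1)[OF x 1] x0 by simp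
  next
    case (2 i)
    then show ?thesis using dtn_mult(2)[OF x 2(1), of k] xs[OF 2(1)] xa[OF 2(1)] pm
      by (cases "a i = amin") (auto simp del: index_mult_mat_vec)
  next
    case (3 i)
    then show ?thesis using dtn_mult(3)[OF x 3(1), of k] xs[OF 3(1)] xa[OF 3(1)] pm
      by (cases "a i = amin") (auto simp del: index_mult_mat_vec)
  qed
  then show "(dtn k *\<^sub>v x) $ r = (complex_of_real (ktanh amin k) \<cdot>\<^sub>v x) $ r" using r x by simp
qed

lemma ker_span_min_imp_H_kernel:
  assumes k: "k > 0" and "ktanh amin k > 0"
    and x: "x \<in> span_min ne ni a" "x \<in> kerL d A B (ktanh amin k)"
  shows "H k *\<^sub>v x = 0\<^sub>v d"
proof -
  have xc: "x \<in> carrier_vec d" and L: "Lt *\<^sub>v x = complex_of_real (ktanh amin k) \<cdot>\<^sub>v x"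
    using x(2) kerL_iff[of "ktanh amin k" x] assms(2) by auto
  have Px: "P *\<^sub>v x = x" using x(2) by (auto simp: kerL_def ran_adjB_iff)
  have "P *\<^sub>v (dtn k *\<^sub>v x) = complex_of_real (ktanh amin k) \<cdot>\<^sub>v x"
    unfolding dtn_span_min[OF x(1)] using Px xc by (simp add: mult_mat_vec[of _ d d])
  then show ?thesis using H_kernel[OF xc k] Px L by simp
qed

text \<open>On the kernel of \<open>H k\<close> the forms of L and \<open>dtn k\<close> agree, so
  \<open>top\<close> forces the form of \<open>dtn k\<close> down to its smallest possible value.
  Components with a larger weight vanish, which leaves \<open>span_min\<close>, and there L x = P
  M(k) x is a multiple of \<open>x\<close>.\<close>

lemma extremal_H_kernel:
  assumes k: "k > 0" and pos: "ktanh amin k > 0" and x: "x \<in> carrier_vec d" and 0: "H k *\<^sub>v x = 0\<^sub>v d"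
    and top: "qform Lt x \<le> ktanh amin k * sqnorm x"
  shows "x \<in> span_min ne ni a \<inter> kerL d A B (ktanh amin k)"
proof -
  let ?m = "ktanh amin k"
  have Px: "P *\<^sub>v x = x" and L: "Lt *\<^sub>v x = P *\<^sub>v (dtn k *\<^sub>v x)" using H_kernel[OF x k] 0 by auto
  have "(P *\<^sub>v (dtn k *\<^sub>v x)) \<bullet>c x = (dtn k *\<^sub>v x) \<bullet>c x"
    using hermitian_cscalar_prod[OF P_carrier P_hermitian _ x, of "dtn k *\<^sub>v x"] Px x by simp
  then have "qform Lt x = qform (dtn k) x" by (simp add: qform_def L)
  then have le: "weighted (k - ?m) (\<lambda>i. ktanh (a i) k - ?m) (\<lambda>i. kcoth (a i) k - ?m) x \<le> 0"
    using top unfolding weighted_diff weighted_const[OF x] qform_dtn[OF x, symmetric] by simp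
  have c: "k - ?m > 0" "\<And>i. i < ni \<Longrightarrow> ktanh (a i) k - ?m \<ge> 0" "\<And>i. i < ni \<Longrightarrow> kcoth (a i) k - ?m > 0"
    using ktanh_amin_le[OF k] by auto
  have "weighted (k - ?m) (\<lambda>i. ktanh (a i) k - ?m) (\<lambda>i. kcoth (a i) k - ?m) x \<ge> 0"
    using c by (intro weighted_nonneg[OF x]) (auto simp: less_imp_le)
  then have w: "weighted (k - ?m) (\<lambda>i. ktanh (a i) k - ?m) (\<lambda>i. kcoth (a i) k - ?m) x = 0" using le by simp
  have z: "e < ne \<Longrightarrow> x $ e = 0" "i < ni \<Longrightarrow> x $ (ne + i) = x $ (ne + ni + i)"
    "i < ni \<Longrightarrow> ktanh (a i) k - ?m > 0 \<Longrightarrow> x $ (ne + i) = 0" for e i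
    using weighted_eq_0[OF x c(1) _ _ w] c(2,3) by simp_all
  have za: "x $ (ne + i) = 0" if i: "i < ni" "a i \<noteq> amin" for i
    using z(3)[OF i(1)] ktanh_strict_mono_length[OF k, of amin "a i"] amin(2)[OF i(1)] i(2) by simp
  have sp: "x \<in> span_min ne ni a" unfolding span_min_iff using z(1,2) za x by blast
  have "Lt *\<^sub>v x = complex_of_real ?m \<cdot>\<^sub>v x"
    unfolding L dtn_span_min[OF sp] using x Px by (simp add: mult_mat_vec[of _ d d])
  then show ?thesis using sp kerL_iff[of ?m x] pos x by simp
qed

section \<open>From multiplicities to the eigenvalue bounds\<close>

lemma zero_smult: "x \<in> carrier_vec d \<Longrightarrow> complex_of_real 0 \<cdot>\<^sub>v x = 0\<^sub>v d"
  by (intro eq_vecI) auto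

lemma eig_mult_H:
  assumes k: "k > 0" and ed: "eigen_decomp d (H k) U e"
  shows "eig_mult ne ni a A B (- (k\<^sup>2)) = enat (card {l. l < d \<and> e l = 0})"
proof -
  have "x \<in> carrier_vec d \<and> A *\<^sub>v x + B *\<^sub>v (- (dtn k *\<^sub>v x)) = 0\<^sub>v d
      \<longleftrightarrow> x \<in> carrier_vec d \<and> H k *\<^sub>v x = complex_of_real 0 \<cdot>\<^sub>v x" for x
    using boundary_condition_H[OF _ k, of x] zero_smult[of x] by auto
  then show ?thesis
    unfolding eig_mult_eq[OF k] ed_multiplicity[OF ed H_carrier, symmetric] by presburger
qed

lemma L_mult_Lt:
  assumes "\<mu> \<noteq> 0" and ed: "eigen_decomp d Lt U e"
  shows "L_mult d A B \<mu> = enat (card {l. l < d \<and> e l = \<mu>})"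
  unfolding L_mult_def ed_multiplicity[OF ed Lt_carrier, symmetric] kerL_iff[OF assms(1)] ..

context
  fixes n :: nat and \<kappa> m :: "nat \<Rightarrow> real"
  assumes kappa_pos: "\<forall>i \<in> {1..n}. \<kappa> i > 0"
    and kappa_mono: "\<forall>i \<in> {1..n}. \<forall>j \<in> {1..n}. i \<le> j \<longrightarrow> \<kappa> j \<le> \<kappa> i"
    and kappa_eigs: "\<forall>k > 0. eig_mult ne ni a A B (- (k\<^sup>2)) = enat (card {i \<in> {1..n}. \<kappa> i = k})"
    and m_pos: "\<forall>i \<in> {1..n}. m i > 0"
    and m_mono: "\<forall>i \<in> {1..n}. \<forall>j \<in> {1..n}. i \<le> j \<longrightarrow> m j \<le> m i"
    and m_eigs: "\<forall>\<mu> > 0. enat (card {i \<in> {1..n}. m i = \<mu>}) \<le> L_mult (dimK ne ni) A B \<mu>"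
    and m_largest: "\<forall>\<mu>. n \<ge> 1 \<and> m n < \<mu> \<longrightarrow>
                       enat (card {i \<in> {1..n}. m i = \<mu>}) = L_mult (dimK ne ni) A B \<mu>"
begin

text \<open>The list may break off inside the multiplicity of its last value \<open>m n\<close>.
  Hence \<open>m_eigs\<close> only bounds the fibres from above, giving \<open>m i\<close> at most
  the eigenvalue at its position; the converse uses \<open>m_largest\<close>, and a strictly larger
  eigenvalue would lie in its range above \<open>m n\<close>.\<close>

lemma m_eq_eigenvalue:
  assumes ed: "eigen_decomp d Lt U e" and i: "i \<in> {1..n}"
  shows "i - 1 < d" "e (i - 1) = m i"
proof -
  note dec = ed_decreasing[OF ed Lt_carrier]
  obtain i' where i': "i = Suc i'" using i by (cases i) auto
  have mn: "m n > 0" "m n \<le> m i" using m_pos m_mono i by auto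
  have "card {j \<in> {1..n}. m i \<le> m j} \<le> card {l \<in> {..<d}. m i \<le> e l}"
  proof (rule card_ge_le_of_fibres)
    fix q assume "m i \<le> q"
    then have q: "q > 0" using mn by simp
    show "card {j \<in> {1..n}. m j = q} \<le> card {l \<in> {..<d}. e l = q}"
      using m_eigs[rule_format, OF q] L_mult_Lt[OF _ ed, of q] q by simp
  qed auto
  moreover have "i \<le> card {j \<in> {1..n}. m i \<le> m j}" using le_card_ge_iff_1[OF m_mono i] by simp
  ultimately have ge: "i' < d \<and> m i \<le> e i'"
    using le_card_ge_iff[of d e i' "m i"] dec i' by auto
  have "\<not> m i < e i'"
  proof
    assume lt: "m i < e i'"
    have "card {l \<in> {..<d}. e i' \<le> e l} \<le> card {j \<in> {1..n}. e i' \<le> m j}"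
    proof (rule card_ge_le_of_fibres)
      fix q assume "e i' \<le> q"
      then have q: "q > 0" "m n < q" using mn lt by auto
      have "n \<ge> 1" using i by simp
      then show "card {l \<in> {..<d}. e l = q} \<le> card {j \<in> {1..n}. m j = q}"
        using m_largest[rule_format, of q] L_mult_Lt[OF _ ed, of q] q by simp
    qed auto
    moreover have "i \<le> card {l \<in> {..<d}. e i' \<le> e l}"
      using le_card_ge_iff[of d e i' "e i'"] dec ge i' by simp
    ultimately have "e i' \<le> m i" using le_card_ge_iff_1[OF m_mono i, of "e i'"] by simp
    then show False using lt by simp
  qed
  then show "i - 1 < d" "e (i - 1) = m i" using ge i' by auto
qed

text \<open>Both bounds and one half of the optimality claim evaluate this criterion at a suitable
  \<open>k\<close>.\<close>

lemma kappa_ge_iff: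
  assumes ed: "\<And>k. eigen_decomp d (H k) (U k) (ev k)" and i: "i \<in> {1..n}" and k: "k > 0"
  shows "k \<le> \<kappa> i \<longleftrightarrow> i - 1 < d \<and> 0 \<le> ev k (i - 1)"
proof -
  obtain V e where edL: "eigen_decomp d Lt V e"
    using hermitian_eigen_decomp[OF Lt_carrier Lt_hermitian] .
  have "card {i \<in> {1..n}. k \<le> \<kappa> i} = card {l \<in> {..<d}. 0 \<le> ev k l}"
  proof (rule card_crossings[where f = "\<lambda>l k. ev k l"])
    fix l q assume l: "l < d" and q: "0 < (q::real)"
    show "isCont (\<lambda>k. ev k l) q"
      unfolding continuous_at
    proof (rule tendstoI)
      fix \<epsilon> :: real assume \<epsilon>: "\<epsilon> > 0"
      define \<delta> where "\<delta> = \<epsilon> / 2"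
      have \<delta>: "\<delta> > 0" "\<delta> < \<epsilon>" using \<epsilon> by (auto simp: \<delta>_def)
      have near: "eventually (\<lambda>p. \<bar>g p - g q\<bar> \<le> \<delta>) (at q)" if "isCont g q" for g :: "real \<Rightarrow> real"
        using tendstoD[OF that[unfolded continuous_at] \<delta>(1)]
        by (rule eventually_mono) (simp add: dist_real_def)
      have "eventually (\<lambda>p. \<bar>p - q\<bar> \<le> \<delta>) (at q)" by (rule near) simp
      moreover have "eventually (\<lambda>p. \<forall>i\<in>{..<ni}. \<bar>ktanh (a i) p - ktanh (a i) q\<bar> \<le> \<delta>) (at q)"
        using continuous_ktanh by (intro eventually_ball_finite ballI near) auto
      moreover have "eventually (\<lambda>p. \<forall>i\<in>{..<ni}. \<bar>kcoth (a i) p - kcoth (a i) q\<bar> \<le> \<delta>) (at q)"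
        using continuous_kcoth[OF q] a_pos by (intro eventually_ball_finite ballI near) auto
      ultimately show "eventually (\<lambda>p. dist (ev p l) (ev q l) < \<epsilon>) (at q)"
      proof eventually_elim
        case (elim p)
        have "ev p l \<le> ev q l + \<delta>"
          using elim by (intro eigenvalue_mono[OF ed H_carrier ed H_carrier l] qform_H_near) (auto simp: abs_minus_commute)
        moreover have "ev q l \<le> ev p l + \<delta>"
          using elim by (intro eigenvalue_mono[OF ed H_carrier ed H_carrier l] qform_H_near) auto
        ultimately show ?case using \<delta>(2) by (simp add: dist_real_def abs_less_iff)
      qed
    qed
  next
    fix l p q assume "l < d" "0 < (p::real)" "p < q"
    then show "ev q l < ev p l"
      by (intro eigenvalue_strict_mono[OF ed H_carrier ed H_carrier] qform_H_strict)
  next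
    fix l assume l: "l < d"
    \<comment> \<open>The form of \<open>H K\<close> is at most that of L minus
      \<open>ktanh amin K\<close> times the norm, so each branch is negative once this constant
      exceeds the eigenvalue of L.\<close>
    obtain K where K: "K > 0" "e l < ktanh amin K" using ktanh_unbounded[OF amin(1)] .
    have "ev K l \<le> e l + (- ktanh amin K)"
      using K by (intro eigenvalue_mono[OF ed H_carrier edL Lt_carrier l] qform_H_upper)
    then show "\<exists>K>0. ev K l < 0" using K by (intro exI[of _ K]) auto
  next
    fix q :: real assume q: "0 < q"
    show "card {i \<in> {1..n}. \<kappa> i = q} = card {l. l < d \<and> ev q l = 0}"
      using kappa_eigs[rule_format, OF q] eig_mult_H[OF q ed] by simp
  qed (rule k)
  moreover obtain i' where "i = Suc i'" using i by (cases i) auto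
  ultimately show ?thesis
    using le_card_ge_iff_1[OF kappa_mono i, of k] le_card_ge_iff[of d "ev k" i' 0] ed_decreasing[OF ed H_carrier]
    by auto
qed

lemma eigenvalue_bounds:
  "(\<forall>i \<in> {1..n}. 0 < \<kappa> i \<and> \<kappa> i \<le> nu (m i) amin)
       \<and> (n \<ge> 1 \<longrightarrow>
           (\<kappa> 1 = nu (m 1) amin \<longleftrightarrow>
             (\<exists>x \<in> span_min ne ni a \<inter> kerL d A B (m 1). x \<noteq> 0\<^sub>v d)))
       \<and> (\<forall>i \<in> {1..n}. m i - 2 / amin > 0 \<longrightarrow> eta (m i - 2 / amin) amin \<le> \<kappa> i)"
proof -
  obtain U ev where ed: "\<And>k. eigen_decomp d (H k) (U k) (ev k)" using exists_H_decomp by blast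
  obtain V e where edL: "eigen_decomp d Lt V e"
    using hermitian_eigen_decomp[OF Lt_carrier Lt_hermitian] .
  note km = m_eq_eigenvalue[OF edL]
  have upper: "\<kappa> i \<le> nu (m i) amin" if i: "i \<in> {1..n}" for i
  proof -
    have k: "\<kappa> i > 0" using kappa_pos i by simp
    have mi: "m i > 0" using m_pos i by simp
    \<comment> \<open>The criterion is read at the eigenvalue itself.\<close>
    have "0 \<le> ev (\<kappa> i) (i - 1)" using kappa_ge_iff[OF ed i k] by simp
    also have "\<dots> \<le> e (i - 1) + (- ktanh amin (\<kappa> i))"
      using k by (intro eigenvalue_mono[OF ed H_carrier edL Lt_carrier km(1)[OF i]] qform_H_upper)
    finally have "ktanh amin (\<kappa> i) \<le> ktanh amin (nu (m i) amin)"
      using km(2)[OF i] nu_ktanh(2)[OF mi amin(1)] by simp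
    then show ?thesis
      using ktanh_strict_mono[OF amin(1), of "nu (m i) amin" "\<kappa> i"] nu_ktanh(1)[OF mi amin(1)] by force
  qed
  have lower: "eta (m i - 2 / amin) amin \<le> \<kappa> i" if i: "i \<in> {1..n}" and l: "m i - 2 / amin > 0" for i
  proof -
    \<comment> \<open>At this point the largest weight \<open>kcoth amin\<close> equals
      \<open>m i\<close>, so passing from L to \<open>H\<close> lowers the eigenvalue
      \<open>m i\<close> at most to 0.\<close>
    let ?k = "eta (m i - 2 / amin) amin"
    have k: "?k > 0" "kcoth amin ?k = m i" using eta_kcoth[OF l amin(1)] by auto
    have "e (i - 1) \<le> ev ?k (i - 1) + kcoth amin ?k"
      using k by (intro eigenvalue_mono[OF edL Lt_carrier ed H_carrier km(1)[OF i]] qform_H_lower)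
    then show ?thesis using kappa_ge_iff[OF ed i k(1)] km[OF i] k(2) by simp
  qed
  have optimal: "\<kappa> 1 = nu (m 1) amin \<longleftrightarrow> (\<exists>x \<in> span_min ne ni a \<inter> kerL d A B (m 1). x \<noteq> 0\<^sub>v d)" if n: "n \<ge> 1"
  proof -
    define k where "k = nu (m 1) amin"
    have 1: "1 \<in> {1..n}" using n by simp
    have m1: "m 1 > 0" using m_pos n by simp
    have k: "k > 0" "ktanh amin k = m 1" using nu_ktanh[OF m1 amin(1)] by (auto simp: k_def)
    have d0: "0 < d" "e 0 = m 1" using km[OF 1] by auto
    show ?thesis
    proof
      assume "\<kappa> 1 = nu (m 1) amin"
      then have "1 \<in> {i \<in> {1..n}. \<kappa> i = k}" using 1 by (simp add: k_def)
      then have "card {i \<in> {1..n}. \<kappa> i = k} > 0" by (subst card_gt_0_iff) auto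
      then have "card {l. l < d \<and> ev k l = 0} > 0"
        using kappa_eigs[rule_format, OF k(1)] eig_mult_H[OF k(1) ed] by simp
      then obtain l where l: "l < d" "ev k l = 0" by (auto simp: card_gt_0_iff)
      obtain x where x: "x \<in> carrier_vec d" "x \<noteq> 0\<^sub>v d" "H k *\<^sub>v x = complex_of_real (ev k l) \<cdot>\<^sub>v x"
        using ed_eigenvector[OF ed H_carrier l(1)] .
      have Hx: "H k *\<^sub>v x = 0\<^sub>v d" using x l zero_smult by simp
      \<comment> \<open>\<open>m 1\<close> is the largest eigenvalue of L, and \<open>k\<close> was
        chosen such that \<open>ktanh amin k\<close> equals it.\<close>
      have "qform Lt x \<le> ktanh amin k * sqnorm x"
        using ed_qform_le[OF edL Lt_carrier x(1) d0(1)] d0(2) k(2) by simp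
      then have "x \<in> span_min ne ni a \<inter> kerL d A B (m 1)"
        using extremal_H_kernel[OF k(1) _ x(1) Hx] k(2) m1 by simp
      then show "\<exists>x \<in> span_min ne ni a \<inter> kerL d A B (m 1). x \<noteq> 0\<^sub>v d" using x(2) by blast
    next
      assume "\<exists>x \<in> span_min ne ni a \<inter> kerL d A B (m 1). x \<noteq> 0\<^sub>v d"
      then obtain x where x: "x \<in> span_min ne ni a" "x \<in> kerL d A B (m 1)" "x \<noteq> 0\<^sub>v d" by blast
      have xc: "x \<in> carrier_vec d" using x(1) by (simp add: span_min_iff)
      have "H k *\<^sub>v x = 0\<^sub>v d" using ker_span_min_imp_H_kernel[OF k(1) _ x(1)] k(2) m1 x(2) by simp
      \<comment> \<open>A kernel vector keeps the largest eigenvalue of \<open>H k\<close>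
        nonnegative, which puts \<open>\<kappa> 1\<close> at or beyond \<open>k\<close>; the upper
        bound gives equality.\<close>
      then have "qform (H k) x = 0" using xc by (simp add: qform_def)
      then have "0 \<le> ev k 0 * sqnorm x"
        using ed_qform_le[OF ed[of k] H_carrier xc d0(1)] by simp
      then have "0 \<le> ev k 0" using sqnorm_pos[OF xc x(3)] by (simp add: zero_le_mult_iff)
      then have "k \<le> \<kappa> 1" using kappa_ge_iff[OF ed 1 k(1)] d0 by simp
      then show "\<kappa> 1 = nu (m 1) amin" using upper[OF 1] by (simp add: k_def)
    qed
  qed
  show ?thesis using upper lower optimal kappa_pos by blast
qed

end

end

theorem theorem3p2:
  fixes ne ni n :: nat and a :: "nat \<Rightarrow> real" and A B :: "complex mat"
    and \<kappa> m :: "nat \<Rightarrow> real"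
  assumes ni_pos: "ni \<ge> 1"
    and a_pos: "\<forall>i < ni. a i > 0"
    and A_dim: "A \<in> carrier_mat (dimK ne ni) (dimK ne ni)"
    and B_dim: "B \<in> carrier_mat (dimK ne ni) (dimK ne ni)"
    and surj: "\<forall>y \<in> carrier_vec (dimK ne ni). \<exists>u \<in> carrier_vec (dimK ne ni).
                 \<exists>v \<in> carrier_vec (dimK ne ni). A *\<^sub>v u + B *\<^sub>v v = y"
    and selfadj: "mat_adjoint (A * mat_adjoint B) = A * mat_adjoint B"
    and kappa_pos: "\<forall>i \<in> {1..n}. \<kappa> i > 0"
    and kappa_mono: "\<forall>i \<in> {1..n}. \<forall>j \<in> {1..n}. i \<le> j \<longrightarrow> \<kappa> j \<le> \<kappa> i"
    and kappa_eigs: "\<forall>k > 0. eig_mult ne ni a A B (- (k\<^sup>2)) = enat (card {i \<in> {1..n}. \<kappa> i = k})"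
    and m_pos: "\<forall>i \<in> {1..n}. m i > 0"
    and m_mono: "\<forall>i \<in> {1..n}. \<forall>j \<in> {1..n}. i \<le> j \<longrightarrow> m j \<le> m i"
    and m_eigs: "\<forall>\<mu> > 0. enat (card {i \<in> {1..n}. m i = \<mu>}) \<le> L_mult (dimK ne ni) A B \<mu>"
    and m_largest: "\<forall>\<mu>. n \<ge> 1 \<and> m n < \<mu> \<longrightarrow>
                       enat (card {i \<in> {1..n}. m i = \<mu>}) = L_mult (dimK ne ni) A B \<mu>"
  shows "(\<forall>i \<in> {1..n}. 0 < \<kappa> i \<and> \<kappa> i \<le> nu (m i) (a_min ni a))
       \<and> (n \<ge> 1 \<longrightarrow>
           (\<kappa> 1 = nu (m 1) (a_min ni a) \<longleftrightarrow>
             (\<exists>x \<in> span_min ne ni a \<inter> kerL (dimK ne ni) A B (m 1). x \<noteq> 0\<^sub>v (dimK ne ni))))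
       \<and> (\<forall>i \<in> {1..n}. m i - 2 / a_min ni a > 0 \<longrightarrow>
           eta (m i - 2 / a_min ni a) (a_min ni a) \<le> \<kappa> i)"
proof -
  obtain Q where Q: "Q \<in> carrier_mat (dimK ne ni) (dimK ne ni)" "mat_adjoint Q * B = mat_adjoint B * Q"
    "B * (mat_adjoint B * Q) = B"
    using range_adjoint_projector[OF B_dim] .
  interpret graph_bvp ne ni a A B Q
    using ni_pos a_pos A_dim B_dim surj selfadj Q by unfold_locales auto
  show ?thesis
    using eigenvalue_bounds[OF kappa_pos kappa_mono kappa_eigs m_pos m_mono m_eigs m_largest] .
qed

end
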